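(* For every $\varepsilon>0$ there are $\delta>0$ and $\lambda(\varepsilon)>0$ such that the following holds. Let $\varphi$ be a (nonzero, real-valued) eigenfunction of the Laplacian on $\mathbb{T}^2$ with eigenvalue $E=\lambda^2$ (in the normalization of the context), where $\lambda>\lambda(\varepsilon)$. Let $\{C_\alpha\}$ be a collection of disjoint regular arcs contained in the nodal set $\mathcal{N}_\varphi$ satisfying $$w(C_\alpha)>\lambda^{-\frac12+\varepsilon}\quad\text{for each }\alpha.$$ Then $$\sum_\alpha \operatorname{length}(C_\alpha)<\lambda^{1-\delta}.$$
   Context: $\mathbb{T}^2=\mathbb{R}^2/\mathbb{Z}^2$ is the standard flat torus and $e(t)=\exp(2\pi i t)$. An eigenfunction with eigenvalue $E=\lambda^2$ (the Laplace eigenvalue is actually $4\pi^2E$; $E$ is an integer which is a sum of two squares) is a nonzero real-valued function $\varphi(x)=\sum_{\xi\in\mathbb{Z}^2,\ |\xi|^2=E}a_\xi\, e(x\cdot\xi)$ with $\overline{a_\xi}=a_{-\xi}$. Its nodal set is $\mathcal{N}_\varphi=\{x\in\mathbb{T}^2:\varphi(x)=0\}$. Regular arc: an arc $C\subset\mathbb{T}^2$ is regular if it admits an arc-length parametrization $\gamma:[0,\ell]\to C$, $0<\ell<1$, which is $C^2$ and such that for some $\kappa>0$ one has $\kappa<|\ddot\gamma|<2\kappa$ pointwise and $2\kappa\ell<1$. Width: for a convex curve $C$ in the plane, the width $w(C)$ is the minimal distance between a pair of parallel supporting lines of the curve. A regular arc in $\mathbb{T}^2$ is viewed as a planar (convex)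 arc by lifting to $\mathbb{R}^2$. *)

theory Defs
  imports "HOL-Analysis.Analysis"
begin

quotient_type torus2 = "real^2" / "\<lambda>x y. \<forall>i. x $ i - y $ i \<in> \<int>"
proof (rule equivpI)
  show "reflp (\<lambda>x y::real^2. \<forall>i. x $ i - y $ i \<in> \<int>)"
    by (auto simp: reflp_def)
  show "symp (\<lambda>x y::real^2. \<forall>i. x $ i - y $ i \<in> \<int>)"
    by (auto simp: symp_def) (metis Ints_minus minus_diff_eq)
  show "transp (\<lambda>x y::real^2. \<forall>i. x $ i - y $ i \<in> \<int>)"
    by (auto simp: transp_def) (metis Ints_add diff_add_cancel add_diff_eq)
qed

lift_definition torus_proj :: "real^2 \<Rightarrow> torus2" is "\<lambda>x. x" .

definition frequency_vec :: "int^2 \<Rightarrow> real^2"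
  where "frequency_vec \<xi> = (\<chi> i. of_int (\<xi> $ i))"

lemma exp_frequency_cong:
  fixes x y :: "real^2"
  assumes "\<forall>i. x $ i - y $ i \<in> \<int>"
  shows "exp (2 * of_real pi * \<i> * of_real (x \<bullet> frequency_vec \<xi>))
       = (exp (2 * of_real pi * \<i> * of_real (y \<bullet> frequency_vec \<xi>)) :: complex)"
proof -
  have "(x - y) \<bullet> frequency_vec \<xi> \<in> \<int>"
    unfolding inner_vec_def frequency_vec_def
    using assms by (intro Ints_sum) (auto intro!: Ints_mult)
  then obtain k :: int where k: "(x - y) \<bullet> frequency_vec \<xi> = of_int k"
    by (auto elim: Ints_cases)
  then have "x \<bullet> frequency_vec \<xi> = y \<bullet> frequency_vec \<xi> + of_int k"
    by (simp add: inner_diff_left)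
  then show ?thesis
    by (subst exp_eq, intro exI[of _ k]) (simp add: algebra_simps)
qed

lift_definition torus_char :: "int^2 \<Rightarrow> torus2 \<Rightarrow> complex"
  is "\<lambda>\<xi> x. exp (2 * of_real pi * \<i> * of_real (x \<bullet> frequency_vec \<xi>))"
  by (rule exp_frequency_cong) blast

definition frequencies :: "real \<Rightarrow> (int^2) set"
  where "frequencies E = {\<xi>. (norm (frequency_vec \<xi>))\<^sup>2 = E}"

lemma finite_frequencies: "finite (frequencies E)"
proof -
  have "frequencies E \<subseteq> (\<lambda>f. \<chi> i. f i) ` (UNIV \<rightarrow>\<^sub>E {- \<lceil>sqrt E\<rceil>..\<lceil>sqrt E\<rceil>})"
  proof
    fix \<xi> assume "\<xi> \<in> frequencies E"
    then have "norm (frequency_vec \<xi>) = sqrt E"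
      by (auto simp: frequencies_def real_sqrt_unique)
    moreover have "\<bar>real_of_int (\<xi> $ i)\<bar> \<le> norm (frequency_vec \<xi>)" for i
      using component_le_norm_cart[of "frequency_vec \<xi>" i] by (simp add: frequency_vec_def)
    ultimately have "\<bar>real_of_int (\<xi> $ i)\<bar> \<le> sqrt E" for i by simp
    then have "real_of_int \<bar>\<xi> $ i\<bar> \<le> of_int \<lceil>sqrt E\<rceil>" for i
      using le_of_int_ceiling order_trans by (metis of_int_abs)
    then have "\<bar>\<xi> $ i\<bar> \<le> \<lceil>sqrt E\<rceil>" for i by (simp only: of_int_le_iff)
    then have "($) \<xi> \<in> UNIV \<rightarrow>\<^sub>E {- \<lceil>sqrt E\<rceil>..\<lceil>sqrt E\<rceil>}"
      by (auto simp: abs_le_iff) (smt (verit))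
    then show "\<xi> \<in> (\<lambda>f. \<chi> i. f i) ` (UNIV \<rightarrow>\<^sub>E {- \<lceil>sqrt E\<rceil>..\<lceil>sqrt E\<rceil>})"
      by (metis (no_types, lifting) image_eqI vec_nth_inverse vec_lambda_eta)
  qed
  then show ?thesis by (rule finite_subset) (intro finite_imageI finite_PiE, auto)
qed

(* E is a real argument: a nonzero \<phi> forces frequencies E to be nonempty, i.e. E to be an
   integer that is a sum of two squares. *)
definition laplace_eigenfunction :: "real \<Rightarrow> (torus2 \<Rightarrow> real) \<Rightarrow> bool"
  where "laplace_eigenfunction E \<phi> \<longleftrightarrow>
    (\<exists>a :: int^2 \<Rightarrow> complex.
       (\<forall>\<xi>\<in>frequencies E. cnj (a \<xi>) = a (- \<xi>)) \<and>
       (\<forall>x. of_real (\<phi> x) = (\<Sum>\<xi>\<in>frequencies E. a \<xi> * torus_char \<xi> x))) \<and>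
    (\<exists>x. \<phi> x \<noteq> 0)"

definition nodal_set :: "(torus2 \<Rightarrow> real) \<Rightarrow> torus2 set"
  where "nodal_set \<phi> = {x. \<phi> x = 0}"

(* A map [0,l] -> T^2 is C^2 iff it has a C^2 lift to the plane, so parametrizations of
   toral arcs are given by their lifts. Since l < 1, the projected map is automatically
   injective on [0,l]. *)
definition regular_param :: "real \<Rightarrow> (real \<Rightarrow> real^2) \<Rightarrow> bool"
  where "regular_param l \<gamma> \<longleftrightarrow> 0 < l \<and> l < 1 \<and>
    (\<exists>\<gamma>' \<gamma>'' \<kappa>.
       (\<forall>t\<in>{0..l}. (\<gamma> has_vector_derivative \<gamma>' t) (at t within {0..l})) \<and>
       (\<forall>t\<in>{0..l}. (\<gamma>' has_vector_derivative \<gamma>'' t) (at t within {0..l})) \<and>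
       continuous_on {0..l} \<gamma>'' \<and>
       (\<forall>t\<in>{0..l}. norm (\<gamma>' t) = 1) \<and>
       0 < \<kappa> \<and> (\<forall>t\<in>{0..l}. \<kappa> < norm (\<gamma>'' t) \<and> norm (\<gamma>'' t) < 2 * \<kappa>) \<and>
       2 * \<kappa> * l < 1)"

definition arc_lift :: "torus2 set \<Rightarrow> real \<Rightarrow> (real \<Rightarrow> real^2) \<Rightarrow> bool"
  where "arc_lift C l \<gamma> \<longleftrightarrow> regular_param l \<gamma> \<and> C = torus_proj ` \<gamma> ` {0..l}"

definition regular_arc :: "torus2 set \<Rightarrow> bool"
  where "regular_arc C \<longleftrightarrow> (\<exists>l \<gamma>. arc_lift C l \<gamma>)"

definition parallel_supporting_lines :: "(real^2) set \<Rightarrow> (real^2) set \<Rightarrow> (real^2) set \<Rightarrow> bool"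
  where "parallel_supporting_lines S L1 L2 \<longleftrightarrow>
    (\<exists>u a b. norm u = 1 \<and> L1 = {x. u \<bullet> x = a} \<and> L2 = {x. u \<bullet> x = b} \<and>
       S \<inter> L1 \<noteq> {} \<and> S \<inter> L2 \<noteq> {} \<and> (\<forall>x\<in>S. a \<le> u \<bullet> x \<and> u \<bullet> x \<le> b))"

definition width :: "(real^2) set \<Rightarrow> real"
  where "width S = Inf {setdist L1 L2 | L1 L2. parallel_supporting_lines S L1 L2}"

definition arc_length :: "torus2 set \<Rightarrow> real"
  where "arc_length C = (THE l. \<exists>\<gamma>. arc_lift C l \<gamma>)"

definition arc_width :: "torus2 set \<Rightarrow> real"
  where "arc_width C = (THE w. \<exists>l \<gamma>. arc_lift C l \<gamma> \<and> w = width (\<gamma> ` {0..l}))"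


(* arc_length and arc_width are well defined: every regular arc has a lift, all of its lifts
   differ by a lattice translation, and they have the same l. *)

lemma regular_param_bounds:
  assumes "regular_param l \<gamma>"
  obtains K where "0 < K" "K * l < 1"
    "\<And>s t. s \<in> {0..l} \<Longrightarrow> t \<in> {0..l} \<Longrightarrow> norm (\<gamma> s - \<gamma> t) \<le> \<bar>s - t\<bar>"
    "\<And>s t. s \<in> {0..l} \<Longrightarrow> t \<in> {0..l} \<Longrightarrow> \<bar>s - t\<bar> - K * \<bar>s - t\<bar>\<^sup>2 \<le> norm (\<gamma> s - \<gamma> t)"
proof -
  from assms obtain \<gamma>' \<gamma>'' \<kappa> where
    d1: "\<And>t. t\<in>{0..l} \<Longrightarrow> (\<gamma> has_vector_derivative \<gamma>' t) (at t within {0..l})" and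
    d2: "\<And>t. t\<in>{0..l} \<Longrightarrow> (\<gamma>' has_vector_derivative \<gamma>'' t) (at t within {0..l})" and
    n1: "\<And>t. t\<in>{0..l} \<Longrightarrow> norm (\<gamma>' t) = 1" and k: "0 < \<kappa>" "2 * \<kappa> * l < 1" and
    n2: "\<And>t. t\<in>{0..l} \<Longrightarrow> norm (\<gamma>'' t) < 2 * \<kappa>"
    unfolding regular_param_def by blast
  have on: "onorm (\<lambda>h::real. h *\<^sub>R v) = norm v" for v :: "real^2"
    using onorm_scaleR_left[of "\<lambda>h::real. h" v]
    by (simp add: bounded_linear_ident onorm_id[unfolded id_def])
  have lip: "norm (\<gamma> s - \<gamma> t) \<le> \<bar>s - t\<bar>" if "s \<in> {0..l}" "t \<in> {0..l}" for s t
    using differentiable_bound[of "{0..l}" \<gamma> "\<lambda>t h. h *\<^sub>R \<gamma>' t" 1 s t] d1 n1 that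
    by (simp add: has_vector_derivative_def on)
  have lip': "norm (\<gamma>' s - \<gamma>' t) \<le> 2 * \<kappa> * \<bar>s - t\<bar>" if "s \<in> {0..l}" "t \<in> {0..l}" for s t
    using differentiable_bound[of "{0..l}" \<gamma>' "\<lambda>t h. h *\<^sub>R \<gamma>'' t" "2 * \<kappa>" s t] d2 n2 that
    by (simp add: has_vector_derivative_def on less_imp_le)
  have "\<bar>s - t\<bar> - 2 * \<kappa> * \<bar>s - t\<bar>\<^sup>2 \<le> norm (\<gamma> s - \<gamma> t)" if st: "s \<in> {0..l}" "t \<in> {0..l}" for s t
  proof -
    let ?S = "closed_segment t s"
    have sub: "?S \<subseteq> {0..l}" using st by (auto simp: closed_segment_eq_real_ivl)
    have "norm (\<gamma> s - \<gamma> t - (s - t) *\<^sub>R \<gamma>' t) \<le> norm (s - t) * (2 * \<kappa> * \<bar>s - t\<bar>)"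
    proof (rule vector_differentiable_bound_linearization[of ?S])
      fix x assume x: "x \<in> ?S"
      show "(\<gamma> has_vector_derivative \<gamma>' x) (at x within ?S)"
        using d1 sub x has_vector_derivative_within_subset by blast
      have "\<bar>x - t\<bar> \<le> \<bar>s - t\<bar>" using x by (auto simp: closed_segment_eq_real_ivl split: if_splits)
      then show "norm (\<gamma>' x - \<gamma>' t) \<le> 2 * \<kappa> * \<bar>s - t\<bar>"
        using lip'[of x t] sub x st k
        by (smt (verit) mult_left_mono subsetD)
    qed auto
    moreover have "norm ((s - t) *\<^sub>R \<gamma>' t) = \<bar>s - t\<bar>" using n1 st by simp
    ultimately show ?thesis
      using norm_triangle_ineq2[of "(s - t) *\<^sub>R \<gamma>' t" "\<gamma> s - \<gamma> t"]
      by (simp add: norm_minus_commute power2_eq_square algebra_simps)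
  qed
  then show ?thesis using that[of "2 * \<kappa>"] k lip by auto
qed

lemma regular_param_lipschitz:
  assumes "regular_param l \<gamma>" "s \<in> {0..l}" "t \<in> {0..l}"
  shows "norm (\<gamma> s - \<gamma> t) \<le> \<bar>s - t\<bar>"
proof -
  obtain K where "\<And>s t. s \<in> {0..l} \<Longrightarrow> t \<in> {0..l} \<Longrightarrow> norm (\<gamma> s - \<gamma> t) \<le> \<bar>s - t\<bar>"
    using regular_param_bounds[OF assms(1)] by blast
  then show ?thesis using assms by blast
qed

lemma regular_param_length_le:
  assumes 1: "regular_param l1 \<gamma>1" and 2: "regular_param l2 \<gamma>2"
    and im: "\<gamma>1 ` {0..l1} = \<gamma>2 ` {0..l2}"
  shows "l2 \<le> l1"
proof -
  obtain K where K: "0 < K" "K * l2 < 1"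
    and lo: "\<And>s t. s \<in> {0..l2} \<Longrightarrow> t \<in> {0..l2} \<Longrightarrow> \<bar>s - t\<bar> - K * \<bar>s - t\<bar>\<^sup>2 \<le> norm (\<gamma>2 s - \<gamma>2 t)"
    using regular_param_bounds[OF 2] by metis
  have up: "norm (\<gamma>1 s - \<gamma>1 t) \<le> \<bar>s - t\<bar>" if "s \<in> {0..l1}" "t \<in> {0..l1}" for s t
    using regular_param_lipschitz[OF 1 that] .
  have pos: "0 < l1" "0 < l2" using 1 2 by (auto simp: regular_param_def)
  define c where "c = 1 - K * l2"
  have c: "c > 0" using K by (simp add: c_def)
  have lipc: "c * \<bar>s - t\<bar> \<le> norm (\<gamma>2 s - \<gamma>2 t)" if st: "s \<in> {0..l2}" "t \<in> {0..l2}" for s t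
  proof -
    have "\<bar>s - t\<bar> \<le> l2" using st by auto
    then have "K * \<bar>s - t\<bar> * \<bar>s - t\<bar> \<le> K * l2 * \<bar>s - t\<bar>"
      using K by (intro mult_right_mono mult_left_mono) auto
    moreover have "K * \<bar>s - t\<bar>\<^sup>2 = K * \<bar>s - t\<bar> * \<bar>s - t\<bar>"
      by (simp add: power2_eq_square mult.assoc del: abs_mult_self_eq)
    moreover have "c * \<bar>s - t\<bar> = \<bar>s - t\<bar> - K * l2 * \<bar>s - t\<bar>"
      by (simp add: c_def left_diff_distrib)
    ultimately show ?thesis using lo[OF st] by linarith
  qed
  have "\<forall>t\<in>{0..l1}. \<exists>s\<in>{0..l2}. \<gamma>2 s = \<gamma>1 t" using im by (metis imageE imageI)
  then obtain h where h: "\<And>t. t \<in> {0..l1} \<Longrightarrow> h t \<in> {0..l2}"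
    "\<And>t. t \<in> {0..l1} \<Longrightarrow> \<gamma>2 (h t) = \<gamma>1 t" by metis
  have onto: "\<exists>t\<in>{0..l1}. h t = s" if s: "s \<in> {0..l2}" for s
  proof -
    have "\<gamma>2 s \<in> \<gamma>1 ` {0..l1}" using im s by blast
    then obtain t where t: "t \<in> {0..l1}" "\<gamma>1 t = \<gamma>2 s" by (metis imageE)
    then have "c * \<bar>h t - s\<bar> \<le> 0" using lipc[OF h(1)[OF t(1)] s] h(2)[OF t(1)] by simp
    then have "h t = s" using c by (simp add: mult_le_0_iff)
    then show ?thesis using t by blast
  qed
  obtain s0 s1 where s: "s0 \<in> {0..l1}" "h s0 = 0" "s1 \<in> {0..l1}" "h s1 = l2"
    using onto[of 0] onto[of l2] pos by auto
  define M where "M = K / c\<^sup>2"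
  have M: "M \<ge> 0" using K by (simp add: M_def)
  have hM: "\<bar>h s - h t\<bar> \<le> \<bar>s - t\<bar> + M * \<bar>s - t\<bar>\<^sup>2" if st: "s \<in> {0..l1}" "t \<in> {0..l1}" for s t
  proof -
    have "c * \<bar>h s - h t\<bar> \<le> \<bar>s - t\<bar>"
      using lipc[OF h(1)[OF st(1)] h(1)[OF st(2)]] up[OF st] h(2) st by simp
    then have "(c * \<bar>h s - h t\<bar>)\<^sup>2 \<le> \<bar>s - t\<bar>\<^sup>2" using c by (intro power_mono) auto
    then have "c\<^sup>2 * \<bar>h s - h t\<bar>\<^sup>2 \<le> \<bar>s - t\<bar>\<^sup>2" by (simp only: power_mult_distrib)
    then have "M * (c\<^sup>2 * \<bar>h s - h t\<bar>\<^sup>2) \<le> M * \<bar>s - t\<bar>\<^sup>2" using M by (rule mult_left_mono)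
    moreover have "M * (c\<^sup>2 * \<bar>h s - h t\<bar>\<^sup>2) = K * \<bar>h s - h t\<bar>\<^sup>2" using c by (simp add: M_def)
    moreover have "\<bar>h s - h t\<bar> - K * \<bar>h s - h t\<bar>\<^sup>2 \<le> \<bar>s - t\<bar>"
      using lo[OF h(1)[OF st(1)] h(1)[OF st(2)]] up[OF st] h(2) st by simp
    ultimately show ?thesis by linarith
  qed
  have "l2 \<le> l1 + M * l1\<^sup>2 / real (Suc n)" for n
  proof -
    define N where "N = real (Suc n)"
    have N: "N > 0" by (simp add: N_def)
    define d where "d = (s1 - s0) / N"
    define p where "p i = s0 + real i * d" for i
    have pN: "p (Suc n) = s1" "p 0 = s0" using N unfolding p_def d_def N_def[symmetric] by simp_all
    have p: "p i \<in> {0..l1}" if i: "i \<le> Suc n" for i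
    proof -
      define u where "u = real i / N"
      have u: "0 \<le> u" "u \<le> 1" using i N by (auto simp: u_def N_def)
      have "p i = (1 - u) * s0 + u * s1" by (simp add: p_def d_def u_def algebra_simps diff_divide_distrib)
      then show ?thesis
        using convexD_alt[OF convex_real_interval(5)[of 0 l1] s(1) s(3) u] by simp
    qed
    have "\<bar>d\<bar> \<le> l1 / N" using s N by (auto simp: d_def abs_divide intro!: divide_right_mono)
    then have dd: "\<bar>d\<bar> + M * \<bar>d\<bar>\<^sup>2 \<le> l1 / N + M * (l1 / N)\<^sup>2"
      using M by (intro add_mono mult_left_mono power_mono) auto
    have step: "\<bar>h (p (Suc i)) - h (p i)\<bar> \<le> l1 / N + M * (l1 / N)\<^sup>2" if "i < Suc n" for i
    proof -
      have "p (Suc i) - p i = d" by (simp add: p_def algebra_simps)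
      then show ?thesis using hM[OF p p, of "Suc i" i] that dd by simp
    qed
    have "l2 = (\<Sum>i<Suc n. h (p (Suc i)) - h (p i))"
      using sum_lessThan_telescope[of "\<lambda>i. h (p i)" "Suc n"] by (simp only: pN s diff_zero)
    also have "\<dots> \<le> (\<Sum>i<Suc n. l1 / N + M * (l1 / N)\<^sup>2)"
      using step by (intro sum_mono) (meson abs_ge_self lessThan_iff order_trans)
    also have "\<dots> = N * (l1 / N + M * (l1 / N)\<^sup>2)" by (simp add: N_def)
    also have "\<dots> = l1 + M * l1\<^sup>2 / N" using N by (simp add: field_simps power2_eq_square)
    finally show ?thesis by (simp add: N_def)
  qed
  moreover have "(\<lambda>n. l1 + M * l1\<^sup>2 / real (Suc n)) \<longlonglongrightarrow> l1 + 0"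
    by (intro tendsto_add tendsto_const LIMSEQ_Suc[OF lim_const_over_n])
  ultimately show ?thesis by (intro LIMSEQ_le_const[of _ "l1 + 0", simplified]) auto
qed

lemma torus_proj_eq_iff: "torus_proj x = torus_proj y \<longleftrightarrow> (\<forall>i. x $ i - y $ i \<in> \<int>)"
  by transfer simp

lemma lattice_norm_less_1:
  fixes v :: "real^2"
  assumes "\<forall>i. v $ i \<in> \<int>" "norm v < 1" shows "v = 0"
proof -
  have "v $ i = 0" for i
  proof (rule Ints_nonzero_abs_less1)
    show "\<bar>v $ i\<bar> < 1" using component_le_norm_cart[of v i] assms(2) by simp
  qed (use assms(1) in blast)
  then show ?thesis by (simp add: vec_eq_iff)
qed

lemma arc_lift_sub:
  assumes 1: "arc_lift C l1 \<gamma>1" and 2: "arc_lift C l2 \<gamma>2"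
  obtains v where "\<forall>i. v $ i \<in> \<int>" "\<gamma>1 ` {0..l1} \<subseteq> (+) v ` \<gamma>2 ` {0..l2}"
proof -
  have r: "regular_param l1 \<gamma>1" "regular_param l2 \<gamma>2" using 1 2 by (auto simp: arc_lift_def)
  have l: "0 < l1" "0 < l2" "l2 < 1" using r by (auto simp: regular_param_def)
  have lip1: "norm (\<gamma>1 s - \<gamma>1 t) \<le> \<bar>s - t\<bar>" if "s \<in> {0..l1}" "t \<in> {0..l1}" for s t
    using regular_param_lipschitz[OF r(1) that] .
  have lip2: "norm (\<gamma>2 s - \<gamma>2 t) \<le> \<bar>s - t\<bar>" if "s \<in> {0..l2}" "t \<in> {0..l2}" for s t
    using regular_param_lipschitz[OF r(2) that] .
  have "\<exists>s. s \<in> {0..l2} \<and> torus_proj (\<gamma>1 t) = torus_proj (\<gamma>2 s)" if "t \<in> {0..l1}" for t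
    using 1 2 that by (auto simp: arc_lift_def image_image) (metis (no_types, lifting) atLeastAtMost_iff imageE imageI)
  then obtain h where h: "\<And>t. t \<in> {0..l1} \<Longrightarrow> h t \<in> {0..l2} \<and> torus_proj (\<gamma>1 t) = torus_proj (\<gamma>2 (h t))"
    by metis
  define n where "n t = \<gamma>1 t - \<gamma>2 (h t)" for t
  have n: "n t $ i \<in> \<int>" if "t \<in> {0..l1}" for t i
    using h[OF that] by (auto simp: n_def torus_proj_eq_iff)
  have loc: "n s = n t" if st: "s \<in> {0..l1}" "t \<in> {0..l1}" "\<bar>s - t\<bar> < 1 - l2" for s t
  proof -
    have "norm (\<gamma>2 (h s) - \<gamma>2 (h t)) \<le> l2"
      using lip2[of "h s" "h t"] h[OF st(1)] h[OF st(2)] by auto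
    moreover have "norm (\<gamma>1 s - \<gamma>1 t) < 1 - l2" using lip1[OF st(1,2)] st(3) by simp
    moreover have "n s - n t = (\<gamma>1 s - \<gamma>1 t) - (\<gamma>2 (h s) - \<gamma>2 (h t))" by (simp add: n_def)
    ultimately have "norm (n s - n t) < 1"
      using norm_triangle_ineq4[of "\<gamma>1 s - \<gamma>1 t" "\<gamma>2 (h s) - \<gamma>2 (h t)"] by simp
    then have "n s - n t = 0" using n[OF st(1)] n[OF st(2)] by (intro lattice_norm_less_1) auto
    then show ?thesis by simp
  qed
  have "n 0 = n t" if "t \<in> {0..l1}" for t
  proof (rule connected_local_const[of "{0..l1}"])
    show "\<forall>a\<in>{0..l1}. eventually (\<lambda>b. n a = n b) (at a within {0..l1})"
    proof
      fix a assume a: "a \<in> {0..l1}"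
      have "\<forall>b\<in>{0..l1}. b \<noteq> a \<and> dist b a < 1 - l2 \<longrightarrow> n a = n b"
        using loc[of a] a by (simp add: dist_real_def abs_minus_commute)
      moreover have "0 < 1 - l2" using l by simp
      ultimately show "eventually (\<lambda>b. n a = n b) (at a within {0..l1})"
        unfolding eventually_at by blast
    qed
    show "connected {0..l1}" by simp
    show "0 \<in> {0..l1}" using l by simp
    show "t \<in> {0..l1}" by (rule that)
  qed
  then have "\<gamma>1 t = n 0 + \<gamma>2 (h t)" if "t \<in> {0..l1}" for t
    using that by (simp add: n_def)
  then have "\<gamma>1 ` {0..l1} \<subseteq> (+) (n 0) ` \<gamma>2 ` {0..l2}" using h by fastforce
  then show ?thesis using that[of "n 0"] n l by simp
qed

lemma arc_lift_unique:
  assumes 1: "arc_lift C l1 \<gamma>1" and 2: "arc_lift C l2 \<gamma>2"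
  shows "\<exists>v. (\<forall>i. v $ i \<in> \<int>) \<and> \<gamma>1 ` {0..l1} = (+) v ` \<gamma>2 ` {0..l2}"
proof -
  obtain v where v: "\<forall>i. v $ i \<in> \<int>" "\<gamma>1 ` {0..l1} \<subseteq> (+) v ` \<gamma>2 ` {0..l2}"
    using arc_lift_sub[OF 1 2] .
  obtain w where w: "\<forall>i. w $ i \<in> \<int>" "\<gamma>2 ` {0..l2} \<subseteq> (+) w ` \<gamma>1 ` {0..l1}"
    using arc_lift_sub[OF 2 1] .
  have r: "regular_param l1 \<gamma>1" using 1 by (auto simp: arc_lift_def)
  have l: "0 < l1" "l1 < 1" using r by (auto simp: regular_param_def)
  have "\<gamma>1 0 \<in> \<gamma>1 ` {0..l1}" using l by simp
  then have "\<gamma>1 0 \<in> (+) v ` (+) w ` \<gamma>1 ` {0..l1}" using v(2) w(2) by blast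
  then obtain t where t: "t \<in> {0..l1}" "\<gamma>1 0 = v + (w + \<gamma>1 t)" by auto
  have "norm (\<gamma>1 0 - \<gamma>1 t) \<le> \<bar>0 - t\<bar>" using regular_param_lipschitz[OF r _ t(1), of 0] l by simp
  then have "norm (v + w) < 1" using t l by (auto simp: algebra_simps)
  then have "v + w = 0" using v w by (intro lattice_norm_less_1) auto
  then have "w = - v" by (simp add: add_eq_0_iff)
  then have "(+) v ` \<gamma>2 ` {0..l2} \<subseteq> (+) v ` (+) (- v) ` \<gamma>1 ` {0..l1}" using w(2) by blast
  then have "(+) v ` \<gamma>2 ` {0..l2} \<subseteq> \<gamma>1 ` {0..l1}" by (simp add: image_image)
  then show ?thesis using v by blast
qed

lemma regular_param_translate:
  assumes "regular_param l \<gamma>" shows "regular_param l (\<lambda>t. v + \<gamma> t)"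
proof -
  have "((\<lambda>t. v + \<gamma> t) has_vector_derivative d) (at t within S)"
    if "(\<gamma> has_vector_derivative d) (at t within S)" for d t S
    using has_vector_derivative_add[OF has_vector_derivative_const[of v] that] by simp
  with assms show ?thesis unfolding regular_param_def by blast
qed

lemma setdist_translation_eq: "setdist ((+) v ` A) ((+) v ` B) = setdist A (B :: 'a::real_normed_vector set)"
proof -
  have "{dist x y |x y. x \<in> (+) v ` A \<and> y \<in> (+) v ` B}
      = {dist (v + x) (v + y) |x y. x \<in> A \<and> y \<in> B}" by blast
  then have "{dist x y |x y. x \<in> (+) v ` A \<and> y \<in> (+) v ` B} = {dist x y |x y. x \<in> A \<and> y \<in> B}"
    by simp
  then show ?thesis by (simp add: setdist_def)
qed

lemma parallel_supporting_lines_translate: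
  assumes "parallel_supporting_lines S L1 L2"
  shows "parallel_supporting_lines ((+) v ` S) ((+) v ` L1) ((+) v ` L2)"
proof -
  from assms obtain u a b where *: "norm u = 1" "L1 = {x. u \<bullet> x = a}" "L2 = {x. u \<bullet> x = b}"
    "S \<inter> L1 \<noteq> {}" "S \<inter> L2 \<noteq> {}" "\<forall>x\<in>S. a \<le> u \<bullet> x \<and> u \<bullet> x \<le> b"
    unfolding parallel_supporting_lines_def by blast
  have im: "(+) v ` {x. u \<bullet> x = c} = {x. u \<bullet> x = u \<bullet> v + c}" for c
  proof (intro set_eqI iffI)
    fix x assume "x \<in> {x. u \<bullet> x = u \<bullet> v + c}"
    then show "x \<in> (+) v ` {x. u \<bullet> x = c}"
      by (intro image_eqI[of _ _ "x - v"]) (auto simp: inner_diff_right)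
  qed (auto simp: inner_add_right)
  show ?thesis unfolding parallel_supporting_lines_def
    by (rule exI[of _ u], rule exI[of _ "u \<bullet> v + a"], rule exI[of _ "u \<bullet> v + b"])
       (use * in \<open>auto simp: im inner_add_right\<close>)
qed

lemma width_translate: "width ((+) v ` S) = width S"
proof -
  have sub: "{setdist L1 L2 | L1 L2. parallel_supporting_lines T L1 L2}
      \<subseteq> {setdist L1 L2 | L1 L2. parallel_supporting_lines ((+) w ` T) L1 L2}" for w T
  proof
    fix d assume "d \<in> {setdist L1 L2 | L1 L2. parallel_supporting_lines T L1 L2}"
    then obtain L1 L2 where L: "d = setdist L1 L2" "parallel_supporting_lines T L1 L2" by blast
    then have "d = setdist ((+) w ` L1) ((+) w ` L2)" by (simp add: setdist_translation_eq)
    with parallel_supporting_lines_translate[OF L(2)]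
    show "d \<in> {setdist L1 L2 | L1 L2. parallel_supporting_lines ((+) w ` T) L1 L2}" by blast
  qed
  have "(+) (- v) ` (+) v ` S = S" by (simp add: image_image)
  then show ?thesis unfolding width_def
    using subset_antisym[OF sub[of S v] sub[of "(+) v ` S" "- v", unfolded \<open>(+) (- v) ` (+) v ` S = S\<close>]]
    by simp
qed

lemma arc_length_eq:
  assumes "arc_lift C l \<gamma>" shows "arc_length C = l"
  unfolding arc_length_def
proof (rule the_equality)
  show "\<exists>\<gamma>. arc_lift C l \<gamma>" using assms by blast
  have le: "l1 \<le> l2" if L: "arc_lift C l1 \<gamma>1" "arc_lift C l2 \<gamma>2" for l1 l2 \<gamma>1 \<gamma>2
  proof -
    obtain v where v: "\<gamma>1 ` {0..l1} = (+) v ` \<gamma>2 ` {0..l2}" using arc_lift_unique[OF L] by blast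
    show ?thesis
    proof (rule regular_param_length_le)
      show "regular_param l1 \<gamma>1" using L(1) by (simp add: arc_lift_def)
      show "regular_param l2 (\<lambda>t. v + \<gamma>2 t)"
        using L(2) by (intro regular_param_translate) (simp add: arc_lift_def)
      show "(\<lambda>t. v + \<gamma>2 t) ` {0..l2} = \<gamma>1 ` {0..l1}" using v by (simp add: image_image)
    qed
  qed
  show "l' = l" if "\<exists>\<gamma>. arc_lift C l' \<gamma>" for l'
    using le assms that by (meson order_antisym)
qed

lemma arc_width_eq:
  assumes "arc_lift C l \<gamma>" shows "arc_width C = width (\<gamma> ` {0..l})"
  unfolding arc_width_def
proof (rule the_equality)
  show "\<exists>l' \<gamma>'. arc_lift C l' \<gamma>' \<and> width (\<gamma> ` {0..l}) = width (\<gamma>' ` {0..l'})"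
    using assms by blast
  show "w = width (\<gamma> ` {0..l})" if "\<exists>l \<gamma>. arc_lift C l \<gamma> \<and> w = width (\<gamma> ` {0..l})" for w
  proof -
    from that obtain l' \<gamma>' where g: "arc_lift C l' \<gamma>'" "w = width (\<gamma>' ` {0..l'})" by blast
    from arc_lift_unique[OF g(1) assms] obtain v where "\<gamma>' ` {0..l'} = (+) v ` \<gamma> ` {0..l}" by blast
    with g(2) show ?thesis by (simp only: width_translate)
  qed
qed

end

theory Submission
  imports Defs "HOL-Number_Theory.Cong" "Jordan_Normal_Form.Determinant"
begin

text \<open>Let \<open>\<xi>\<^sub>0\<close> carry the largest coefficient of \<open>\<phi>\<close>. By a Vandermonde argument arcs of the circle of radius \<open>lam\<close>
  shorter than about \<open>lam powr (1/2)\<close> contain boundedly many lattice points, so \<open>\<xi>\<^sub>0\<close> lies in a bounded cluster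
  \<open>K\<close> of frequencies at distance more than \<open>lam powr (1/2 - \<epsilon>/2)\<close> from all others. The lower bound on the
  width is what makes the oscillatory integrals of the cross terms small compared with the length of an arc; as
  \<open>\<phi>\<close> vanishes on the arc, so that the sum over \<open>K\<close> equals minus the remaining part, the former is small in mean square.
  Hence at least half of each arc lies where this sum is small. As the sum has boundedly many terms, this happens
  only on a proportion \<open>lam powr (- c)\<close> of the squares of a grid of mesh nearly \<open>1 / lam\<close>. Finally, a line
  meets the nodal set in such a square in at most as many points as there are frequencies, namely
  \<open>lam powr o(1)\<close>, which bounds the length of the arcs within a square by \<open>lam powr (- 1 + o(1))\<close>.\<close>

text \<open>Without the restriction to bad squares the last step would only give about N M, where N
  is the number of frequencies and M, of order N lam, the inverse mesh. The proportion
  \<open>\<rho>\<close> of bad squares has to beat the resulting N^2, and as N = lam^o(1) any fixed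
  negative power of lam does. A fixed power is available only because the cluster has boundedly many
  terms: each elimination of a character about squares the density of the point set, so that m + 1
  terms cost an exponent 4^m. The radius R of separation is squeezed from two sides. Bounded
  clusters need R below lam^(1/2), the limit of the lattice point bound; a small mean square needs 1
  / R and 1 / sqrt (\<kappa> R) small against the length l of the arc. The width is at most 2
  \<kappa> l^2 and 2 \<kappa> l < 1, so a width w forces l > w and \<kappa> >= w / (2 l^2); with w >
  lam^(-1/2 + \<epsilon>) this leaves room for an R slightly below lam^(1/2). The mesh is dictated
  by the zero count on lines. The modulus of the cluster sum varies on the scale 1 / R only, so its
  values at grid points decide about whole squares.\<close>

no_notation vec_index (infixl \<open>$\<close> 100)

section \<open>Lattice points on circles\<close>

text \<open>Thue's argument: t = y / x is a square root of -1 modulo p, and two of the (q + 1)^2 > p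
  pairs (u, v) with entries in [0, q] agree in u - t v modulo p. Their difference (a, b) satisfies p
  | a^2 + b^2 and 0 < a^2 + b^2 < 2 p.\<close>

lemma two_squares_of_dvd_sum_squares:
  fixes x y :: int and p :: nat
  assumes p: "prime p" and dvd: "int p dvd x\<^sup>2 + y\<^sup>2" and nd: "\<not> int p dvd x"
  shows "\<exists>a b :: int. a\<^sup>2 + b\<^sup>2 = int p"
proof -
  have ip: "prime (int p)" using p by simp
  have p0: "0 < int p" using p prime_gt_0_nat by auto
  have cop: "coprime x (int p)"
    using ip nd prime_imp_coprime coprime_commute by blast
  obtain w where w: "[x * w = 1] (mod int p)"
    using cong_solve_coprime_int[OF cop] by auto
  define t where "t = y * w"
  have "int p dvd w\<^sup>2 * (x\<^sup>2 + y\<^sup>2)" using dvd by simp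
  moreover have "w\<^sup>2 * (x\<^sup>2 + y\<^sup>2) = (x * w)\<^sup>2 + t\<^sup>2"
    by (simp add: t_def power_mult_distrib algebra_simps)
  ultimately have "[(x * w)\<^sup>2 + t\<^sup>2 = 0] (mod int p)" by (simp add: cong_0_iff)
  moreover have "[(x * w)\<^sup>2 + t\<^sup>2 = 1\<^sup>2 + t\<^sup>2] (mod int p)"
    by (intro cong_add cong_pow w cong_refl)
  ultimately have t: "int p dvd 1 + t\<^sup>2"
    using cong_dvd_iff[of "(x * w)\<^sup>2 + t\<^sup>2" "1\<^sup>2 + t\<^sup>2" "int p"] by (simp add: cong_0_iff)
  define q where "q = nat \<lfloor>sqrt (real p)\<rfloor>"
  have q_le: "real q \<le> sqrt (real p)" by (simp add: q_def)
  have "real q ^ 2 \<le> real p"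
    using power_mono[OF q_le, of 2] by simp
  then have q1: "q\<^sup>2 \<le> p" by (metis of_nat_le_iff of_nat_power)
  \<comment> \<open>Strictness matters: it gives a^2 + b^2 < 2 p below, which leaves p itself as the
    only positive multiple of p.\<close>
  moreover have "q\<^sup>2 \<noteq> p"
  proof
    assume "q\<^sup>2 = p"
    then have "prime (q ^ 2)" using p by simp
    then show False using prime_power_iff[of q 2] by simp
  qed
  ultimately have q2: "q\<^sup>2 < p" by simp
  have "sqrt (real p) < real q + 1" by (simp add: q_def)
  then have "(sqrt (real p))\<^sup>2 < (real q + 1)\<^sup>2" by (intro power_strict_mono) auto
  then have "real p < real ((q + 1)\<^sup>2)" by (simp add: add.commute)
  then have q3: "p < (q + 1)\<^sup>2" using of_nat_less_iff by blast
  define B where "B = {0..int q} \<times> {0..int q}"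
  define f where "f = (\<lambda>(u, v). (u - t * v) mod int p)"
  have "f ` B \<subseteq> {0..<int p}" using p0 by (auto simp: f_def)
  then have "card (f ` B) \<le> p" using card_mono[of "{0..<int p}" "f ` B"] by simp
  also have "\<dots> < card B" using q3
    by (simp add: B_def card_cartesian_product power2_eq_square nat_add_distrib)
  finally have "\<not> inj_on f B" using pigeonhole by blast
  then obtain u v u' v' where uv: "(u, v) \<in> B" "(u', v') \<in> B" "(u, v) \<noteq> (u', v')"
    "f (u, v) = f (u', v')" unfolding inj_on_def by (metis surj_pair)
  define a b where "a = u - u'" and "b = v - v'"
  have "[u - t * v = u' - t * v'] (mod int p)" using uv(4) by (simp add: f_def cong_def)
  then have ab: "int p dvd a - t * b"
    by (simp add: cong_iff_dvd_diff a_def b_def algebra_simps)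
  have "a\<^sup>2 + b\<^sup>2 = (a - t * b) * (a + t * b) + b\<^sup>2 * (1 + t\<^sup>2)"
    by (simp add: algebra_simps power2_eq_square)
  then have d: "int p dvd a\<^sup>2 + b\<^sup>2" using ab t by simp
  have "\<bar>a\<bar> \<le> int q" "\<bar>b\<bar> \<le> int q" using uv by (auto simp: B_def a_def b_def)
  then have "a\<^sup>2 \<le> (int q)\<^sup>2" "b\<^sup>2 \<le> (int q)\<^sup>2" by (auto simp: abs_le_square_iff[symmetric])
  moreover have "(int q)\<^sup>2 < int p" using q2 by (metis of_nat_less_iff of_nat_power)
  ultimately have lt: "a\<^sup>2 + b\<^sup>2 < 2 * int p" by linarith
  have "a \<noteq> 0 \<or> b \<noteq> 0" using uv(3) by (auto simp: a_def b_def)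
  then have pos: "0 < a\<^sup>2 + b\<^sup>2" by (simp add: sum_power2_gt_zero_iff)
  obtain k where k: "a\<^sup>2 + b\<^sup>2 = int p * k" using d unfolding dvd_def by blast
  have "0 < k" using pos k p0 by (simp add: zero_less_mult_iff)
  moreover have "k < 2" using lt k p0 by (simp add: mult.commute)
  ultimately have "k = 1" by simp
  then show ?thesis using k by auto
qed

section \<open>Gaussian integers and the splitting of primes\<close>

definition gaussian_ints :: "complex set"
  where "gaussian_ints = {z. Re z \<in> \<int> \<and> Im z \<in> \<int>}"

definition lattice_circle :: "real \<Rightarrow> complex set"
  where "lattice_circle r = {z \<in> gaussian_ints. (cmod z)\<^sup>2 = r}"

lemma gaussian_ints_mult: "z \<in> gaussian_ints \<Longrightarrow> w \<in> gaussian_ints \<Longrightarrow> z * w \<in> gaussian_ints"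
  by (auto simp: gaussian_ints_def)

lemma gaussian_ints_1: "1 \<in> gaussian_ints"
  by (auto simp: gaussian_ints_def)

lemma gaussian_ints_power: "z \<in> gaussian_ints \<Longrightarrow> z ^ n \<in> gaussian_ints"
  by (induction n) (auto simp: gaussian_ints_mult gaussian_ints_1)

lemma gaussian_ints_cnj: "z \<in> gaussian_ints \<Longrightarrow> cnj z \<in> gaussian_ints"
  by (auto simp: gaussian_ints_def)

lemma gaussian_int_cases:
  assumes "z \<in> gaussian_ints"
  obtains x y :: int where "z = Complex (of_int x) (of_int y)"
  using assms by (auto simp: gaussian_ints_def complex_eq_iff elim!: Ints_cases)

lemma gaussian_int_Complex: "Complex (of_int x) (of_int y) \<in> gaussian_ints"
  by (auto simp: gaussian_ints_def)

lemma gaussian_int_norm_ge_1: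
  assumes "z \<in> gaussian_ints" "z \<noteq> 0" shows "1 \<le> cmod z"
proof -
  obtain x y :: int where z: "z = Complex (of_int x) (of_int y)"
    using gaussian_int_cases[OF assms(1)] .
  have "(0::int) < x\<^sup>2 + y\<^sup>2" using assms(2) z by (auto simp: complex_eq_iff sum_power2_gt_zero_iff)
  then have "real_of_int 1 \<le> real_of_int (x\<^sup>2 + y\<^sup>2)" by (subst of_int_le_iff) simp
  then show ?thesis by (simp add: z cmod_def)
qed

text \<open>Stands in for unique factorization. The prime p divides the product of the real parts of
  z * cnj g and z * g, hence one of them; norms then force p to divide the imaginary part too, and
  dividing by p = g * cnj g gives the quotient.\<close>

lemma gaussian_prime_divides:
  assumes p: "prime (p::nat)" and g: "g \<in> gaussian_ints" "(cmod g)\<^sup>2 = p"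
    and z: "z \<in> gaussian_ints" "(cmod z)\<^sup>2 = real p * real c"
  shows "\<exists>w\<in>gaussian_ints. z = g * w \<or> z = cnj g * w"
proof -
  obtain a b :: int where ab: "g = Complex (of_int a) (of_int b)" using gaussian_int_cases[OF g(1)] .
  obtain x y :: int where xy: "z = Complex (of_int x) (of_int y)" using gaussian_int_cases[OF z(1)] .
  have "real_of_int (a\<^sup>2 + b\<^sup>2) = real_of_int (int p)" using g(2) by (simp add: ab cmod_def)
  then have P: "a\<^sup>2 + b\<^sup>2 = int p" using of_int_eq_iff by blast
  have "real_of_int (x\<^sup>2 + y\<^sup>2) = real_of_int (int p * int c)" using z(2) by (simp add: xy cmod_def)
  then have Q: "x\<^sup>2 + y\<^sup>2 = int p * int c" using of_int_eq_iff by blast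
  have ip: "prime (int p)" using p by simp
  have p0: "p \<noteq> 0" using p by auto
  \<comment> \<open>The sign s = 1 stands for g and s = -1 for cnj g; u + i v is the quotient of z
    by a + s b i.\<close>
  have main: "\<exists>u v::int. x = a * u - s * b * v \<and> y = a * v + s * b * u"
    if d: "int p dvd a * x + s * b * y" and s: "s\<^sup>2 = 1" for s
  proof -
    have "(a * x + s * b * y)\<^sup>2 + (a * y - s * b * x)\<^sup>2
        = a\<^sup>2 * x\<^sup>2 + s\<^sup>2 * b\<^sup>2 * y\<^sup>2 + a\<^sup>2 * y\<^sup>2 + s\<^sup>2 * b\<^sup>2 * x\<^sup>2"
      by (simp add: power2_sum power2_diff power_mult_distrib)
    also have "\<dots> = (a\<^sup>2 + b\<^sup>2) * (x\<^sup>2 + y\<^sup>2)" by (simp add: s algebra_simps)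
    finally have "(a * x + s * b * y)\<^sup>2 + (a * y - s * b * x)\<^sup>2 = int p * (int p * int c)"
      by (simp add: P Q)
    moreover have "int p dvd (a * x + s * b * y)\<^sup>2" using d by (simp add: power2_eq_square)
    ultimately have "int p dvd (a * y - s * b * x)\<^sup>2"
      by (metis dvd_add_right_iff dvd_triv_left)
    then have d2: "int p dvd a * y - s * b * x" using ip prime_dvd_power by blast
    obtain u where u: "a * x + s * b * y = int p * u" using d unfolding dvd_def by blast
    obtain v where v: "a * y - s * b * x = int p * v" using d2 unfolding dvd_def by blast
    have "int p * (a * u - s * b * v) = a * (int p * u) - s * b * (int p * v)"
      by (simp add: algebra_simps)
    also have "\<dots> = a * (a * x + s * b * y) - s * b * (a * y - s * b * x)"
      unfolding u v ..
    also have "\<dots> = (a\<^sup>2 + s\<^sup>2 * b\<^sup>2) * x" by (simp add: algebra_simps power2_eq_square)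
    finally have 1: "int p * (a * u - s * b * v) = int p * x" using s P by simp
    have "int p * (a * v + s * b * u) = a * (int p * v) + s * b * (int p * u)"
      by (simp add: algebra_simps)
    also have "\<dots> = a * (a * y - s * b * x) + s * b * (a * x + s * b * y)"
      unfolding u v ..
    also have "\<dots> = (a\<^sup>2 + s\<^sup>2 * b\<^sup>2) * y" by (simp add: algebra_simps power2_eq_square)
    finally have 2: "int p * (a * v + s * b * u) = int p * y" using s P by simp
    show ?thesis using 1 2 p0 by (metis mult_cancel_left of_nat_eq_0_iff)
  qed
  have "(a * x + b * y) * (a * x - b * y) = a\<^sup>2 * (x\<^sup>2 + y\<^sup>2) - y\<^sup>2 * (a\<^sup>2 + b\<^sup>2)"
    by (simp add: algebra_simps power2_eq_square)
  also have "\<dots> = int p * (a\<^sup>2 * int c - y\<^sup>2)" unfolding P Q by (simp add: algebra_simps)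
  finally have "int p dvd (a * x + b * y) * (a * x - b * y)" by simp
  then have "int p dvd a * x + b * y \<or> int p dvd a * x - b * y" using ip prime_dvd_mult_iff by blast
  then show ?thesis
  proof
    assume "int p dvd a * x + b * y"
    then obtain u v where "x = a * u - b * v" "y = a * v + b * u" using main[of 1] by auto
    then have "z = g * Complex (of_int u) (of_int v)" by (simp add: ab xy complex_eq_iff)
    then show ?thesis using gaussian_int_Complex by blast
  next
    assume "int p dvd a * x - b * y"
    then obtain u v where "x = a * u + b * v" "y = a * v - b * u" using main[of "-1"] by auto
    then have "z = cnj g * Complex (of_int u) (of_int v)" by (simp add: ab xy complex_eq_iff)
    then show ?thesis using gaussian_int_Complex by blast
  qed
qed

lemma lattice_circle_bij: "bij_betw (\<lambda>\<xi>. Complex (of_int (\<xi> $ 1)) (of_int (\<xi> $ 2))) (frequencies E) (lattice_circle E)"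
proof -
  have nrm: "(norm (frequency_vec \<xi>))\<^sup>2 = (cmod (Complex (of_int (\<xi> $ 1)) (of_int (\<xi> $ 2))))\<^sup>2" for \<xi>
    by (simp add: frequency_vec_def cmod_def norm_vec_def L2_set_def sum_2)
  show ?thesis unfolding bij_betw_def
  proof
    show "inj_on (\<lambda>\<xi>::int^2. Complex (of_int (\<xi> $ 1)) (of_int (\<xi> $ 2))) (frequencies E)"
      by (auto simp: inj_on_def Finite_Cartesian_Product.vec_eq_iff forall_2)
    show "(\<lambda>\<xi>. Complex (of_int (\<xi> $ 1)) (of_int (\<xi> $ 2))) ` frequencies E = lattice_circle E"
    proof (intro equalityI subsetI)
      fix z assume "z \<in> lattice_circle E"
      then have z: "z \<in> gaussian_ints" "(cmod z)\<^sup>2 = E" by (auto simp: lattice_circle_def)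
      obtain x y :: int where xy: "z = Complex (of_int x) (of_int y)" using gaussian_int_cases[OF z(1)] .
      show "z \<in> (\<lambda>\<xi>. Complex (of_int (\<xi> $ 1)) (of_int (\<xi> $ 2))) ` frequencies E"
        by (rule image_eqI[of _ _ "vector [x, y]"]) (use z xy nrm in \<open>auto simp: frequencies_def\<close>)
    qed (auto simp: lattice_circle_def gaussian_int_Complex frequencies_def nrm)
  qed
qed

lemma finite_lattice_circle: "finite (lattice_circle E)"
  using bij_betw_finite[OF lattice_circle_bij] finite_frequencies by blast

lemma card_frequencies: "card (frequencies E) = card (lattice_circle E)"
  using bij_betw_same_card[OF lattice_circle_bij] .

text \<open>Removing k factors of norm p, one at a time, leaves a point w of the smaller circle.
  Since multiplication commutes, only the number j of factors g among them matters, which accounts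
  for k + 1 copies of that circle.\<close>

lemma card_lattice_circle_split:
  assumes p: "prime (p::nat)" and g: "g \<in> gaussian_ints" "(cmod g)\<^sup>2 = p"
  shows "card (lattice_circle (real (p ^ k * m))) \<le> (k + 1) * card (lattice_circle (real m))"
proof -
  have p0: "real p \<noteq> 0" using p by auto
  have sub: "z \<in> lattice_circle (real (p ^ k * m)) \<Longrightarrow>
     \<exists>j\<le>k. \<exists>w\<in>lattice_circle (real m). z = g ^ j * cnj g ^ (k - j) * w" for z
  proof (induction k arbitrary: z)
    case (Suc k)
    have z: "z \<in> gaussian_ints" "(cmod z)\<^sup>2 = real p * real (p ^ k * m)"
      using Suc.prems by (auto simp: lattice_circle_def)
    obtain w where w: "w \<in> gaussian_ints" "z = g * w \<or> z = cnj g * w"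
      using gaussian_prime_divides[OF p g z] by blast
    have "(cmod z)\<^sup>2 = real p * (cmod w)\<^sup>2"
      using w(2) g(2) by (auto simp: norm_mult power_mult_distrib)
    then have "w \<in> lattice_circle (real (p ^ k * m))" using w z p0 by (simp add: lattice_circle_def)
    then obtain j v where j: "j \<le> k" "v \<in> lattice_circle (real m)" "w = g ^ j * cnj g ^ (k - j) * v"
      using Suc.IH by blast
    from w(2) show ?case
    proof
      assume "z = g * w"
      then show ?thesis using j
        by (intro exI[of _ "Suc j"] conjI bexI[of _ v]) auto
    next
      assume "z = cnj g * w"
      then show ?thesis using j
        by (intro exI[of _ "j"] conjI bexI[of _ v]) (auto simp: Suc_diff_le)
    qed
  qed auto
  then have "lattice_circle (real (p ^ k * m)) \<subseteq>
      (\<Union>j\<in>{..k}. (\<lambda>w. g ^ j * cnj g ^ (k - j) * w) ` lattice_circle (real m))" by fast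
  then have "card (lattice_circle (real (p ^ k * m))) \<le>
      card (\<Union>j\<in>{..k}. (\<lambda>w. g ^ j * cnj g ^ (k - j) * w) ` lattice_circle (real m))"
    by (intro card_mono) (auto simp: finite_lattice_circle)
  also have "\<dots> \<le> (\<Sum>j\<in>{..k}. card ((\<lambda>w. g ^ j * cnj g ^ (k - j) * w) ` lattice_circle (real m)))"
    by (rule card_UN_le) auto
  also have "\<dots> \<le> (\<Sum>j\<in>{..k}. card (lattice_circle (real m)))"
    by (intro sum_mono card_image_le finite_lattice_circle)
  also have "\<dots> = (k + 1) * card (lattice_circle (real m))" by simp
  finally show ?thesis .
qed

text \<open>If p is not a sum of two squares, it divides both coordinates of any lattice point whose
  norm it divides, so z = p w and the exponent drops by 2; hence strong induction with two base
  cases. For k = 1 the circle is empty, as p would divide m.\<close>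

lemma card_lattice_circle_inert:
  assumes p: "prime (p::nat)" and ng: "\<And>a b::int. a\<^sup>2 + b\<^sup>2 \<noteq> int p" and m: "\<not> p dvd m"
  shows "card (lattice_circle (real (p ^ k * m))) \<le> card (lattice_circle (real m))"
proof (induction k rule: less_induct)
  case (less k)
  have p0: "real p \<noteq> 0" using p by auto
  have dv: "\<exists>w\<in>gaussian_ints. z = of_nat p * w"
    if "k = Suc k'" "z \<in> lattice_circle (real (p ^ k * m))" for z k'
  proof -
    have z: "z \<in> gaussian_ints" "(cmod z)\<^sup>2 = real (p ^ k * m)"
      using that by (auto simp: lattice_circle_def)
    obtain x y :: int where xy: "z = Complex (of_int x) (of_int y)" using gaussian_int_cases[OF z(1)] .
    have "real_of_int (x\<^sup>2 + y\<^sup>2) = real_of_int (int (p ^ k * m))" using z(2) by (simp add: xy cmod_def)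
    then have Q: "x\<^sup>2 + y\<^sup>2 = int (p ^ k * m)" using of_int_eq_iff by blast
    then have d: "int p dvd x\<^sup>2 + y\<^sup>2" using that(1) by simp
    have "int p dvd x" using two_squares_of_dvd_sum_squares[OF p d] ng by blast
    moreover have "int p dvd y"
      using two_squares_of_dvd_sum_squares[OF p, of y x] d ng by (auto simp: add.commute)
    ultimately obtain u v where "x = int p * u" "y = int p * v" unfolding dvd_def by blast
    then have "z = of_nat p * Complex (of_int u) (of_int v)" by (simp add: xy complex_eq_iff)
    then show ?thesis using gaussian_int_Complex by blast
  qed
  consider "k = 0" | "k = 1" | k' where "k = Suc (Suc k')" by (metis One_nat_def not0_implies_Suc)
  then show ?case
  proof cases
    case 1 then show ?thesis by simp
  next
    case 2
    have False if z: "z \<in> lattice_circle (real (p ^ k * m))" for z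
    proof -
      obtain w where w: "w \<in> gaussian_ints" "z = of_nat p * w" using dv[of 0] z 2 by auto
      obtain x y :: int where xy: "w = Complex (of_int x) (of_int y)" using gaussian_int_cases[OF w(1)] .
      have "(cmod z)\<^sup>2 = real p * (real p * (cmod w)\<^sup>2)" 
        by (simp add: w(2) norm_mult power_mult_distrib power2_eq_square)
      moreover have "(cmod z)\<^sup>2 = real p * real m" using z 2 by (simp add: lattice_circle_def)
      ultimately have "real p * (cmod w)\<^sup>2 = real m" using p0 by simp
      then have "real_of_int (int p * (x\<^sup>2 + y\<^sup>2)) = real_of_int (int m)" by (simp add: xy cmod_def)
      then have "int p * (x\<^sup>2 + y\<^sup>2) = int m" using of_int_eq_iff by blast
      then have "int p dvd int m" by (metis dvd_triv_left)
      then show False using m by simp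
    qed
    then have "lattice_circle (real (p ^ k * m)) = {}" by blast
    then show ?thesis by simp
  next
    case 3
    have "lattice_circle (real (p ^ k * m)) \<subseteq> (\<lambda>w. of_nat p * w) ` lattice_circle (real (p ^ k' * m))"
    proof
      fix z assume z: "z \<in> lattice_circle (real (p ^ k * m))"
      obtain w where w: "w \<in> gaussian_ints" "z = of_nat p * w" using dv[of "Suc k'"] z 3 by auto
      have "(cmod z)\<^sup>2 = (real p)\<^sup>2 * (cmod w)\<^sup>2" by (simp add: w(2) norm_mult power_mult_distrib)
      moreover have "(cmod z)\<^sup>2 = (real p)\<^sup>2 * real (p ^ k' * m)"
        using z 3 by (simp add: lattice_circle_def power2_eq_square)
      ultimately have "w \<in> lattice_circle (real (p ^ k' * m))" using p0 w by (simp add: lattice_circle_def)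
      then show "z \<in> (\<lambda>w. of_nat p * w) ` lattice_circle (real (p ^ k' * m))" using w by blast
    qed
    then have "card (lattice_circle (real (p ^ k * m))) \<le> card (lattice_circle (real (p ^ k' * m)))"
      by (meson card_image_le card_mono finite_imageI finite_lattice_circle order_trans)
    then show ?thesis using less.IH[of k'] 3 by simp
  qed
qed

lemma card_lattice_circle_prime_power:
  assumes p: "prime (p::nat)" and m: "\<not> p dvd m"
  shows "card (lattice_circle (real (p ^ k * m))) \<le> (k + 1) * card (lattice_circle (real m))"
proof (cases "\<exists>a b::int. a\<^sup>2 + b\<^sup>2 = int p")
  case True
  then obtain a b :: int where ab: "a\<^sup>2 + b\<^sup>2 = int p" by blast
  have "(cmod (Complex (of_int a) (of_int b)))\<^sup>2 = real_of_int (a\<^sup>2 + b\<^sup>2)" by (simp add: cmod_def)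
  then have "(cmod (Complex (of_int a) (of_int b)))\<^sup>2 = real p" by (simp add: ab)
  then show ?thesis using card_lattice_circle_split[OF p gaussian_int_Complex] by blast
next
  case False
  then have "card (lattice_circle (real (p ^ k * m))) \<le> 1 * card (lattice_circle (real m))"
    using card_lattice_circle_inert[OF p _ m] by simp
  also have "\<dots> \<le> (k + 1) * card (lattice_circle (real m))" by (rule mult_right_mono) auto
  finally show ?thesis .
qed

section \<open>The number of frequencies is lam^o(1)\<close>

lemma linear_le_exponential:
  assumes "\<eta> > (0::real)"
  obtains C where "C \<ge> 1" "\<And>k. real (k + 1) \<le> C * 2 powr (\<eta> * real k)"
proof -
  \<comment> \<open>Chosen so that k + 1 <= C (1 + \<eta> k ln 2), to which 1 + x <= exp x
    applies.\<close>
  define C where "C = max 1 (1 / (\<eta> * ln 2))"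
  have "real (k + 1) \<le> C * 2 powr (\<eta> * real k)" for k
  proof -
    have e: "\<eta> * ln 2 > 0" using assms by simp
    have "real k \<le> C * (\<eta> * ln 2 * real k)"
    proof -
      have "1 / (\<eta> * ln 2) * (\<eta> * ln 2 * real k) \<le> C * (\<eta> * ln 2 * real k)"
        using e by (intro mult_right_mono) (auto simp: C_def)
      then show ?thesis using e assms by simp
    qed
    moreover have "(1::real) \<le> C" by (simp add: C_def)
    ultimately have "real (k + 1) \<le> C * (1 + \<eta> * real k * ln 2)" by (simp add: algebra_simps)
    also have "\<dots> \<le> C * exp (\<eta> * real k * ln 2)"
      by (intro mult_left_mono exp_ge_add_one_self) (auto simp: C_def)
    finally show ?thesis by (simp add: powr_def)
  qed
  then show ?thesis using that[of C] by (simp add: C_def)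
qed

text \<open>The proof of the divisor bound: a prime power p^k costs a factor k + 1 and is allowed
  p^(\<eta> k). For p >= 2^(1/\<eta>) the allowance is at least 2^k >= k + 1; the at most P smaller
  primes cost an extra constant D each, uniformly in n.\<close>

lemma card_lattice_circle_nat_bound:
  assumes "\<eta> > (0::real)"
  obtains C where "C > 0" "\<And>n::nat. n > 0 \<Longrightarrow> real (card (lattice_circle (real n))) \<le> C * real n powr \<eta>"
proof -
  obtain D where D: "D \<ge> 1" "\<And>k. real (k + 1) \<le> D * 2 powr (\<eta> * real k)"
    using linear_le_exponential[OF assms] by metis
  define P where "P = nat \<lceil>2 powr (1 / \<eta>)\<rceil>"
  define S where "S n = {p::nat. prime p \<and> p dvd n \<and> p < P}" for n
  have finS: "finite (S n)" for n by (rule finite_subset[of _ "{..<P}"]) (auto simp: S_def)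
  define r where "r n = real (card (lattice_circle (real n)))" for n :: nat
  have factor: "real (k + 1) \<le> (if p < P then D else 1) * real (p ^ k) powr \<eta>" if p: "prime p" for p k :: nat
  proof -
    have p2: "real p \<ge> 2" using prime_ge_2_nat[OF p] by simp
    have pk: "real (p ^ k) powr \<eta> = real p powr (\<eta> * real k)"
      using p2 by (simp add: powr_realpow[symmetric] powr_powr mult.commute)
    show ?thesis
    proof (cases "p < P")
      case True
      have "2 powr (\<eta> * real k) \<le> real p powr (\<eta> * real k)"
        using p2 assms by (intro powr_mono2) auto
      then have "D * 2 powr (\<eta> * real k) \<le> D * real p powr (\<eta> * real k)"
        using D(1) by (intro mult_left_mono) auto
      then show ?thesis using D(2)[of k] True pk by simp
    next
      case False
      then have "2 powr (1 / \<eta>) \<le> real p" by (simp add: P_def) linarith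
      then have "(2 powr (1 / \<eta>)) powr (\<eta> * real k) \<le> real p powr (\<eta> * real k)"
        using assms by (intro powr_mono2) auto
      moreover have "(2 powr (1 / \<eta>)) powr (\<eta> * real k) = 2 ^ k"
        using assms by (simp add: powr_powr powr_realpow)
      moreover have "real (k + 1) \<le> 2 ^ k"
        using of_nat_mono[of "k + 1" "2 ^ k", where 'a=real] by (simp add: Suc_leI)
      ultimately show ?thesis using False pk by simp
    qed
  qed
  have main: "r n \<le> (r 1 * D ^ card (S n)) * real n powr \<eta>" if "n > 0" for n
    using that
  proof (induction n rule: less_induct)
    case (less n)
    show ?case
    proof (cases "n = 1")
      case True
      have "r 1 * 1 \<le> r 1 * D ^ card (S 1)"
        using D(1) by (intro mult_left_mono) (auto simp: r_def)
      then show ?thesis using True by simp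
    next
      case False
      then obtain p where p: "prime p" "p dvd n" using prime_factor_nat by blast
      have nz: "n \<noteq> 0" "\<not> is_unit p" using less.prems p by auto
      obtain m where m: "n = p ^ multiplicity p n * m" "\<not> p dvd m"
        using multiplicity_decompose'[OF nz] by blast
      define k where "k = multiplicity p n"
      have k: "k > 0" using p nz by (simp add: k_def multiplicity_gt_zero_iff)
      have m0: "m > 0" using m less.prems by (cases m) auto
      have n: "n = p ^ k * m" using m by (simp add: k_def)
      have "p ^ 1 \<le> p ^ k" using k prime_gt_0_nat[OF p(1)] by (intro power_increasing) auto
      then have "1 < p ^ k" using prime_gt_1_nat[OF p(1)] by simp
      then have mn: "m < n" using n m0 by simp
      have "r n \<le> real (k + 1) * r m"
        using card_lattice_circle_prime_power[OF p(1) m(2), of k] unfolding r_def n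
        by (metis of_nat_le_iff of_nat_mult)
      also have "\<dots> \<le> ((if p < P then D else 1) * real (p ^ k) powr \<eta>) * ((r 1 * D ^ card (S m)) * real m powr \<eta>)"
        by (intro mult_mono factor p less.IH mn m0) (use D in \<open>auto simp: r_def\<close>)
      also have "\<dots> = r 1 * ((if p < P then D else 1) * D ^ card (S m)) * real n powr \<eta>"
        by (simp add: n powr_mult)
      also have "\<dots> \<le> r 1 * D ^ card (S n) * real n powr \<eta>"
      proof (intro mult_right_mono mult_left_mono)
        have sub: "S m \<subseteq> S n" by (auto simp: S_def n)
        show "(if p < P then D else 1) * D ^ card (S m) \<le> D ^ card (S n)"
        proof (cases "p < P")
          case True
          have "p \<in> S n" "p \<notin> S m" using True p m by (auto simp: S_def)
          then have "S m \<subset> S n" using sub by blast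
          then have "Suc (card (S m)) \<le> card (S n)" using psubset_card_mono[OF finS] by (simp add: Suc_leI)
          then have "D ^ Suc (card (S m)) \<le> D ^ card (S n)" using D(1) by (intro power_increasing)
          then show ?thesis using True by simp
        next
          case False
          then show ?thesis using D(1) card_mono[OF finS sub] by (simp add: power_increasing)
        qed
      qed (auto simp: r_def)
      finally show ?thesis .
    qed
  qed
  have "r n \<le> ((r 1 + 1) * D ^ P) * real n powr \<eta>" if "n > 0" for n
  proof -
    have "card (S n) \<le> P" using card_mono[of "{..<P}" "S n"] by (auto simp: S_def)
    then have "D ^ card (S n) \<le> D ^ P" using D(1) by (intro power_increasing)
    then have "r 1 * D ^ card (S n) \<le> (r 1 + 1) * D ^ P"
      using D by (intro mult_mono) (auto simp: r_def)
    then show ?thesis using main[OF that] by (meson mult_right_mono order_trans powr_ge_zero)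
  qed
  then show ?thesis using D that[of "(r 1 + 1) * D ^ P"] by (simp add: r_def add_pos_nonneg)
qed

lemma card_frequencies_bound:
  assumes "\<eta> > (0::real)"
  obtains C where "C > 0" "\<And>lam. lam > 0 \<Longrightarrow> real (card (frequencies (lam\<^sup>2))) \<le> C * lam powr \<eta>"
proof -
  \<comment> \<open>That bound is in terms of n = lam^2, hence half the exponent.\<close>
  obtain C where C: "C > 0" "\<And>n::nat. n > 0 \<Longrightarrow> real (card (lattice_circle (real n))) \<le> C * real n powr (\<eta> / 2)"
    using card_lattice_circle_nat_bound[of "\<eta> / 2"] assms by auto
  have "real (card (frequencies (lam\<^sup>2))) \<le> C * lam powr \<eta>" if lam: "lam > 0" for lam
  proof (cases "frequencies (lam\<^sup>2) = {}")
    case False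
    then obtain \<xi> where "\<xi> \<in> frequencies (lam\<^sup>2)" by blast
    then have "real_of_int ((\<xi> $ 1)\<^sup>2 + (\<xi> $ 2)\<^sup>2) = lam\<^sup>2"
      by (simp add: frequencies_def frequency_vec_def norm_vec_def L2_set_def sum_2)
    then have "real (nat ((\<xi> $ 1)\<^sup>2 + (\<xi> $ 2)\<^sup>2)) = lam\<^sup>2" by simp
    then obtain n :: nat where n: "real n = lam\<^sup>2" by blast
    then have "n > 0" using lam by (cases n) auto
    then have "real (card (frequencies (lam\<^sup>2))) \<le> C * (lam\<^sup>2) powr (\<eta> / 2)"
      using C(2)[of n] n by (simp add: card_frequencies)
    also have "(lam\<^sup>2) powr (\<eta> / 2) = lam powr \<eta>"
    proof -
      have "lam\<^sup>2 = lam powr 2" using lam by simp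
      then show ?thesis by (simp only: powr_powr) simp
    qed
    finally show ?thesis .
  qed (use C(1) in auto)
  then show ?thesis using that C(1) by blast
qed

section \<open>Vandermonde determinants and lattice points close together\<close>

text \<open>Induction with the last node as a variable x: the determinant is a polynomial in x of
  degree at most n that vanishes at the other n nodes and has the smaller Vandermonde determinant as
  coefficient of x^n.\<close>

lemma vandermonde_det:
  fixes z :: "nat \<Rightarrow> complex"
  assumes "inj_on z {..<n}"
  shows "Determinant.det (mat n n (\<lambda>(i, j). z i ^ j)) = (\<Prod>j<n. \<Prod>i<j. z j - z i)"
  using assms
proof (induction n)
  case 0
  then show ?case by (simp add: det_dim_zero)
next
  case (Suc n)
  have inj: "inj_on z {..<n}" using Suc.prems by (rule inj_on_subset) auto
  \<comment> \<open>Only row n depends on x, so the cofactors along it are constants and the Laplace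
    expansion displays the polynomial.\<close>
  define A where "A x = mat (Suc n) (Suc n) (\<lambda>(i, j). (z(n := x)) i ^ j)" for x
  define V where "V = (\<Prod>j<n. \<Prod>i<j. z j - z i)"
  define c where "c j = cofactor (A 0) n j" for j
  define p where "p = (\<Sum>j\<le>n. Polynomial.monom (c j) j)"
  have carr: "A x \<in> carrier_mat (Suc n) (Suc n)" for x by (simp add: A_def)
  have cof: "cofactor (A x) n j = c j" if "j \<le> n" for x j
  proof -
    have "mat_delete (A x) n j = mat_delete (A 0) n j"
      unfolding mat_delete_def by (rule eq_matI) (auto simp: A_def)
    then show ?thesis by (simp add: c_def cofactor_def)
  qed
  have poly: "Determinant.det (A x) = Polynomial.poly p x" for x
  proof -
    have "Determinant.det (A x) = (\<Sum>j<Suc n. A x $$ (n, j) * cofactor (A x) n j)"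
      by (rule laplace_expansion_row[OF carr]) simp
    also have "\<dots> = (\<Sum>j\<le>n. c j * x ^ j)"
      unfolding lessThan_Suc_atMost by (intro sum.cong) (auto simp: cof, auto simp: A_def)
    also have "\<dots> = Polynomial.poly p x" by (simp add: p_def poly_sum poly_monom)
    finally show ?thesis .
  qed
  have cn: "Polynomial.coeff p n = V"
  proof -
    have "Polynomial.coeff p n = c n" by (simp add: p_def coeff_sum)
    also have "mat_delete (A 0) n n = mat n n (\<lambda>(i, j). z i ^ j)"
      unfolding mat_delete_def by (rule eq_matI) (auto simp: A_def)
    then have "c n = Determinant.det (mat n n (\<lambda>(i, j). z i ^ j))"
      by (simp add: c_def cofactor_def flip: mult_2)
    finally show ?thesis using Suc.IH[OF inj] by (simp add: V_def)
  qed
  have degp: "Polynomial.degree p \<le> n" unfolding p_def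
    by (intro degree_sum_le) (auto intro: order_trans[OF degree_monom_le])
  have root: "Polynomial.poly p (z i) = 0" if "i < n" for i
  proof -
    have "Determinant.det (A (z i)) = 0"
      by (rule det_identical_rows[OF carr, of i n]) (use that in \<open>auto simp: A_def\<close>)
    then show ?thesis using poly by simp
  qed
  define q where "q = (\<Prod>i<n. [:- z i, 1:])"
  have degq: "Polynomial.degree q = n" unfolding q_def by (subst degree_prod_eq_sum_degree) auto
  have "lead_coeff q = 1" unfolding q_def lead_coeff_prod by simp
  then have lq: "Polynomial.coeff q n = 1" by (simp add: degq)
  \<comment> \<open>Degree below n, yet n distinct roots: this is where the distinctness of the
    nodes enters.\<close>
  define r where "r = p - Polynomial.smult V q"
  have "r = 0"
  proof (rule ccontr)
    assume r: "r \<noteq> 0"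
    have "Polynomial.degree r \<le> n" unfolding r_def
      using degp degq by (intro degree_diff_le) auto
    moreover have "Polynomial.coeff r n = 0" by (simp add: r_def cn lq)
    ultimately have "Polynomial.degree r < n" using r
      by (metis leading_coeff_0_iff le_neq_implies_less)
    moreover have "z ` {..<n} \<subseteq> {x. Polynomial.poly r x = 0}"
      using root by (auto simp: r_def q_def poly_prod)
    then have "card (z ` {..<n}) \<le> card {x. Polynomial.poly r x = 0}"
      by (intro card_mono poly_roots_finite r)
    then have "n \<le> Polynomial.degree r"
      using card_poly_roots_bound[OF r] card_image[OF inj] by simp
    ultimately show False by simp
  qed
  then have "Polynomial.poly p (z n) = V * (\<Prod>i<n. z n - z i)"
    by (simp add: r_def q_def poly_prod)
  moreover have "A (z n) = mat (Suc n) (Suc n) (\<lambda>(i, j). z i ^ j)"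
    unfolding A_def by (rule eq_matI) auto
  ultimately show ?case using poly[of "z n"] by (simp add: V_def)
qed

lemma gaussian_ints_sum: "(\<And>i. i \<in> S \<Longrightarrow> f i \<in> gaussian_ints) \<Longrightarrow> sum f S \<in> gaussian_ints"
  by (induction S rule: infinite_finite_induct) (auto simp: gaussian_ints_def)

lemma gaussian_ints_prod: "(\<And>i. i \<in> S \<Longrightarrow> f i \<in> gaussian_ints) \<Longrightarrow> prod f S \<in> gaussian_ints"
  by (induction S rule: infinite_finite_induct) (auto simp: gaussian_ints_1 gaussian_ints_mult)

text \<open>The matrix with entries \<open>cnj z\<^sub>i ^ (l - c)\<close> for \<open>c < l\<close> and \<open>z\<^sub>i ^ (c - l)\<close> for \<open>c \<ge> l\<close> has a
  Gaussian integer as determinant. On the circle \<open>cnj z = R\<^sup>2 / z\<close>, so that up to powers of \<open>R\<close> it is a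
  Vandermonde determinant, which is thus bounded from below.\<close>

lemma lattice_points_spread_pow:
  fixes z :: "nat \<Rightarrow> complex"
  assumes inj: "inj_on z {..<2 * l + 1}"
    and g: "\<And>i. i < 2 * l + 1 \<Longrightarrow> z i \<in> gaussian_ints" "\<And>i. i < 2 * l + 1 \<Longrightarrow> cmod (z i) = R"
    and R: "R > 0"
    and d: "\<And>i j. i < 2 * l + 1 \<Longrightarrow> j < 2 * l + 1 \<Longrightarrow> cmod (z i - z j) \<le> d"
  shows "R ^ (l\<^sup>2) \<le> d ^ (l * (2 * l + 1))"
proof -
  define n where "n = 2 * l + 1"
  define M where "M = mat n n (\<lambda>(i, c). if c < l then cnj (z i) ^ (l - c) else z i ^ (c - l))"
  define W where "W = mat n n (\<lambda>(i, c). z i ^ c)"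
  have carr: "M \<in> carrier_mat n n" "W \<in> carrier_mat n n" by (auto simp: M_def W_def)
  have d0: "0 \<le> d" using d[of 0 0] by simp
  \<comment> \<open>Row i is scaled by \<open>z i ^ l\<close>. As z * cnj z = R^2, every entry
    becomes a Vandermonde entry times a factor that depends on the column only; for c >= l the
    truncated difference \<open>l - c\<close> makes this factor 1.\<close>
  have MW: "z i ^ l * M $$ (i, c) = W $$ (i, c) * of_real ((R\<^sup>2) ^ (l - c))" if ic: "i < n" "c < n" for i c
  proof (cases "c < l")
    case True
    have zc: "z i * cnj (z i) = of_real (R\<^sup>2)"
      using g(2)[of i] ic by (simp add: complex_norm_square[symmetric] n_def)
    have "z i ^ l = z i ^ c * z i ^ (l - c)" using True by (simp flip: power_add)
    then have "z i ^ l * cnj (z i) ^ (l - c) = z i ^ c * (z i * cnj (z i)) ^ (l - c)"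
      by (simp add: power_mult_distrib)
    then show ?thesis using True ic zc by (simp add: M_def W_def)
  next
    case False
    then show ?thesis using ic by (simp add: M_def W_def flip: power_add)
  qed
  have "Determinant.det M * (\<Prod>i<n. z i ^ l) = (\<Sum>p | p permutes {0..<n}. signof p * (\<Prod>i=0..<n. z i ^ l * M $$ (i, p i)))"
    unfolding det_def'[OF carr(1)] sum_distrib_right
    by (intro sum.cong refl) (simp add: prod.distrib lessThan_atLeast0 mult_ac)
  also have "\<dots> = (\<Sum>p | p permutes {0..<n}. signof p * (\<Prod>i=0..<n. W $$ (i, p i)) * (\<Prod>c<n. of_real ((R\<^sup>2) ^ (l - c))))"
  proof (intro sum.cong refl)
    fix p assume "p \<in> {p. p permutes {0..<n}}"
    then have p: "p permutes {0..<n}" by simp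
    have "(\<Prod>i=0..<n. z i ^ l * M $$ (i, p i)) = (\<Prod>i=0..<n. W $$ (i, p i) * of_real ((R\<^sup>2) ^ (l - p i)))"
      using p by (intro prod.cong refl MW) (auto simp: permutes_in_image dest: permutes_in_image[OF p, THEN iffD2])
    also have "\<dots> = (\<Prod>i=0..<n. W $$ (i, p i)) * (\<Prod>i=0..<n. of_real ((R\<^sup>2) ^ (l - p i)))"
      by (simp add: prod.distrib)
    also have "(\<Prod>i=0..<n. complex_of_real ((R\<^sup>2) ^ (l - p i))) = (\<Prod>c=0..<n. of_real ((R\<^sup>2) ^ (l - c)))"
      using prod.permute[OF p, of "\<lambda>c. complex_of_real ((R\<^sup>2) ^ (l - c))"] by (simp add: o_def)
    finally show "signof p * (\<Prod>i=0..<n. z i ^ l * M $$ (i, p i)) =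
        signof p * (\<Prod>i=0..<n. W $$ (i, p i)) * (\<Prod>c<n. of_real ((R\<^sup>2) ^ (l - c)))"
      by (simp add: lessThan_atLeast0 mult_ac)
  qed
  also have "\<dots> = Determinant.det W * (\<Prod>c<n. of_real ((R\<^sup>2) ^ (l - c)))"
    unfolding det_def'[OF carr(2)] by (simp only: sum_distrib_right)
  finally have eq: "Determinant.det M * (\<Prod>i<n. z i ^ l) = Determinant.det W * (\<Prod>c<n. of_real ((R\<^sup>2) ^ (l - c)))" .
  have detW: "Determinant.det W = (\<Prod>j<n. \<Prod>i<j. z j - z i)"
    unfolding W_def using vandermonde_det[OF inj] by (simp add: n_def)
  have W0: "Determinant.det W \<noteq> 0" unfolding detW
  proof -
    have "z j - z i \<noteq> 0" if "j < n" "i < j" for i j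
      using inj_onD[OF inj, of j i] that by (auto simp: n_def)
    then show "(\<Prod>j<n. \<Prod>i<j. z j - z i) \<noteq> 0" by (auto simp: prod_zero_iff)
  qed
  have "Determinant.det M \<noteq> 0" using eq W0 R by auto
  moreover have "Determinant.det M \<in> gaussian_ints"
    unfolding det_def'[OF carr(1)]
  proof (intro gaussian_ints_sum gaussian_ints_mult gaussian_ints_prod)
    fix p assume "p \<in> {p. p permutes {0..<n}}"
    then have p: "p permutes {0..<n}" by simp
    show "signof p \<in> gaussian_ints" by (simp add: sign_def gaussian_ints_def)
    fix i assume i: "i \<in> {0..<n}"
    then have "p i < n" using permutes_in_image[OF p, of i] by auto
    then show "M $$ (i, p i) \<in> gaussian_ints"
      using g(1)[of i] i by (auto simp: M_def n_def intro!: gaussian_ints_power gaussian_ints_cnj)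
  qed
  ultimately have M1: "1 \<le> cmod (Determinant.det M)" using gaussian_int_norm_ge_1 by blast
  have nz: "cmod (\<Prod>i<n. z i ^ l) = R ^ (l * n)"
  proof -
    have "cmod (\<Prod>i<n. z i ^ l) = (\<Prod>i<n. R ^ l)"
      unfolding prod_norm[symmetric] by (intro prod.cong) (auto simp: norm_power g n_def)
    then show ?thesis by (simp add: power_mult)
  qed
  have sl: "(\<Sum>c<n. l - c) * 2 = l * (l + 1)"
  proof -
    have "(\<Sum>c<n. l - c) = (\<Sum>c<Suc l. l - c)"
      by (rule sum.mono_neutral_right) (auto simp: n_def)
    also have "\<dots> = (\<Sum>c<Suc l. c)" using sum.nat_diff_reindex[of "\<lambda>c. c" "Suc l"] by simp
    also have "\<dots> * 2 = l * (l + 1)" using gauss_sum_nat[of l] by (simp add: lessThan_Suc_atMost atMost_atLeast0 )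
    finally show ?thesis .
  qed
  have nR: "cmod (\<Prod>c<n. of_real ((R\<^sup>2) ^ (l - c))) = R ^ (l * (l + 1))"
  proof -
    have "cmod (\<Prod>c<n. of_real ((R\<^sup>2) ^ (l - c))) = (\<Prod>c<n. (R\<^sup>2) ^ (l - c))"
      unfolding prod_norm[symmetric] by (intro prod.cong) (auto simp: norm_power)
    also have "\<dots> = (R\<^sup>2) ^ (\<Sum>c<n. l - c)" by (simp add: power_sum)
    also have "\<dots> = R ^ (2 * (\<Sum>c<n. l - c))" by (simp only: power_mult)
    finally show ?thesis using sl by (simp only: mult.commute)
  qed
  have nW: "cmod (Determinant.det W) \<le> d ^ (l * n)"
  proof -
    have "cmod (Determinant.det W) = (\<Prod>j<n. \<Prod>i<j. cmod (z j - z i))"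
      unfolding detW by (simp add: prod_norm)
    also have "\<dots> \<le> (\<Prod>j<n. \<Prod>i<j. d)"
      using d by (intro prod_mono conjI prod_nonneg) (auto simp: n_def)
    also have "\<dots> = d ^ (\<Sum>j<n. j)" by (simp add: power_sum)
    also have "(\<Sum>j<n. j) = l * n"
      using gauss_sum_nat[of "2 * l"] by (simp add: n_def lessThan_Suc_atMost atMost_atLeast0)
    finally show ?thesis .
  qed
  \<comment> \<open>Since n = 2 l + 1, the exponents satisfy l n = l^2 + l (l + 1): conjugating l of
    the columns improves the trivial lower bound 1 for the Vandermonde determinant to
    R^(l^2).\<close>
  have "R ^ (l\<^sup>2) * R ^ (l * (l + 1)) = 1 * R ^ (l * n)"
  proof -
    have "l\<^sup>2 + l * (l + 1) = l * n" by (simp add: n_def power2_eq_square algebra_simps)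
    then show ?thesis by (simp flip: power_add)
  qed
  also have "\<dots> \<le> cmod (Determinant.det M) * R ^ (l * n)"
    using M1 R by (intro mult_right_mono) auto
  also have "\<dots> = cmod (Determinant.det W) * R ^ (l * (l + 1))"
    using arg_cong[OF eq, of cmod] nz nR by (simp add: norm_mult)
  also have "\<dots> \<le> d ^ (l * n) * R ^ (l * (l + 1))" using nW R by (intro mult_right_mono) auto
  finally show ?thesis using R by (simp add: n_def)
qed

text \<open>Taking roots turns the power inequality into the exponent l / (2 l + 1), which tends to
  1/2 from below. So sets of diameter R^(1/2 - e) contain boundedly many points of the circle, with
  a bound that grows as e tends to 0.\<close>

lemma lattice_points_spread:
  assumes l: "l > 0" and R: "R > 0" and S: "S \<subseteq> lattice_circle (R\<^sup>2)" "2 * l + 1 \<le> card S"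
    and d: "\<And>z w. z \<in> S \<Longrightarrow> w \<in> S \<Longrightarrow> cmod (z - w) \<le> d"
  shows "R powr (real l / real (2 * l + 1)) \<le> d"
proof -
  have fin: "finite S" using S(1) finite_lattice_circle finite_subset by blast
  obtain T where T: "T \<subseteq> S" "card T = 2 * l + 1" by (rule obtain_subset_with_card_n[OF S(2)])
  have "finite T" using T fin finite_subset by blast
  from ex_bij_betw_nat_finite[OF this] obtain z where z: "bij_betw z {..<2 * l + 1} T"
    unfolding atLeast0LessThan T(2) ..
  have zS: "z i \<in> S" if "i < 2 * l + 1" for i using z T that by (auto simp: bij_betw_def)
  have "R ^ (l\<^sup>2) \<le> d ^ (l * (2 * l + 1))"
  proof (rule lattice_points_spread_pow[of z])
    show "inj_on z {..<2 * l + 1}" using z by (simp add: bij_betw_def)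
    fix i assume i: "i < 2 * l + 1"
    then have "z i \<in> lattice_circle (R\<^sup>2)" using zS S by blast
    then show "z i \<in> gaussian_ints" "cmod (z i) = R" using R by (auto simp: lattice_circle_def power2_eq_iff_nonneg)
  qed (use R d zS in auto)
  then have "(R ^ l) ^ l \<le> (d ^ (2 * l + 1)) ^ l"
    unfolding power2_eq_square power_mult[of R l l] mult.commute[of l "2 * l + 1"] power_mult[of d "2 * l + 1" l] .
  moreover have "z 0 \<in> S" using zS by simp
  then have "cmod (z 0 - z 0) \<le> d" using d by blast
  then have d0: "d \<ge> 0" by simp
  ultimately have le: "R ^ l \<le> d ^ (2 * l + 1)"
    using l by (subst (asm) power_mono_iff) (use R in auto)
  have "0 < R ^ l" using R by simp
  then have "d \<noteq> 0" using le by auto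
  then have d1: "d > 0" using d0 by simp
  have "R powr (real l / real (2 * l + 1)) = (R ^ l) powr (1 / real (2 * l + 1))"
    unfolding powr_realpow[OF R, of l, symmetric] powr_powr by simp
  also have "\<dots> \<le> (d ^ (2 * l + 1)) powr (1 / real (2 * l + 1))"
    using le R by (intro powr_mono2) auto
  also have "\<dots> = d" using d1 unfolding powr_realpow[OF d1, symmetric] powr_powr by simp
  finally show ?thesis .
qed

section \<open>Sums of few characters\<close>

text \<open>Double counting: the pairs in E are sorted by their difference.\<close>

lemma card_translates_sum:
  fixes E H :: "'g::ab_group_add set"
  assumes "finite H" "finite E" and "\<And>x y. x \<in> E \<Longrightarrow> y \<in> E \<Longrightarrow> y - x \<in> H"
  shows "(\<Sum>h\<in>H. card {x\<in>E. x + h \<in> E}) = card E * card E"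
proof -
  have "(\<Sum>h\<in>H. card {x\<in>E. x + h \<in> E}) = card (SIGMA h:H. {x\<in>E. x + h \<in> E})"
    using assms by simp
  also have "\<dots> = card (E \<times> E)"
  proof (rule bij_betw_same_card)
    show "bij_betw (\<lambda>(h, x). (x, x + h)) (SIGMA h:H. {x\<in>E. x + h \<in> E}) (E \<times> E)"
      by (rule bij_betwI[where g = "\<lambda>(x, y). (y - x, x)"]) (use assms in auto)
  qed
  finally show ?thesis by (simp add: card_cartesian_product)
qed

text \<open>Passing from \<open>p\<close> to \<open>x \<mapsto> p (x + h) - chi\<^sub>i h * p x\<close> removes the character \<open>chi\<^sub>i\<close>; since many shifts
  \<open>h\<close> map a large part of \<open>E\<close> into \<open>E\<close>, one of them does not shrink the leading coefficient much.\<close>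

lemma character_sum_lower_bound:
  fixes H :: "'g::ab_group_add set" and chi :: "'j \<Rightarrow> 'g \<Rightarrow> complex" and A \<rho> \<tau>0 b :: real
  assumes H: "finite H" and A: "1 \<le> A"
    and mult: "\<And>j x y. chi j (x + y) = chi j x * chi j y" and unit: "\<And>j x. cmod (chi j x) = 1"
    and S: "finite S" "card S \<le> Suc m"
    and conc: "\<And>i j \<tau>. i \<in> S \<Longrightarrow> j \<in> S \<Longrightarrow> i \<noteq> j \<Longrightarrow> \<tau>0 \<le> \<tau> \<Longrightarrow>
        real (card {h\<in>H. cmod (chi i h - chi j h) < \<tau>}) \<le> A * \<tau> * card H"
    and E: "finite E" "\<And>x y. x \<in> E \<Longrightarrow> y \<in> E \<Longrightarrow> y - x \<in> H"
    and \<rho>: "0 < \<rho>" "\<rho> \<le> 1" "\<rho> * card H \<le> card E" "E \<noteq> {}"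
    and \<tau>0: "\<tau>0 \<le> (\<rho> / (8 * A)) ^ (4 ^ m)"
    and b: "0 \<le> b" "\<exists>j\<in>S. b \<le> cmod (c j)"
  shows "\<exists>x\<in>E. (\<rho> / (8 * A)) ^ (4 ^ m) * b \<le> cmod (\<Sum>j\<in>S. c j * chi j x)"
  using S conc E \<rho> \<tau>0 b
proof (induction m arbitrary: S c E \<rho> b)
  case (0 S c E \<rho> b)
  obtain j where j: "j \<in> S" "b \<le> cmod (c j)" using 0 by blast
  then have "card S = 1" using 0(1,2) by (metis One_nat_def card_0_eq empty_iff le_Suc_eq le_zero_eq)
  then have S: "S = {j}" using j by (metis card_1_singletonE singletonD)
  obtain x where "x \<in> E" using 0 by blast
  moreover have "\<rho> / (8 * A) * b \<le> 1 * b" using 0 A by (intro mult_right_mono) auto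
  ultimately show ?case using j unit by (intro bexI[of _ x]) (auto simp: S norm_mult)
next
  case (Suc m S c E \<rho> b)
  define u where "u = \<rho> / (8 * A)"
  have u: "0 < u" "u \<le> 1" using Suc.prems A by (auto simp: u_def)
  show ?case
  proof (cases "card S \<le> Suc m")
    case True
    have mono: "u ^ (4 ^ Suc m) \<le> u ^ (4 ^ m)" using u power_decreasing[of "4 ^ m" "4 ^ Suc m" u] by simp
    then have t: "\<tau>0 \<le> (\<rho> / (8 * A)) ^ (4 ^ m)" using Suc.prems by (simp add: u_def)
    have "\<exists>x\<in>E. (\<rho> / (8 * A)) ^ (4 ^ m) * b \<le> cmod (\<Sum>j\<in>S. c j * chi j x)"
      by (rule Suc.IH[OF Suc.prems(1) True Suc.prems(3-9) t Suc.prems(11,12)])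
    then show ?thesis using mono Suc.prems(11)
      unfolding u_def by (meson mult_right_mono order_trans)
  next
    case False
    define D where "D = real (card H)"
    obtain x0 where x0: "x0 \<in> E" using Suc.prems by blast
    have "(\<lambda>y. y - x0) ` E \<subseteq> H" using Suc.prems(5) x0 by auto
    moreover have "inj_on (\<lambda>y. y - x0) E" by (auto simp: inj_on_def)
    ultimately have "card E \<le> card H" by (metis H card_image card_mono)
    then have ED: "real (card E) \<le> D" by (simp add: D_def)
    have "card E > 0" using Suc.prems x0 card_gt_0_iff by blast
    then have D0: "D > 0" using ED by simp
    obtain j0 where j0: "j0 \<in> S" "b \<le> cmod (c j0)" using Suc.prems by blast
    \<comment> \<open>The character i0 will be eliminated; j0, which carries a coefficient of size
      at least b, has to survive.\<close>
    have "\<exists>i0\<in>S. i0 \<noteq> j0"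
    proof (rule ccontr)
      assume "\<not> (\<exists>i0\<in>S. i0 \<noteq> j0)"
      then have "S = {j0}" using j0 by blast
      then show False using False by simp
    qed
    then obtain i0 where i0: "i0 \<in> S" "i0 \<noteq> j0" by blast
    define N where "N h = card {x\<in>E. x + h \<in> E}" for h
    \<comment> \<open>Averaging over H gives at least \<open>\<rho>' * D\<close> shifts that keep
      \<open>\<rho>' * D\<close> points inside E. At most A \<tau> D shifts are resonant for i0 and
      j0, and \<tau> is chosen to make this half of \<open>\<rho>' * D\<close>, so some popular
      shift is not resonant.\<close>
    define \<rho>' where "\<rho>' = \<rho>\<^sup>2 / 2"
    define \<tau> where "\<tau> = \<rho>\<^sup>2 / (4 * A)"
    have \<rho>0: "0 < \<rho>" "\<rho> \<le> 1" using Suc.prems by auto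
    have \<rho>'0: "0 < \<rho>'" "\<rho>' \<le> 1" using \<rho>0 power_le_one[of \<rho> 2] by (auto simp: \<rho>'_def)
    have \<tau>u: "u\<^sup>2 \<le> \<tau> / 2"
      using A \<rho>0 by (simp add: u_def \<tau>_def power_divide power_mult_distrib frac_le power2_eq_square
          mult_left_mono)
    have \<rho>u: "u\<^sup>2 \<le> \<rho>' / (8 * A)"
      using A \<rho>0 by (simp add: u_def \<rho>'_def power_divide power_mult_distrib frac_le power2_eq_square
          mult_left_mono)
    \<comment> \<open>The exponent 4^m is made for this inequality, 2 + 2 * 4^m <= 4^(m + 1): the
      single factor u^2 pays for \<tau> / 2, and the power of u^2 for the new density
      \<open>\<rho>'\<close>.\<close>
    have pu: "u ^ (4 ^ Suc m) \<le> u\<^sup>2 * (u\<^sup>2) ^ (4 ^ m)"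
    proof -
      have "u\<^sup>2 * (u\<^sup>2) ^ (4 ^ m) = u ^ (2 + 2 * 4 ^ m)" by (simp only: power_add power_mult)
      moreover have "(2::nat) + 2 * 4 ^ m \<le> 4 ^ Suc m"
      proof -
        have "(1::nat) \<le> 4 ^ m" by simp
        then show ?thesis by simp
      qed
      ultimately show ?thesis using u by (metis power_decreasing less_imp_le)
    qed
    have \<rho>m: "(u\<^sup>2) ^ (4 ^ m) \<le> (\<rho>' / (8 * A)) ^ (4 ^ m)"
      using \<rho>u by (intro power_mono) auto
    have u2: "(u\<^sup>2) ^ (4 ^ m) \<le> 1" "u\<^sup>2 \<le> 1" using u by (auto intro!: power_le_one)
    have t1: "\<tau>0 \<le> u\<^sup>2 * (u\<^sup>2) ^ (4 ^ m)" using Suc.prems pu by (simp add: u_def)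
    have t2: "u\<^sup>2 * (u\<^sup>2) ^ (4 ^ m) \<le> u\<^sup>2" "u\<^sup>2 * (u\<^sup>2) ^ (4 ^ m) \<le> (u\<^sup>2) ^ (4 ^ m)"
      using u2 u by (auto intro!: mult_left_le mult_left_le_one_le)
    have t\<tau>: "\<tau>0 \<le> \<tau>" using t1 t2(1) \<tau>u by (simp add: power2_eq_square) (smt (verit) mult_pos_pos u(1))
    have t\<rho>: "\<tau>0 \<le> (\<rho>' / (8 * A)) ^ (4 ^ m)" using t1 t2(2) \<rho>m by linarith
    define G where "G = {h\<in>H. \<rho>' * D \<le> real (N h)}"
    have finG: "finite G" using H by (simp add: G_def)
    have "(\<rho> * D)\<^sup>2 \<le> (real (card E))\<^sup>2"
      using Suc.prems(8) \<rho>0 D0 by (intro power_mono) (auto simp: D_def)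
    also have "\<dots> = (\<Sum>h\<in>H. real (N h))"
      using card_translates_sum[OF H Suc.prems(4,5)]
      by (simp add: N_def power2_eq_square flip: of_nat_sum of_nat_mult)
    also have "\<dots> = (\<Sum>h\<in>G. real (N h)) + (\<Sum>h\<in>H - G. real (N h))"
      using H by (subst sum.subset_diff[of G H]) (auto simp: G_def)
    also have "\<dots> \<le> (\<Sum>h\<in>G. D) + (\<Sum>h\<in>H - G. \<rho>' * D)"
    proof (intro add_mono sum_mono)
      show "real (N h) \<le> D" for h
      proof -
        have "N h \<le> card E" unfolding N_def by (intro card_mono Suc.prems) auto
        then show ?thesis using ED by linarith
      qed
      show "h \<in> H - G \<Longrightarrow> real (N h) \<le> \<rho>' * D" for h by (auto simp: G_def)
    qed
    also have "\<dots> \<le> real (card G) * D + D * (\<rho>' * D)"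
    proof -
      have "card (H - G) \<le> card H" by (intro card_mono H) auto
      then have "real (card (H - G)) * (\<rho>' * D) \<le> D * (\<rho>' * D)"
        using \<rho>'0 D0 by (intro mult_right_mono) (auto simp: D_def)
      then show ?thesis by simp
    qed
    finally have "D * (\<rho>\<^sup>2 * D) \<le> D * (real (card G) + \<rho>' * D)"
      by (simp add: power2_eq_square algebra_simps)
    then have "\<rho>\<^sup>2 * D \<le> real (card G) + \<rho>' * D" using D0 by simp
    then have cG: "\<rho>' * D \<le> real (card G)" by (simp add: \<rho>'_def algebra_simps)
    define Bd where "Bd = {h\<in>H. cmod (chi i0 h - chi j0 h) < \<tau>}"
    have "real (card Bd) \<le> A * \<tau> * D"
      using Suc.prems(3)[OF i0(1) j0(1) i0(2) t\<tau>] by (simp add: Bd_def D_def)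
    also have "A * \<tau> = \<rho>' / 2" using A by (simp add: \<tau>_def \<rho>'_def)
    also have "\<rho>' / 2 * D < \<rho>' * D" using \<rho>'0 D0 by simp
    finally have "card Bd < card G" using cG by linarith
    then have "\<not> G \<subseteq> Bd" using card_mono[of Bd G] H by (auto simp: Bd_def)
    then obtain h where h: "h \<in> G" "h \<notin> Bd" by blast
    define E' where "E' = {x\<in>E. x + h \<in> E}"
    define c' where "c' j = c j * (chi j h - chi i0 h)" for j
    have hH: "h \<in> H" "\<rho>' * D \<le> card E'" using h by (auto simp: G_def N_def E'_def)
    have "0 < \<rho>' * D" using \<rho>'0 D0 by simp
    then have "card E' \<noteq> 0" using hH by linarith
    then have E'ne: "E' \<noteq> {}" by auto
    have "\<tau> \<le> cmod (chi j0 h - chi i0 h)" using h hH by (simp add: Bd_def norm_minus_commute)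
    then have "b * \<tau> \<le> cmod (c' j0)" unfolding c'_def norm_mult
      using j0 Suc.prems(11) A by (intro mult_mono) (auto simp: \<tau>_def)
    then have cj: "\<exists>j\<in>S - {i0}. \<tau> * b \<le> cmod (c' j)" using j0 i0 by (auto simp: mult.commute)
    have "\<exists>x\<in>E'. (\<rho>' / (8 * A)) ^ (4 ^ m) * (\<tau> * b) \<le> cmod (\<Sum>j\<in>S - {i0}. c' j * chi j x)"
    proof (rule Suc.IH)
      show "card (S - {i0}) \<le> Suc m" using Suc.prems(1,2) i0 by simp
      show "\<rho>' * real (card H) \<le> real (card E')" using hH by (simp add: D_def)
      show "0 \<le> \<tau> * b" using Suc.prems(11) A by (simp add: \<tau>_def)
    qed (use Suc.prems(1,3,4,5) \<rho>'0 E'ne t\<rho> cj in \<open>auto simp: E'_def\<close>)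
    then obtain x where x: "x \<in> E'" "(\<rho>' / (8 * A)) ^ (4 ^ m) * (\<tau> * b) \<le> cmod (\<Sum>j\<in>S - {i0}. c' j * chi j x)"
      by blast
    define p where "p y = (\<Sum>j\<in>S. c j * chi j y)" for y
    have "(\<Sum>j\<in>S - {i0}. c' j * chi j x) = (\<Sum>j\<in>S. c' j * chi j x)"
      using Suc.prems(1) i0 by (subst sum.remove[of S i0]) (auto simp: c'_def)
    also have "\<dots> = p (x + h) - chi i0 h * p x"
      by (simp add: p_def c'_def mult sum_distrib_left flip: sum_subtractf) (simp add: algebra_simps)
    finally have "cmod (\<Sum>j\<in>S - {i0}. c' j * chi j x) \<le> cmod (p (x + h)) + cmod (p x)"
      using norm_triangle_ineq4[of "p (x + h)" "chi i0 h * p x"] by (simp add: norm_mult unit)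
    then have px: "(\<rho>' / (8 * A)) ^ (4 ^ m) * (\<tau> * b) \<le> cmod (p (x + h)) + cmod (p x)" using x by linarith
    have "u ^ (4 ^ Suc m) * b \<le> (u\<^sup>2 * (u\<^sup>2) ^ (4 ^ m)) * b"
      using pu Suc.prems(11) by (rule mult_right_mono)
    also have "\<dots> \<le> (\<tau> / 2 * (\<rho>' / (8 * A)) ^ (4 ^ m)) * b"
      using \<tau>u \<rho>m u A Suc.prems(11) by (intro mult_right_mono mult_mono) (auto simp: \<tau>_def)
    also have "\<dots> = ((\<rho>' / (8 * A)) ^ (4 ^ m) * (\<tau> * b)) / 2" by simp
    also have "\<dots> \<le> (cmod (p (x + h)) + cmod (p x)) / 2" using px by (rule divide_right_mono) simp
    finally have "u ^ (4 ^ Suc m) * b \<le> max (cmod (p (x + h))) (cmod (p x))" by (simp add: max_def)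
    then have "u ^ (4 ^ Suc m) * b \<le> cmod (p (x + h)) \<or> u ^ (4 ^ Suc m) * b \<le> cmod (p x)" by (simp only: le_max_iff_disj)
    moreover have "x \<in> E" "x + h \<in> E" using x by (auto simp: E'_def)
    ultimately show ?thesis unfolding p_def u_def by blast
  qed
qed

section \<open>Zeros of real exponential sums\<close>

text \<open>The upper end \<open>Max Z\<close> in place of b is what the induction needs: the point
  found between the two largest zeros then differs from all points found before.\<close>

lemma rolle_card:
  fixes f f' :: "real \<Rightarrow> real"
  assumes der: "\<And>t. (f has_real_derivative f' t) (at t)"
    and Z: "finite Z" "card Z = Suc r" "Z \<subseteq> {a..b}" "\<forall>z\<in>Z. f z = 0"
  shows "\<exists>Z'. finite Z' \<and> card Z' = r \<and> Z' \<subseteq> {a..<Max Z} \<and> (\<forall>z\<in>Z'. f' z = 0)"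
  using Z
proof (induction r arbitrary: Z)
  case 0
  then show ?case by (intro exI[of _ "{}"]) auto
next
  case (Suc r)
  define z where "z = Max Z"
  define Z0 where "Z0 = Z - {z}"
  have zZ: "z \<in> Z" unfolding z_def using Suc.prems by (intro Max_in) auto
  have Z0: "finite Z0" "card Z0 = Suc r" "Z0 \<subseteq> {a..b}" "\<forall>z\<in>Z0. f z = 0"
    using Suc.prems zZ by (auto simp: Z0_def)
  define y where "y = Max Z0"
  have yZ: "y \<in> Z0" unfolding y_def using Z0 by (intro Max_in) auto
  have "y \<le> z" unfolding z_def using yZ Suc.prems by (intro Max_ge) (auto simp: Z0_def)
  then have yz: "y < z" using yZ by (auto simp: Z0_def)
  obtain Z' where Z': "finite Z'" "card Z' = r" "Z' \<subseteq> {a..<y}" "\<forall>z\<in>Z'. f' z = 0"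
    using Suc.IH[OF Z0] unfolding y_def by blast
  have "\<exists>w. y < w \<and> w < z \<and> DERIV f w :> 0"
  proof (rule Rolle[OF yz])
    show "f y = f z" using Z0(4) yZ Suc.prems(4) zZ by simp
    show "continuous_on {y..z} f" using der by (intro DERIV_continuous_on) (auto intro: DERIV_subset)
    show "f differentiable at x" for x using der real_differentiable_def by blast
  qed
  then obtain w where w: "y < w" "w < z" "DERIV f w :> 0" by blast
  then have "f' w = 0" using der DERIV_unique by blast
  moreover have "w \<notin> Z'" using Z'(3) w by auto
  moreover have "a \<le> w" using w yZ Z0(3) by auto
  ultimately show ?case using Z' w yz
    by (intro exI[of _ "insert w Z'"]) (auto simp: z_def)
qed

text \<open>Each differentiation costs one zero, so n - k > 0 of them are left for the k-th
  derivative.\<close>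

lemma exists_zero_iterated_derivative:
  fixes f :: "nat \<Rightarrow> real \<Rightarrow> real"
  assumes der: "\<And>k t. (f k has_real_derivative f (Suc k) t) (at t)"
    and Z: "finite Z" "n \<le> card Z" "Z \<subseteq> {a..b}" "\<forall>z\<in>Z. f 0 z = 0" and k: "k < n"
  shows "\<exists>z\<in>{a..b}. f k z = 0"
proof -
  have "\<exists>Z. finite Z \<and> card Z \<ge> n - k \<and> Z \<subseteq> {a..b} \<and> (\<forall>z\<in>Z. f k z = 0)"
    using k
  proof (induction k)
    case 0 then show ?case using Z by auto
  next
    case (Suc k)
    then obtain Y where Y: "finite Y" "card Y \<ge> n - k" "Y \<subseteq> {a..b}" "\<forall>z\<in>Y. f k z = 0" by auto
    then obtain r where r: "card Y = Suc r" using Suc.prems by (cases "card Y") auto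
    obtain Z' where Z': "finite Z'" "card Z' = r" "Z' \<subseteq> {a..<Max Y}" "\<forall>z\<in>Z'. f (Suc k) z = 0"
      using rolle_card[OF der Y(1) r Y(3,4)] by blast
    have "Max Y \<in> Y" using Y r by (intro Max_in) auto
    then have "Z' \<subseteq> {a..b}" using Z'(3) Y(3) by force
    then show ?case using Z' Y r by (intro exI[of _ Z']) auto
  qed
  then obtain Y where Y: "card Y \<ge> n - k" "Y \<subseteq> {a..b}" "\<forall>z\<in>Y. f k z = 0" by blast
  then have "Y \<noteq> {}" using k by auto
  then show ?thesis using Y by blast
qed

text \<open>The left side is a weighted l^1 norm of the coefficients, with weight h^(deg - k);
  multiplication by X - u increases it at most by the factor 1 + |u| h. It serves to bound the lower
  coefficients of a characteristic polynomial.\<close>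

lemma coeff_prod_linear_sum_bound:
  fixes u :: "'j \<Rightarrow> complex"
  assumes "finite S" and "\<And>j. j \<in> S \<Longrightarrow> cmod (u j) \<le> L" and h: "0 \<le> h" and L: "0 \<le> L"
  shows "(\<Sum>k\<le>card S. cmod (Polynomial.coeff (\<Prod>j\<in>S. [:- u j, 1:]) k) * h ^ (card S - k)) \<le> (1 + L * h) ^ card S"
  using assms(1,2)
proof (induction S rule: finite_induct)
  case empty
  then show ?case by simp
next
  case (insert i S)
  define q where "q = (\<Prod>j\<in>S. [:- u j, 1:])"
  define n where "n = card S"
  define s where "s = (\<Sum>k\<le>n. cmod (Polynomial.coeff q k) * h ^ (n - k))"
  have deg: "Polynomial.degree q = n" unfolding q_def n_def using insert.hyps
    by (subst degree_prod_eq_sum_degree) auto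
  have IH: "s \<le> (1 + L * h) ^ n" using insert by (simp add: s_def q_def n_def)
  have s0: "0 \<le> s" unfolding s_def using h by (intro sum_nonneg) auto
  have q': "(\<Prod>j\<in>insert i S. [:- u j, 1:]) = [:- u i, 1:] * q" using insert by (simp add: q_def)
  have co: "cmod (Polynomial.coeff ([:- u i, 1:] * q) k) \<le> L * cmod (Polynomial.coeff q k) + (case k of 0 \<Rightarrow> 0 | Suc k' \<Rightarrow> cmod (Polynomial.coeff q k'))" for k
  proof -
    have "cmod (u i * Polynomial.coeff q k) \<le> L * cmod (Polynomial.coeff q k)"
      using insert.prems[of i] by (simp add: norm_mult mult_right_mono)
    then show ?thesis
      by (cases k) (auto simp: coeff_pCons intro: norm_triangle_le_diff norm_triangle_le
          simp: norm_minus_commute algebra_simps)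
  qed
  have "(\<Sum>k\<le>Suc n. cmod (Polynomial.coeff ([:- u i, 1:] * q) k) * h ^ (Suc n - k))
     \<le> (\<Sum>k\<le>Suc n. (L * cmod (Polynomial.coeff q k)) * h ^ (Suc n - k) + (case k of 0 \<Rightarrow> 0 | Suc k' \<Rightarrow> cmod (Polynomial.coeff q k')) * h ^ (Suc n - k))"
    using h co by (intro sum_mono) (simp add: mult_right_mono flip: distrib_right)
  also have "\<dots> = (\<Sum>k\<le>Suc n. (L * cmod (Polynomial.coeff q k)) * h ^ (Suc n - k)) +
      (\<Sum>k\<le>Suc n. (case k of 0 \<Rightarrow> 0 | Suc k' \<Rightarrow> cmod (Polynomial.coeff q k')) * h ^ (Suc n - k))"
    by (simp add: sum.distrib)
  also have "(\<Sum>k\<le>Suc n. (L * cmod (Polynomial.coeff q k)) * h ^ (Suc n - k)) = L * h * s"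
  proof -
    have "Polynomial.coeff q (Suc n) = 0" using deg by (intro coeff_eq_0) auto
    then have "(\<Sum>k\<le>Suc n. (L * cmod (Polynomial.coeff q k)) * h ^ (Suc n - k)) = (\<Sum>k\<le>n. (L * cmod (Polynomial.coeff q k)) * h ^ (Suc n - k))"
      by simp
    also have "\<dots> = (\<Sum>k\<le>n. L * h * (cmod (Polynomial.coeff q k) * h ^ (n - k)))"
      by (intro sum.cong) (auto simp: Suc_diff_le)
    finally show ?thesis by (simp add: s_def sum_distrib_left)
  qed
  also have "(\<Sum>k\<le>Suc n. (case k of 0 \<Rightarrow> 0 | Suc k' \<Rightarrow> cmod (Polynomial.coeff q k')) * h ^ (Suc n - k)) = s"
    unfolding sum.atMost_Suc_shift s_def by simp
  also have "L * h * s + s = (1 + L * h) * s" by (simp add: algebra_simps)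
  also have "\<dots> \<le> (1 + L * h) * (1 + L * h) ^ n" using IH h L by (intro mult_left_mono) auto
  finally show ?case using insert.hyps unfolding q' by (simp add: n_def)
qed

text \<open>An exponential sum solves the linear equation with characteristic polynomial \<open>\<Prod>(X - \<i> w\<^sub>j)\<close>. If it
  has as many zeros as terms in a short interval, then by Rolle all lower derivatives are controlled by the highest
  one, and the equation forces the latter to vanish.\<close>

lemma real_exponential_sum_vanishes:
  fixes c :: "'j \<Rightarrow> complex" and w :: "'j \<Rightarrow> real" and S :: "'j set"
  defines "F \<equiv> \<lambda>k t. \<Sum>j\<in>S. c j * (\<i> * of_real (w j)) ^ k * exp (\<i> * of_real (w j * t))"
  assumes S: "finite S" and w: "\<And>j. j \<in> S \<Longrightarrow> \<bar>w j\<bar> \<le> L" and L: "0 \<le> L" and h: "0 \<le> h"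
    and real: "\<And>t. Im (F 0 t) = 0"
    and small: "(1 + L * h) ^ card S < 2"
    and Z: "finite Z" "card S \<le> card Z" "Z \<subseteq> {a..a + h}" "\<forall>z\<in>Z. F 0 z = 0"
    and t: "t \<in> {a..a + h}"
  shows "F 0 t = 0"
proof -
  define n where "n = card S"
  have dF: "(F k has_vector_derivative F (Suc k) t) (at t)" for k t
  proof -
    have "((\<lambda>t. exp (\<i> * of_real (w j * t))) has_vector_derivative (\<i> * of_real (w j)) * exp (\<i> * of_real (w j * t))) (at t)" for j
    proof -
      have "((\<lambda>t. \<i> * of_real (w j * t)) has_vector_derivative (\<i> * of_real (w j * 1))) (at t)"
        by (intro has_vector_derivative_mult_right has_vector_derivative_of_real DERIV_cmult DERIV_ident)
      from field_vector_diff_chain_at[OF this DERIV_exp]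
      show ?thesis by (simp add: o_def)
    qed
    then have "((\<lambda>t. \<Sum>j\<in>S. c j * (\<i> * of_real (w j)) ^ k * exp (\<i> * of_real (w j * t))) has_vector_derivative
       (\<Sum>j\<in>S. c j * (\<i> * of_real (w j)) ^ k * ((\<i> * of_real (w j)) * exp (\<i> * of_real (w j * t))))) (at t)"
      by (intro has_vector_derivative_sum has_vector_derivative_mult_right)
    then show ?thesis by (simp add: F_def mult_ac)
  qed
  define f where "f k t = Re (F k t)" for k t
  have df: "(f k has_real_derivative f (Suc k) t) (at t)" for k t
    unfolding f_def has_real_derivative_iff_has_vector_derivative
    by (rule bounded_linear.has_vector_derivative[OF bounded_linear_Re dF])
  \<comment> \<open>Rolle's theorem needs real functions: as F 0 is real-valued, so are all its
    derivatives, and passing to real parts loses nothing.\<close>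
  have im: "Im (F k t) = 0" for k t
  proof (induction k arbitrary: t)
    case (Suc k)
    have "((\<lambda>t. Im (F k t)) has_vector_derivative Im (F (Suc k) t)) (at t)"
      by (rule bounded_linear.has_vector_derivative[OF bounded_linear_Im dF])
    then have "((\<lambda>t. 0) has_real_derivative Im (F (Suc k) t)) (at t)"
      by (simp add: Suc has_real_derivative_iff_has_vector_derivative)
    then show ?case using DERIV_unique DERIV_const by blast
  qed (use real in auto)
  have Ff: "F k t = of_real (f k t)" for k t using im by (simp add: f_def complex_eq_iff)
  have f0: "\<exists>z\<in>{a..a + h}. f k z = 0" if "k < n" for k
    by (rule exists_zero_iterated_derivative[where f = f and Z = Z and n = n])
      (use Z that df in \<open>auto simp: n_def f_def\<close>)
  have "continuous_on {a..a + h} (f n)" using df by (intro DERIV_continuous_on) (auto intro: DERIV_subset)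
  then have "bounded (f n ` {a..a + h})"
    by (intro compact_imp_bounded compact_continuous_image) auto
  define M where "M = (SUP t\<in>{a..a + h}. \<bar>f n t\<bar>)"
  have bdd: "bdd_above ((\<lambda>t. \<bar>f n t\<bar>) ` {a..a + h})"
    using \<open>bounded (f n ` {a..a + h})\<close> unfolding bounded_iff bdd_above_def by (auto simp: image_iff)
  have M: "\<bar>f n t\<bar> \<le> M" if "t \<in> {a..a + h}" for t
    unfolding M_def by (rule cSUP_upper[OF that bdd])
  have M0: "0 \<le> M" using M[OF t] by linarith
  \<comment> \<open>Downwards from order n: each derivative of lower order has a zero in the
    interval, so the mean value theorem trades one order of differentiation for a factor h.\<close>
  have fk: "\<forall>t\<in>{a..a + h}. \<bar>f (n - i) t\<bar> \<le> h ^ i * M" if "i \<le> n" for i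
    using that
  proof (induction i)
    case 0 then show ?case using M by simp
  next
    case (Suc i)
    define k where "k = n - Suc i"
    have k: "k < n" "Suc k = n - i" using Suc.prems by (auto simp: k_def)
    obtain z where z: "z \<in> {a..a + h}" "f k z = 0" using f0[OF k(1)] by blast
    have IH: "\<bar>f (Suc k) s\<bar> \<le> h ^ i * M" if "s \<in> {a..a + h}" for s
      using Suc that k by simp
    have "\<bar>f k s\<bar> \<le> h ^ Suc i * M" if s: "s \<in> {a..a + h}" for s
    proof -
      have "norm (f k s - f k z) \<le> h ^ i * M * norm (s - z)"
        by (rule field_differentiable_bound[of "{a..a + h}" _ "f (Suc k)"])
           (use s z IH df in \<open>auto intro: DERIV_subset\<close>)
      also have "\<dots> \<le> h ^ i * M * h" using s z M0 h by (intro mult_left_mono) auto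
      finally show ?thesis using z by (simp add: mult_ac)
    qed
    then show ?case by (simp add: k_def)
  qed
  define Q where "Q = (\<Prod>j\<in>S. [:- (\<i> * complex_of_real (w j)), 1:])"
  have degQ: "Polynomial.degree Q = n" unfolding Q_def n_def using S
    by (subst degree_prod_eq_sum_degree) auto
  have lead: "Polynomial.coeff Q n = 1"
  proof -
    have "lead_coeff Q = 1" unfolding Q_def lead_coeff_prod by simp
    then show ?thesis by (simp add: degQ)
  qed
  have ode: "(\<Sum>k\<le>n. Polynomial.coeff Q k * F k s) = 0" for s
  proof -
    have "(\<Sum>k\<le>n. Polynomial.coeff Q k * F k s) = (\<Sum>j\<in>S. c j * exp (\<i> * of_real (w j * s)) * Polynomial.poly Q (\<i> * of_real (w j)))"
      unfolding F_def poly_altdef degQ sum_distrib_left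
      by (subst sum.swap) (simp add: mult_ac)
    also have "\<dots> = 0"
    proof (rule sum.neutral, safe)
      fix j assume "j \<in> S"
      then have "Polynomial.poly Q (\<i> * of_real (w j)) = 0" unfolding Q_def poly_prod using S by auto
      then show "c j * exp (\<i> * of_real (w j * s)) * Polynomial.poly Q (\<i> * of_real (w j)) = 0" by simp
    qed
    finally show ?thesis .
  qed
  \<comment> \<open>The coefficient norm without its leading term 1; hence (1 + L h)^n < 2 makes
    \<theta> < 1, and M <= \<theta> M forces M = 0.\<close>
  define \<theta> where "\<theta> = (\<Sum>k<n. cmod (Polynomial.coeff Q k) * h ^ (n - k))"
  have "(\<Sum>k\<le>n. cmod (Polynomial.coeff Q k) * h ^ (n - k)) \<le> (1 + L * h) ^ n"
    unfolding Q_def n_def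
    by (rule coeff_prod_linear_sum_bound) (use S w h L in \<open>auto simp: norm_mult\<close>)
  then have \<theta>: "\<theta> < 1" using small lead by (simp add: \<theta>_def n_def flip: lessThan_Suc_atMost)
  have \<theta>0: "\<theta> \<ge> 0" unfolding \<theta>_def using h by (intro sum_nonneg) auto
  have fn: "\<bar>f n s\<bar> \<le> \<theta> * M" if s: "s \<in> {a..a + h}" for s
  proof -
    have "F n s = - (\<Sum>k<n. Polynomial.coeff Q k * F k s)"
      using ode[of s] lead by (simp add: add_eq_0_iff2 flip: lessThan_Suc_atMost)
    then have "\<bar>f n s\<bar> = cmod (\<Sum>k<n. Polynomial.coeff Q k * F k s)" using Ff[of n s]
      by (metis norm_minus_cancel norm_of_real)
    also have "\<dots> \<le> (\<Sum>k<n. cmod (Polynomial.coeff Q k) * (h ^ (n - k) * M))"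
    proof (rule sum_norm_le)
      fix k assume k: "k \<in> {..<n}"
      have "\<bar>f k s\<bar> \<le> h ^ (n - k) * M" using fk[of "n - k"] s k by simp
      then show "cmod (Polynomial.coeff Q k * F k s) \<le> cmod (Polynomial.coeff Q k) * (h ^ (n - k) * M)"
        by (simp add: norm_mult Ff mult_left_mono)
    qed
    also have "\<dots> = \<theta> * M" by (simp add: \<theta>_def sum_distrib_left mult_ac)
    finally show ?thesis .
  qed
  have "M \<le> \<theta> * M" unfolding M_def
    by (rule cSUP_least) (use t fn in \<open>auto simp: M_def\<close>)
  then have "M = 0" using \<theta> \<theta>0 M0 by (smt (verit) mult_left_le_one_le mult_right_mono mult_less_cancel_right2)
  then have "f 0 t = 0" using fk[of n] t by simp
  then show ?thesis by (simp add: Ff)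
qed

text \<open>Too many zeros make F vanish on the whole interval. An interval moved by at most h / 2
  overlaps it in infinitely many points, so F vanishes there as well; repeating this reaches
  t0.\<close>

lemma real_exponential_sum_zeros:
  fixes c :: "'j \<Rightarrow> complex" and w :: "'j \<Rightarrow> real" and S :: "'j set"
  defines "F \<equiv> \<lambda>t. \<Sum>j\<in>S. c j * exp (\<i> * of_real (w j * t))"
  assumes S: "finite S" and w: "\<And>j. j \<in> S \<Longrightarrow> \<bar>w j\<bar> \<le> L" and L: "0 \<le> L" and h: "0 < h"
    and real: "\<And>t. Im (F t) = 0"
    and small: "(1 + L * h) ^ card S < 2"
    and nz: "F t0 \<noteq> 0"
  shows "finite {t\<in>{a..a + h}. F t = 0} \<and> card {t\<in>{a..a + h}. F t = 0} < card S"
proof -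
  have van: "F t = 0" if "finite Z" "card S \<le> card Z" "Z \<subseteq> {a..a + h}" "\<forall>z\<in>Z. F z = 0" "t \<in> {a..a + h}" for Z a t
    using real_exponential_sum_vanishes[of S w L h c Z a t] S w L h real small that by (simp add: F_def)
  have step: "\<forall>t\<in>{a'..a' + h}. F t = 0"
    if "\<forall>t\<in>{a..a + h}. F t = 0" "\<bar>a - a'\<bar> \<le> h / 2" for a a'
  proof -
    have "infinite {max a a'..min a a' + h}" using that(2) h by (intro infinite_Icc) (auto simp: max_def min_def)
    then obtain Z where Z: "finite Z" "card Z = card S" "Z \<subseteq> {max a a'..min a a' + h}"
      using infinite_arbitrarily_large by blast
    show ?thesis
    proof
      fix t assume "t \<in> {a'..a' + h}"
      moreover have "Z \<subseteq> {a'..a' + h}" "\<forall>z\<in>Z. F z = 0" using Z(3) that(1) by force+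
      ultimately show "F t = 0" using van[of Z a' t] Z by auto
    qed
  qed
  have all: False if z: "\<forall>t\<in>{a..a + h}. F t = 0" for a
  proof -
    \<comment> \<open>The signed fraction s of the step h / 2 is fixed in advance, so that after k
      steps the interval starts exactly at t0.\<close>
    have "\<forall>t\<in>{a + real k * (h / 2) * s..a + real k * (h / 2) * s + h}. F t = 0" if s: "\<bar>s\<bar> \<le> 1" for k s
    proof (induction k)
      case (Suc k)
      have "\<bar>a + real k * (h / 2) * s - (a + real (Suc k) * (h / 2) * s)\<bar> = h / 2 * \<bar>s\<bar>"
      proof -
        have "a + real k * (h / 2) * s - (a + real (Suc k) * (h / 2) * s) = - (h / 2 * s)"
          by (simp add: field_simps)
        then show ?thesis using h by (simp only: abs_minus_cancel abs_mult abs_divide abs_of_pos abs_numeral)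
      qed
      also have "\<dots> \<le> h / 2 * 1" using h s by (intro mult_left_mono) auto
      also have "h / 2 * 1 = h / 2" by simp
      finally show ?case by (rule step[OF Suc])
    qed (use z in auto)
    moreover obtain k where k: "\<bar>t0 - a\<bar> / (h / 2) < real k" using reals_Archimedean2 by blast
    have k0: "real k > 0" using k h by (smt (verit) divide_nonneg_pos half_gt_zero)
    define c where "c = real k * (h / 2)"
    define s where "s = (t0 - a) / c"
    have c0: "c > 0" using k0 h by (simp add: c_def)
    have "\<bar>t0 - a\<bar> < c" using k h unfolding c_def by (simp add: pos_divide_less_eq)
    then have "\<bar>s\<bar> \<le> 1" using c0 by (simp add: s_def abs_divide pos_divide_le_eq)
    moreover have "t0 = a + real k * (h / 2) * s" unfolding c_def[symmetric] using c0 by (simp add: s_def)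
    ultimately show False using nz h by fastforce
  qed
  define Y where "Y = {t\<in>{a..a + h}. F t = 0}"
  have no: "\<not> (finite Z \<and> card S \<le> card Z \<and> Z \<subseteq> Y)" for Z
    using van[of Z a] all[of a] unfolding Y_def by blast
  have "finite Y"
    using no infinite_arbitrarily_large[of Y "card S"] by (metis order_refl)
  moreover have "card Y < card S" using no[of Y] calculation by auto
  ultimately show ?thesis by (simp add: Y_def)
qed

section \<open>Oscillatory integrals\<close>

text \<open>With \<open>g = f' / (f'\<^sup>2 + \<nu>)\<close> one has \<open>exp (\<i> f) = - \<i> (exp (\<i> f) g)' + \<i> exp (\<i> f) g' + exp (\<i> f) \<nu> / (f'\<^sup>2 + \<nu>)\<close>;
  this treats stationary (\<open>\<nu> > 0\<close>) and non-stationary (\<open>\<nu> = 0\<close>) phases at once.\<close>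

lemma oscillatory_integral_bound:
  fixes f f' f'' :: "real \<Rightarrow> real"
  assumes ab: "a \<le> b" and \<nu>: "0 \<le> \<nu>"
    and d1: "\<And>t. t \<in> {a..b} \<Longrightarrow> (f has_real_derivative f' t) (at t within {a..b})"
    and d2: "\<And>t. t \<in> {a..b} \<Longrightarrow> (f' has_real_derivative f'' t) (at t within {a..b})"
    and cont: "continuous_on {a..b} f''"
    and pos: "\<And>t. t \<in> {a..b} \<Longrightarrow> 0 < (f' t)\<^sup>2 + \<nu>"
  shows "cmod (integral {a..b} (\<lambda>t. exp (\<i> * of_real (f t)))) \<le>
     \<bar>f' a\<bar> / ((f' a)\<^sup>2 + \<nu>) + \<bar>f' b\<bar> / ((f' b)\<^sup>2 + \<nu>) +
     integral {a..b} (\<lambda>t. (\<bar>f'' t\<bar> + \<nu>) / ((f' t)\<^sup>2 + \<nu>))"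
proof -
  define e where "e t = exp (\<i> * complex_of_real (f t))" for t
  define g where "g t = f' t / ((f' t)\<^sup>2 + \<nu>)" for t
  define g' where "g' t = f'' t * (\<nu> - (f' t)\<^sup>2) / ((f' t)\<^sup>2 + \<nu>)\<^sup>2" for t
  define R where "R t = \<i> * e t * of_real (g' t) + e t * of_real (\<nu> / ((f' t)\<^sup>2 + \<nu>))" for t
  define G where "G t = - \<i> * e t * of_real (g t)" for t
  have cf: "continuous_on {a..b} f" "continuous_on {a..b} f'"
    by (rule DERIV_continuous_on[OF d1] DERIV_continuous_on[OF d2], simp)+
  have nz: "t \<in> {a..b} \<Longrightarrow> (f' t)\<^sup>2 + \<nu> \<noteq> 0" for t using pos[of t] by linarith
  have ce: "continuous_on {a..b} e" unfolding e_def by (intro continuous_intros cf)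
  have cg': "continuous_on {a..b} g'" unfolding g'_def
    using nz by (intro continuous_intros cf cont) auto
  have cR: "continuous_on {a..b} R" unfolding R_def
    using nz by (intro continuous_intros ce cg' cf) auto
  have dg: "(g has_real_derivative g' t) (at t within {a..b})" if t: "t \<in> {a..b}" for t
    unfolding g_def
    by (rule derivative_eq_intros d2 t refl nz[OF t] | simp)+
       (simp add: g'_def power2_eq_square field_simps nz[OF t])
  have dG: "(G has_vector_derivative (e t - R t)) (at t within {a..b})" if t: "t \<in> {a..b}" for t
  proof -
    have e: "(e has_vector_derivative (\<i> * of_real (f' t) * e t)) (at t within {a..b})"
    proof -
      have "((\<lambda>t. \<i> * of_real (f t)) has_vector_derivative (\<i> * of_real (f' t))) (at t within {a..b})"
        using d1[OF t] by (intro has_vector_derivative_mult_right has_vector_derivative_of_real)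
          (simp add: has_real_derivative_iff_has_vector_derivative)
      from field_vector_diff_chain_within[OF this DERIV_subset[OF DERIV_exp subset_UNIV]]
      show ?thesis by (simp add: e_def[abs_def] o_def)
    qed
    have g: "((\<lambda>t. complex_of_real (g t)) has_vector_derivative of_real (g' t)) (at t within {a..b})"
      by (rule has_vector_derivative_of_real[OF dg[OF t]])
    have "(G has_vector_derivative (- \<i> * e t * of_real (g' t) + - \<i> * (\<i> * of_real (f' t) * e t) * of_real (g t)))
       (at t within {a..b})"
      unfolding G_def by (intro has_vector_derivative_mult has_vector_derivative_mult_right e g)
    moreover have "- \<i> * e t * of_real (g' t) + - \<i> * (\<i> * of_real (f' t) * e t) * of_real (g t) = e t - R t"
    proof -
      have "f' t * g t = 1 - \<nu> / ((f' t)\<^sup>2 + \<nu>)"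
        using nz[OF t] by (simp add: g_def field_simps power2_eq_square)
      then have "- \<i> * (\<i> * of_real (f' t) * e t) * of_real (g t) = e t * of_real (1 - \<nu> / ((f' t)\<^sup>2 + \<nu>))"
        by (metis (no_types, opaque_lifting) mult.assoc mult.commute minus_mult_left i_squared mult_1 minus_minus of_real_mult)
      then show ?thesis by (simp add: R_def algebra_simps)
    qed
    ultimately show ?thesis by simp
  qed
  have "((\<lambda>t. e t - R t) has_integral (G b - G a)) {a..b}"
    by (rule fundamental_theorem_of_calculus[OF ab dG])
  then have "((\<lambda>t. (e t - R t) + R t) has_integral (G b - G a) + integral {a..b} R) {a..b}"
    by (intro has_integral_add integrable_integral integrable_continuous_real cR)
  then have I: "integral {a..b} e = (G b - G a) + integral {a..b} R"
    by (simp add: integral_unique)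
  have ne: "cmod (e t) = 1" for t by (simp add: e_def)
  have nG: "cmod (G t) = \<bar>f' t\<bar> / ((f' t)\<^sup>2 + \<nu>)" for t
    using \<nu> unfolding G_def norm_mult norm_minus_cancel norm_ii ne norm_of_real by (simp add: g_def abs_divide)
  have "cmod (integral {a..b} R) \<le> integral {a..b} (\<lambda>t. (\<bar>f'' t\<bar> + \<nu>) / ((f' t)\<^sup>2 + \<nu>))"
  proof (rule integral_norm_bound_integral)
    show "R integrable_on {a..b}" by (intro integrable_continuous_real cR)
    show "(\<lambda>t. (\<bar>f'' t\<bar> + \<nu>) / ((f' t)\<^sup>2 + \<nu>)) integrable_on {a..b}"
      using nz by (intro integrable_continuous_real continuous_intros cont cf) auto
    fix t assume t: "t \<in> {a..b}"
    define X where "X = (f' t)\<^sup>2 + \<nu>"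
    have X: "X > 0" using pos[OF t] by (simp add: X_def)
    have "\<bar>\<nu> - (f' t)\<^sup>2\<bar> \<le> X" using \<nu> by (simp add: X_def abs_le_iff)
    then have "\<bar>f'' t\<bar> * \<bar>\<nu> - (f' t)\<^sup>2\<bar> / X\<^sup>2 \<le> \<bar>f'' t\<bar> * X / X\<^sup>2"
      using X by (intro divide_right_mono mult_left_mono) auto
    also have "\<dots> = \<bar>f'' t\<bar> / X" using X by (simp add: power2_eq_square)
    finally have g'b: "\<bar>g' t\<bar> \<le> \<bar>f'' t\<bar> / X" by (simp add: g'_def abs_divide abs_mult X_def)
    have "cmod (R t) \<le> \<bar>g' t\<bar> + \<bar>\<nu> / X\<bar>"
      unfolding R_def X_def
      by (rule norm_triangle_le) (simp only: norm_mult norm_ii ne norm_of_real mult_1 order_refl)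
    also have "\<dots> \<le> \<bar>f'' t\<bar> / X + \<nu> / X" using g'b X \<nu> by simp
    finally show "cmod (R t) \<le> (\<bar>f'' t\<bar> + \<nu>) / ((f' t)\<^sup>2 + \<nu>)" by (simp add: X_def add_divide_distrib)
  qed
  then have "cmod (integral {a..b} e) \<le> \<bar>f' a\<bar> / ((f' a)\<^sup>2 + \<nu>) + \<bar>f' b\<bar> / ((f' b)\<^sup>2 + \<nu>) +
     integral {a..b} (\<lambda>t. (\<bar>f'' t\<bar> + \<nu>) / ((f' t)\<^sup>2 + \<nu>))"
    unfolding I using norm_triangle_ineq[of "G b - G a" "integral {a..b} R"] norm_triangle_ineq4[of "G b" "G a"]
    by (simp add: nG)
  then show ?thesis unfolding e_def .
qed

text \<open>The case \<nu> = 0. No monotonicity of f' is assumed; the price is the integral of |f''|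
  / f'^2, which is the second summand.\<close>

lemma nonstationary_phase:
  fixes f f' f'' :: "real \<Rightarrow> real"
  assumes ab: "a \<le> b" and m: "0 < m"
    and d1: "\<And>t. t \<in> {a..b} \<Longrightarrow> (f has_real_derivative f' t) (at t within {a..b})"
    and d2: "\<And>t. t \<in> {a..b} \<Longrightarrow> (f' has_real_derivative f'' t) (at t within {a..b})"
    and cont: "continuous_on {a..b} f''"
    and lo: "\<And>t. t \<in> {a..b} \<Longrightarrow> m \<le> \<bar>f' t\<bar>"
    and up: "\<And>t. t \<in> {a..b} \<Longrightarrow> \<bar>f'' t\<bar> \<le> M"
  shows "cmod (integral {a..b} (\<lambda>t. exp (\<i> * of_real (f t)))) \<le> 2 / m + M * (b - a) / m\<^sup>2"
proof -
  have cf: "continuous_on {a..b} f'"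
    by (rule DERIV_continuous_on[OF d2])
  have nz: "t \<in> {a..b} \<Longrightarrow> f' t \<noteq> 0" for t using lo[of t] m by auto
  have "cmod (integral {a..b} (\<lambda>t. exp (\<i> * of_real (f t)))) \<le>
     \<bar>f' a\<bar> / ((f' a)\<^sup>2 + 0) + \<bar>f' b\<bar> / ((f' b)\<^sup>2 + 0) +
     integral {a..b} (\<lambda>t. (\<bar>f'' t\<bar> + 0) / ((f' t)\<^sup>2 + 0))"
    by (rule oscillatory_integral_bound) (use ab d1 d2 cont nz in auto)
  also have "\<dots> \<le> 1 / m + 1 / m + M * (b - a) / m\<^sup>2"
  proof (intro add_mono)
    have 1: "\<bar>f' t\<bar> / ((f' t)\<^sup>2 + 0) \<le> 1 / m" if t: "t \<in> {a..b}" for t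
    proof -
      have "\<bar>f' t\<bar> / ((f' t)\<^sup>2 + 0) = 1 / \<bar>f' t\<bar>"
        using nz[OF t] by (simp add: power2_eq_square divide_simps abs_if)
      also have "\<dots> \<le> 1 / m" using lo[OF t] m by (intro divide_left_mono) auto
      finally show ?thesis .
    qed
    show "\<bar>f' a\<bar> / ((f' a)\<^sup>2 + 0) \<le> 1 / m" "\<bar>f' b\<bar> / ((f' b)\<^sup>2 + 0) \<le> 1 / m" using 1 ab by auto
    have "integral {a..b} (\<lambda>t. (\<bar>f'' t\<bar> + 0) / ((f' t)\<^sup>2 + 0)) \<le> integral {a..b} (\<lambda>t. M / m\<^sup>2)"
    proof (rule integral_le)
      show "(\<lambda>t. (\<bar>f'' t\<bar> + 0) / ((f' t)\<^sup>2 + 0)) integrable_on {a..b}"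
        using nz by (intro integrable_continuous_real continuous_intros cont cf) auto
      fix t assume t: "t \<in> {a..b}"
      have "m\<^sup>2 \<le> (f' t)\<^sup>2" using power_mono[OF lo[OF t], of 2] m by simp
      then show "(\<bar>f'' t\<bar> + 0) / ((f' t)\<^sup>2 + 0) \<le> M / m\<^sup>2"
        using up[OF t] m by (intro frac_le) auto
    qed auto
    also have "\<dots> = M * (b - a) / m\<^sup>2" using ab by simp
    finally show "integral {a..b} (\<lambda>t. (\<bar>f'' t\<bar> + 0) / ((f' t)\<^sup>2 + 0)) \<le> M * (b - a) / m\<^sup>2" .
  qed
  finally show ?thesis by simp
qed

text \<open>Here \<nu> is the lower bound of |f''| itself, so the integrand is at most 2 |f''| /
  (f'^2 + \<nu>). As f'' has constant sign, this has a multiple of arctan (f' / sqrt \<nu>) as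
  primitive, whose variation is bounded whatever the range of f'. The constant is 1 + 2 pi <=
  8.\<close>

lemma van_der_corput_second_derivative:
  fixes f f' f'' :: "real \<Rightarrow> real"
  assumes ab: "a \<le> b" and \<nu>: "0 < \<nu>"
    and d1: "\<And>t. t \<in> {a..b} \<Longrightarrow> (f has_real_derivative f' t) (at t within {a..b})"
    and d2: "\<And>t. t \<in> {a..b} \<Longrightarrow> (f' has_real_derivative f'' t) (at t within {a..b})"
    and cont: "continuous_on {a..b} f''"
    and lo: "\<And>t. t \<in> {a..b} \<Longrightarrow> \<nu> \<le> \<bar>f'' t\<bar>"
  shows "cmod (integral {a..b} (\<lambda>t. exp (\<i> * of_real (f t)))) \<le> 8 / sqrt \<nu>"
proof -
  have cf: "continuous_on {a..b} f'"
    by (rule DERIV_continuous_on[OF d2])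
  have nz: "(f' t)\<^sup>2 + \<nu> > 0" for t using \<nu> by (simp add: add_nonneg_pos)
  have nz0: "(f' t)\<^sup>2 + \<nu> \<noteq> 0" for t using nz[of t] by simp
  define s where "s = sqrt \<nu>"
  have s: "s > 0" "s\<^sup>2 = \<nu>" using \<nu> by (auto simp: s_def)
  have "(\<forall>t\<in>{a..b}. 0 < f'' t) \<or> (\<forall>t\<in>{a..b}. f'' t < 0)"
  proof (rule ccontr)
    assume "\<not> ?thesis"
    then obtain x y where xy: "x \<in> {a..b}" "y \<in> {a..b}" "f'' x \<le> 0" "0 \<le> f'' y" by force
    have "connected (f'' ` {a..b})" using cont by (rule connected_continuous_image) simp
    then have "0 \<in> f'' ` {a..b}" using xy unfolding connected_iff_interval by blast
    then show False using lo \<nu> by fastforce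
  qed
  then obtain \<sigma> :: real where \<sigma>: "\<bar>\<sigma>\<bar> = 1" "\<And>t. t \<in> {a..b} \<Longrightarrow> \<bar>f'' t\<bar> = \<sigma> * f'' t"
  proof
    assume "\<forall>t\<in>{a..b}. 0 < f'' t" then show ?thesis using that[of 1] by (auto simp: abs_of_pos)
  next
    assume "\<forall>t\<in>{a..b}. f'' t < 0" then show ?thesis using that[of "-1"] by (auto simp: abs_of_neg)
  qed
  have g: "\<bar>f' t\<bar> / ((f' t)\<^sup>2 + \<nu>) \<le> 1 / (2 * s)" for t
  proof -
    have "0 \<le> (\<bar>f' t\<bar> - s)\<^sup>2" by simp
    then have "2 * \<bar>f' t\<bar> * s \<le> (f' t)\<^sup>2 + \<nu>" by (simp add: power2_diff s)
    then show ?thesis using nz[of t] s(1) by (simp add: field_simps)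
  qed
  define J where "J t = \<sigma> * f'' t / ((f' t)\<^sup>2 + \<nu>)" for t
  have "(J has_integral (\<sigma> / s * arctan (f' b / s) - \<sigma> / s * arctan (f' a / s))) {a..b}"
  proof (rule fundamental_theorem_of_calculus[OF ab])
    fix t assume t: "t \<in> {a..b}"
    have "((\<lambda>t. \<sigma> / s * arctan (f' t / s)) has_real_derivative
        \<sigma> / s * (inverse (1 + (f' t / s)\<^sup>2) * (f'' t / s))) (at t within {a..b})"
      by (intro DERIV_cmult DERIV_chain2[OF DERIV_arctan] DERIV_cdivide d2 t)
    moreover have "\<sigma> / s * (inverse (1 + (f' t / s)\<^sup>2) * (f'' t / s)) = J t"
    proof -
      define X where "X = (f' t)\<^sup>2 + \<nu>"
      have X: "X \<noteq> 0" using nz0[of t] by (simp add: X_def)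
      have "1 + (f' t / s)\<^sup>2 = X / s\<^sup>2"
        using s(1) by (simp add: X_def power_divide add_divide_distrib s(2)[symmetric])
      then show ?thesis using s(1) X by (simp only: J_def X_def[symmetric]) (simp add: power2_eq_square)
    qed
    ultimately show "((\<lambda>t. \<sigma> / s * arctan (f' t / s)) has_vector_derivative J t) (at t within {a..b})"
      by (simp add: has_real_derivative_iff_has_vector_derivative)
  qed
  then have J: "J integrable_on {a..b}" "integral {a..b} J = \<sigma> / s * (arctan (f' b / s) - arctan (f' a / s))"
    by (auto simp: has_integral_integrable integral_unique algebra_simps)
  have "\<bar>arctan (f' b / s) - arctan (f' a / s)\<bar> \<le> pi"
    using arctan_bounded[of "f' b / s"] arctan_bounded[of "f' a / s"] by (simp add: abs_le_iff)
  then have "\<bar>integral {a..b} J\<bar> \<le> pi / s"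
    unfolding J(2) abs_mult abs_divide using s \<sigma>(1) by (simp add: divide_right_mono)
  then have Jb: "integral {a..b} J \<le> pi / s" by linarith
  have "integral {a..b} (\<lambda>t. (\<bar>f'' t\<bar> + \<nu>) / ((f' t)\<^sup>2 + \<nu>)) \<le> integral {a..b} (\<lambda>t. 2 * J t)"
  proof (rule integral_le)
    show "(\<lambda>t. (\<bar>f'' t\<bar> + \<nu>) / ((f' t)\<^sup>2 + \<nu>)) integrable_on {a..b}"
      using nz0 by (intro integrable_continuous_real continuous_intros cont cf) auto
    show "(\<lambda>t. 2 * J t) integrable_on {a..b}" using J(1) by (rule integrable_on_mult_right)
    fix t assume t: "t \<in> {a..b}"
    have "\<bar>f'' t\<bar> + \<nu> \<le> 2 * (\<sigma> * f'' t)" using lo[OF t] \<sigma>(2)[OF t] by simp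
    then have "(\<bar>f'' t\<bar> + \<nu>) / ((f' t)\<^sup>2 + \<nu>) \<le> 2 * (\<sigma> * f'' t) / ((f' t)\<^sup>2 + \<nu>)"
      using nz[of t] by (intro divide_right_mono) auto
    then show "(\<bar>f'' t\<bar> + \<nu>) / ((f' t)\<^sup>2 + \<nu>) \<le> 2 * J t" by (simp add: J_def)
  qed
  also have "\<dots> \<le> 2 * (pi / s)" using Jb by simp
  finally have I: "integral {a..b} (\<lambda>t. (\<bar>f'' t\<bar> + \<nu>) / ((f' t)\<^sup>2 + \<nu>)) \<le> 2 * (pi / s)" .
  have "cmod (integral {a..b} (\<lambda>t. exp (\<i> * of_real (f t)))) \<le>
     \<bar>f' a\<bar> / ((f' a)\<^sup>2 + \<nu>) + \<bar>f' b\<bar> / ((f' b)\<^sup>2 + \<nu>) +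
     integral {a..b} (\<lambda>t. (\<bar>f'' t\<bar> + \<nu>) / ((f' t)\<^sup>2 + \<nu>))"
    by (rule oscillatory_integral_bound) (use ab d1 d2 cont nz \<nu> in auto)
  also have "\<dots> \<le> 1 / (2 * s) + 1 / (2 * s) + 2 * (pi / s)"
    by (intro add_mono g I)
  also have "\<dots> = (1 + 2 * pi) / s" using s by (simp add: field_simps)
  also have "\<dots> \<le> 8 / s" using s pi_less_4 pi_approx by (intro divide_right_mono) auto
  finally show ?thesis by (simp add: s_def)
qed

section \<open>Regular curves\<close>

lemma vector_derivative_norm_diff_le:
  fixes f :: "real \<Rightarrow> 'a::real_normed_vector"
  assumes "convex S" and "\<And>t. t \<in> S \<Longrightarrow> (f has_vector_derivative f' t) (at t within S)"
    and "\<And>t. t \<in> S \<Longrightarrow> norm (f' t) \<le> B" and "s \<in> S" "t \<in> S"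
  shows "norm (f s - f t) \<le> B * \<bar>s - t\<bar>"
proof -
  have "onorm (\<lambda>h::real. h *\<^sub>R v) = norm v" for v :: 'a
    using onorm_scaleR_left[of "\<lambda>h::real. h" v]
    by (simp add: bounded_linear_ident onorm_id[unfolded id_def])
  then show ?thesis
    using differentiable_bound[of S f "\<lambda>t h. h *\<^sub>R f' t" B s t] assms
    by (simp add: has_vector_derivative_def)
qed

text \<open>Names the derivatives and the curvature bound that \<open>regular_param\<close> hides
  behind existential quantifiers.\<close>

locale regular_curve =
  fixes l \<kappa> :: real and \<gamma> \<gamma>' \<gamma>'' :: "real \<Rightarrow> real^2"
  assumes l: "0 < l" "l < 1"
    and d1: "\<And>t. t \<in> {0..l} \<Longrightarrow> (\<gamma> has_vector_derivative \<gamma>' t) (at t within {0..l})"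
    and d2: "\<And>t. t \<in> {0..l} \<Longrightarrow> (\<gamma>' has_vector_derivative \<gamma>'' t) (at t within {0..l})"
    and cont: "continuous_on {0..l} \<gamma>''"
    and unit: "\<And>t. t \<in> {0..l} \<Longrightarrow> norm (\<gamma>' t) = 1"
    and \<kappa>: "0 < \<kappa>" "\<And>t. t \<in> {0..l} \<Longrightarrow> \<kappa> < norm (\<gamma>'' t)" "\<And>t. t \<in> {0..l} \<Longrightarrow> norm (\<gamma>'' t) < 2 * \<kappa>"
      "2 * \<kappa> * l < 1"

lemma regular_param_curve:
  assumes "regular_param l \<gamma>"
  obtains \<kappa> \<gamma>' \<gamma>'' where "regular_curve l \<kappa> \<gamma> \<gamma>' \<gamma>''"
proof -
  from assms obtain \<gamma>' \<gamma>'' \<kappa> where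
       "0 < l \<and> l < 1 \<and> (\<forall>t\<in>{0..l}. (\<gamma> has_vector_derivative \<gamma>' t) (at t within {0..l})) \<and>
       (\<forall>t\<in>{0..l}. (\<gamma>' has_vector_derivative \<gamma>'' t) (at t within {0..l})) \<and>
       continuous_on {0..l} \<gamma>'' \<and>
       (\<forall>t\<in>{0..l}. norm (\<gamma>' t) = 1) \<and>
       0 < \<kappa> \<and> (\<forall>t\<in>{0..l}. \<kappa> < norm (\<gamma>'' t) \<and> norm (\<gamma>'' t) < 2 * \<kappa>) \<and>
       2 * \<kappa> * l < 1"
    unfolding regular_param_def by blast
  then have "regular_curve l \<kappa> \<gamma> \<gamma>' \<gamma>''" by unfold_locales blast+
  then show ?thesis by (rule that)
qed

text \<open>In the plane q is a multiple of p rotated by a right angle, and the squared components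
  of v along p and its rotation add up to v \<bullet> v. This converts an upper bound for the first
  derivative of a phase into a lower bound for the second.\<close>

lemma inner_orthogonal_square:
  fixes p q v :: "real^2"
  assumes "p \<bullet> p = 1" "p \<bullet> q = 0"
  shows "(v \<bullet> q)\<^sup>2 = (q \<bullet> q) * (v \<bullet> v - (v \<bullet> p)\<^sup>2)"
proof -
  define a b where "a = p $ 1" and "b = p $ 2"
  define c d where "c = q $ 1" and "d = q $ 2"
  define x y where "x = v $ 1" and "y = v $ 2"
  define m where "m = a * d - b * c"
  have 1: "a * a + b * b = 1" "a * c + b * d = 0"
    using assms by (simp_all add: inner_vec_def sum_2 a_def b_def c_def d_def)
  have "c = (a * a + b * b) * c - a * (a * c + b * d)" using 1 by simp
  then have c: "c = - (m * b)" by (simp add: m_def algebra_simps)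
  have "d = (a * a + b * b) * d - b * (a * c + b * d)" using 1 by simp
  then have d: "d = m * a" by (simp add: m_def algebra_simps)
  have "q \<bullet> q = m\<^sup>2 * (a * a + b * b)"
    by (simp add: inner_vec_def sum_2 flip: c_def d_def) (simp add: c d power2_eq_square algebra_simps)
  then have qq: "q \<bullet> q = m\<^sup>2" using 1 by simp
  have "(v \<bullet> q)\<^sup>2 = (x * c + y * d)\<^sup>2"
    by (simp add: inner_vec_def sum_2 x_def y_def c_def d_def)
  also have "\<dots> = m\<^sup>2 * (y * a - x * b)\<^sup>2" by (simp add: c d power2_eq_square algebra_simps)
  also have "(y * a - x * b)\<^sup>2 = (a * a + b * b) * (x * x + y * y) - (x * a + y * b)\<^sup>2"
    by (simp add: power2_eq_square algebra_simps)
  also have "\<dots> = v \<bullet> v - (v \<bullet> p)\<^sup>2"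
    using 1(1) by (simp add: inner_vec_def sum_2 x_def y_def a_def b_def)
  finally show ?thesis by (simp add: qq)
qed

lemma real_derivative_ge_imp_expanding:
  fixes g g' :: "real \<Rightarrow> real"
  assumes der: "\<And>t. t \<in> {a..b} \<Longrightarrow> (g has_real_derivative g' t) (at t within {a..b})"
    and g': "\<And>t. t \<in> {a..b} \<Longrightarrow> c \<le> \<bar>g' t\<bar>" and st: "s \<in> {a..b}" "t \<in> {a..b}"
  shows "c * \<bar>s - t\<bar> \<le> \<bar>g s - g t\<bar>"
proof -
  have *: "c * \<bar>s - t\<bar> \<le> \<bar>g s - g t\<bar>" if st: "s \<in> {a..b}" "t \<in> {a..b}" "s < t" for s t
  proof -
    have sub: "{s..t} \<subseteq> {a..b}" using st by auto
    have "(g has_derivative (*) (g' x)) (at x within {s..t})" if "s \<le> x" "x \<le> t" for x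
    proof -
      have "x \<in> {a..b}" using that sub by auto
      from has_derivative_subset[OF der[OF this, unfolded has_field_derivative_def] sub] show ?thesis .
    qed
    then have "\<exists>x\<in>{s<..<t}. g t - g s = g' x * (t - s)"
      by (intro mvt_simple[OF st(3), of g "\<lambda>x. (*) (g' x)"]) auto
    then obtain x where x: "x \<in> {s<..<t}" "g t - g s = g' x * (t - s)" by blast
    have "c * (t - s) \<le> \<bar>g' x\<bar> * (t - s)" using x st g'[of x] by (intro mult_right_mono) auto
    also have "\<dots> = \<bar>g t - g s\<bar>" using x st by (simp add: abs_mult mult.commute)
    finally show ?thesis using st by (simp add: abs_minus_commute)
  qed
  show ?thesis
    using *[of s t] *[of t s] st by (cases s t rule: linorder_cases) (auto simp: abs_minus_commute)
qed

text \<open>Change of variables. It compares the time a curve spends in a set with the measure of a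
  coordinate projection.\<close>

lemma measure_le_of_derivative_ge:
  fixes g g' :: "real \<Rightarrow> real"
  assumes der: "\<And>t. t \<in> {a..b} \<Longrightarrow> (g has_real_derivative g' t) (at t within {a..b})"
    and cont: "continuous_on {a..b} g'"
    and g': "\<And>t. t \<in> {a..b} \<Longrightarrow> c \<le> \<bar>g' t\<bar>" and c: "0 < c"
    and T: "compact T" "T \<subseteq> {a..b}"
  shows "c * measure lebesgue T \<le> measure lebesgue (g ` T)"
proof -
  have inj: "inj_on g T"
  proof (rule inj_onI)
    fix s t assume st: "s \<in> T" "t \<in> T" "g s = g t"
    have "s \<in> {a..b}" "t \<in> {a..b}" using st T(2) by blast+
    from real_derivative_ge_imp_expanding[OF der g' this] have "c * \<bar>s - t\<bar> \<le> 0" using st by simp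
    then show "s = t" using c by (simp add: mult_le_0_iff)
  qed
  have dT: "(g has_real_derivative g' t) (at t within T)" if "t \<in> T" for t
    using der T(2) that by (meson DERIV_subset subsetD)
  have cT: "continuous_on T g" by (rule DERIV_continuous_on[OF dT])
  have cT': "continuous_on T g'" using cont T(2) continuous_on_subset by blast
  have gT: "compact (g ` T)" using compact_continuous_image[OF cT T(1)] .
  have mT: "T \<in> lmeasurable" "g ` T \<in> lmeasurable" using T gT by (auto intro: lmeasurable_compact)
  have "(\<lambda>x. 1::real) absolutely_integrable_on g ` T" "integral (g ` T) (\<lambda>x. 1::real) = measure lebesgue (g ` T)"
    using mT by (auto simp: absolutely_integrable_on_const lmeasure_integral)
  then have I: "(\<lambda>x. \<bar>g' x\<bar> *\<^sub>R (1::real)) absolutely_integrable_on T"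
     "integral T (\<lambda>x. \<bar>g' x\<bar> *\<^sub>R (1::real)) = measure lebesgue (g ` T)"
    using has_absolute_integral_change_of_variables_real[of T g g' "\<lambda>x. 1::real" "measure lebesgue (g ` T)"]
      dT inj mT by (auto simp: fmeasurableD)
  have "c * measure lebesgue T = integral T (\<lambda>x. c)"
    using mT by (simp add: lmeasure_integral flip: integral_mult_right)
  also have "\<dots> \<le> integral T (\<lambda>x. \<bar>g' x\<bar> *\<^sub>R (1::real))"
  proof (rule integral_le)
    show "(\<lambda>x. c) integrable_on T" using mT(1) by (simp add: integrable_on_const)
    show "(\<lambda>x. \<bar>g' x\<bar> *\<^sub>R (1::real)) integrable_on T" using I(1) set_lebesgue_integral_eq_integral(1) by blast
  qed (use g' T in auto)
  finally show ?thesis using I by simp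
qed

context regular_curve
begin

lemma continuous: "continuous_on {0..l} \<gamma>" "continuous_on {0..l} \<gamma>'"
  by (rule continuous_on_vector_derivative[OF d1] continuous_on_vector_derivative[OF d2], assumption)+

lemma component_derivative:
  assumes "t \<in> {0..l}"
  shows "((\<lambda>t. v \<bullet> \<gamma> t) has_real_derivative v \<bullet> \<gamma>' t) (at t within {0..l})"
    "((\<lambda>t. v \<bullet> \<gamma>' t) has_real_derivative v \<bullet> \<gamma>'' t) (at t within {0..l})"
  unfolding has_real_derivative_iff_has_vector_derivative
  by (rule bounded_linear.has_vector_derivative[OF bounded_linear_inner_right d1[OF assms]],
      rule bounded_linear.has_vector_derivative[OF bounded_linear_inner_right d2[OF assms]])

lemma orthogonal: assumes t: "t \<in> {0..l}" shows "\<gamma>' t \<bullet> \<gamma>'' t = 0"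
proof -
  have "((\<lambda>t. \<gamma>' t \<bullet> \<gamma>' t) has_vector_derivative (\<gamma>' t \<bullet> \<gamma>'' t + \<gamma>'' t \<bullet> \<gamma>' t)) (at t within {0..l})"
    by (rule bounded_bilinear.has_vector_derivative[OF bounded_bilinear_inner d2[OF t] d2[OF t]])
  moreover have "((\<lambda>t. \<gamma>' t \<bullet> \<gamma>' t) has_vector_derivative 0) (at t within {0..l})"
    by (rule has_vector_derivative_transform[OF t _ has_vector_derivative_const[of 1]])
      (use unit in \<open>simp add: dot_square_norm\<close>)
  ultimately have "\<gamma>' t \<bullet> \<gamma>'' t + \<gamma>'' t \<bullet> \<gamma>' t = 0"
    using vector_derivative_unique_within_closed_interval[of 0 l t] l t by (metis cbox_interval)
  then show ?thesis by (simp add: inner_commute)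
qed

lemma tangent_lipschitz:
  assumes "s \<in> {0..l}" "t \<in> {0..l}" shows "norm (\<gamma>' s - \<gamma>' t) \<le> 2 * \<kappa> * \<bar>s - t\<bar>"
  using vector_derivative_norm_diff_le[of "{0..l}" \<gamma>' \<gamma>'' "2 * \<kappa>" s t] d2 \<kappa>(3) assms by (simp add: less_imp_le)

text \<open>Comes from 2 \<kappa> l < 1. The tangent therefore cannot turn from nearly orthogonal to
  nearly parallel to a given direction.\<close>

lemma tangent_variation:
  assumes "s \<in> {0..l}" "t \<in> {0..l}" shows "norm (\<gamma>' s - \<gamma>' t) < 1"
proof -
  have "2 * \<kappa> * \<bar>s - t\<bar> \<le> 2 * \<kappa> * l" using assms \<kappa>(1) by (intro mult_left_mono) auto
  then show ?thesis using tangent_lipschitz[OF assms] \<kappa>(4) by linarith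
qed

text \<open>Put w = 2 pi v. Either w \<bullet> \<gamma>' has size at least |w| / 4 throughout and
  the non-stationary bound applies, or some tangent is nearly orthogonal to w. Then no tangent of
  the arc is nearly parallel to w, so w \<bullet> \<gamma>'' has size at least \<kappa> |w| / 5
  everywhere and the second derivative test applies.\<close>

lemma oscillation:
  assumes v: "v \<noteq> 0"
  shows "cmod (integral {0..l} (\<lambda>t. exp (\<i> * of_real (2 * pi * (v \<bullet> \<gamma> t))))) \<le> 4 / norm v + 8 / sqrt (\<kappa> * norm v)"
proof -
  define w where "w = (2 * pi) *\<^sub>R v"
  define V where "V = norm v"
  have V: "V > 0" using v by (simp add: V_def)
  have nw: "norm w = 2 * pi * V" by (simp add: w_def V_def)
  have pc: "pi > 3" using pi_gt3 .
  have eq: "integral {0..l} (\<lambda>t. exp (\<i> * of_real (2 * pi * (v \<bullet> \<gamma> t)))) = integral {0..l} (\<lambda>t. exp (\<i> * of_real (w \<bullet> \<gamma> t)))"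
    by (simp add: w_def)
  have cw: "continuous_on {0..l} (\<lambda>t. w \<bullet> \<gamma>'' t)" by (intro continuous_intros cont)
  have r1: "4 / V \<ge> 0" "8 / sqrt (\<kappa> * V) \<ge> 0" using V \<kappa> by auto
  show ?thesis
  proof (cases "\<forall>t\<in>{0..l}. norm w / 4 \<le> \<bar>w \<bullet> \<gamma>' t\<bar>")
    case True
    have "cmod (integral {0..l} (\<lambda>t. exp (\<i> * of_real (w \<bullet> \<gamma> t)))) \<le>
       2 / (norm w / 4) + (norm w * (2 * \<kappa>)) * (l - 0) / (norm w / 4)\<^sup>2"
    proof (rule nonstationary_phase[OF _ _ component_derivative cw])
      fix t assume t: "t \<in> {0..l}"
      have "\<bar>w \<bullet> \<gamma>'' t\<bar> \<le> norm w * norm (\<gamma>'' t)" by (rule Cauchy_Schwarz_ineq2)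
      also have "\<dots> \<le> norm w * (2 * \<kappa>)" using \<kappa>(3)[OF t] by (intro mult_left_mono) auto
      finally show "\<bar>w \<bullet> \<gamma>'' t\<bar> \<le> norm w * (2 * \<kappa>)" .
    qed (use True l V nw in auto)
    also have "\<dots> = (8 + 16 * (2 * \<kappa> * l)) / norm w"
      using V nw by (simp add: field_simps power2_eq_square)
    also have "\<dots> \<le> 24 / norm w" using \<kappa>(4) by (intro divide_right_mono) auto
    also have "\<dots> \<le> 4 / V"
      using V pc by (simp add: nw divide_simps)
    finally show ?thesis using r1 unfolding eq V_def by linarith
  next
    case False
    then obtain s where s: "s \<in> {0..l}" "\<bar>w \<bullet> \<gamma>' s\<bar> < norm w / 4" by force
    define W where "W = norm w"
    have W: "W > 0" using V by (simp add: W_def nw)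
    have "\<kappa> * W / 5 \<le> \<bar>w \<bullet> \<gamma>'' t\<bar>" if t: "t \<in> {0..l}" for t
    proof -
      have b: "\<bar>w \<bullet> \<gamma>' t\<bar> \<le> 39 / 40 * W"
      proof -
        \<comment> \<open>Otherwise u / W would be within 0.224 of \<gamma>' t but more than 1.2245
          away from \<gamma>' s, and the tangents would differ by more than 1. The squares of these
          numbers lie just above 2 - 2 (39/40) = 1/20 and just below 2 - 2/4 = 3/2.\<close>
        have *: "u \<bullet> \<gamma>' t \<le> 39 / 40 * W" if u: "norm u = W" "\<bar>u \<bullet> \<gamma>' s\<bar> < W / 4" for u
        proof (rule ccontr)
          assume "\<not> ?thesis"
          then have c: "39 / 40 * W < u \<bullet> \<gamma>' t" by simp
          define x where "x = u - W *\<^sub>R \<gamma>' t"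
          define y where "y = u - W *\<^sub>R \<gamma>' s"
          have g: "\<gamma>' t \<bullet> \<gamma>' t = 1" "\<gamma>' s \<bullet> \<gamma>' s = 1" using unit t s by (auto simp: dot_square_norm)
          have uu: "u \<bullet> u = W * W" using u by (simp add: dot_square_norm power2_eq_square)
          have "(norm x)\<^sup>2 = 2 * W * W - 2 * W * (u \<bullet> \<gamma>' t)"
            unfolding x_def power2_norm_eq_inner using g uu by (simp add: inner_diff inner_commute algebra_simps)
          also have "\<dots> < 2 * W * W - 2 * W * (39 / 40 * W)" using c W by simp
          also have "\<dots> < (224 / 1000 * W)\<^sup>2" using W by (simp add: power2_eq_square)
          finally have nx: "norm x < 224 / 1000 * W" by (rule power_less_imp_less_base) (use W in simp)
          have "(12245 / 10000 * W)\<^sup>2 < 2 * W * W - 2 * W * (W / 4)" using W by (simp add: power2_eq_square)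
          also have "\<dots> < 2 * W * W - 2 * W * (u \<bullet> \<gamma>' s)" using u W by simp
          also have "\<dots> = (norm y)\<^sup>2"
            unfolding y_def power2_norm_eq_inner using g uu by (simp add: inner_diff inner_commute algebra_simps)
          finally have ny: "12245 / 10000 * W < norm y" by (rule power_less_imp_less_base) simp
          have "y - x = W *\<^sub>R (\<gamma>' t - \<gamma>' s)" by (simp add: x_def y_def scaleR_diff_right)
          then have "norm (y - x) = W * norm (\<gamma>' t - \<gamma>' s)" using W by simp
          also have "\<dots> \<le> W * 1" using tangent_variation[OF t s(1)] W by (intro mult_left_mono) auto
          finally have "norm (y - x) \<le> W" by simp
          then show False using nx ny norm_triangle_ineq2[of y x] W by linarith
        qed
        show ?thesis using *[of w] *[of "- w"] s by (simp add: W_def abs_le_iff)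
      qed
      have "(w \<bullet> \<gamma>'' t)\<^sup>2 = (\<gamma>'' t \<bullet> \<gamma>'' t) * (w \<bullet> w - (w \<bullet> \<gamma>' t)\<^sup>2)"
        using unit[OF t] orthogonal[OF t] by (intro inner_orthogonal_square) (auto simp: dot_square_norm)
      moreover have "(w \<bullet> \<gamma>' t)\<^sup>2 \<le> (39 / 40 * W)\<^sup>2" using b by (intro power2_le_iff_abs_le[THEN iffD2]) (use W in auto)
      moreover have "\<kappa>\<^sup>2 \<le> \<gamma>'' t \<bullet> \<gamma>'' t" unfolding dot_square_norm
        using \<kappa>(2)[OF t] \<kappa>(1) by (intro power_mono) auto
      ultimately have "\<kappa>\<^sup>2 * (W * W - (39 / 40 * W)\<^sup>2) \<le> (w \<bullet> \<gamma>'' t)\<^sup>2"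
        using W by (simp add: dot_square_norm W_def) (intro mult_mono, auto simp: power2_eq_square)
      \<comment> \<open>Numerically, 1/25 <= 1 - (39/40)^2.\<close>
      moreover have "(\<kappa> * W / 5)\<^sup>2 \<le> \<kappa>\<^sup>2 * (W * W - (39 / 40 * W)\<^sup>2)"
        using W by (simp add: power2_eq_square algebra_simps)
      ultimately have "(\<kappa> * W / 5)\<^sup>2 \<le> \<bar>w \<bullet> \<gamma>'' t\<bar>\<^sup>2" by simp
      then show ?thesis by (rule power2_le_imp_le) simp
    qed
    then have "cmod (integral {0..l} (\<lambda>t. exp (\<i> * of_real (w \<bullet> \<gamma> t)))) \<le> 8 / sqrt (\<kappa> * W / 5)"
      using W l \<kappa> by (intro van_der_corput_second_derivative[OF _ _ component_derivative cw]) auto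
    also have "\<dots> \<le> 8 / sqrt (\<kappa> * V)"
    proof -
      have "\<kappa> * (V * 5) \<le> \<kappa> * W" using \<kappa> V pc unfolding W_def nw by (intro mult_left_mono) auto
      then show ?thesis using \<kappa> V by (intro divide_left_mono) auto
    qed
    finally show ?thesis using r1 unfolding eq V_def by linarith
  qed
qed

end

context regular_curve
begin

lemma lipschitz:
  assumes "s \<in> {0..l}" "t \<in> {0..l}" shows "norm (\<gamma> s - \<gamma> t) \<le> \<bar>s - t\<bar>"
  using vector_derivative_norm_diff_le[of "{0..l}" \<gamma> \<gamma>' 1 s t] d1 unit assms by simp

text \<open>Supporting lines parallel to the initial tangent do it: in the normal direction the
  curve moves with speed at most 2 \<kappa> l. Through this bound the hypothesis on the width
  becomes a lower bound for \<kappa> l^2.\<close>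

lemma width_le: "width (\<gamma> ` {0..l}) \<le> 2 * \<kappa> * l\<^sup>2"
proof -
  define u :: "real^2" where "u = vector [- (\<gamma>' 0 $ 2), \<gamma>' 0 $ 1]"
  have 0: "0 \<in> {0..l}" using l by simp
  have "norm (\<gamma>' 0) = 1" using unit[OF 0] .
  then have nu: "norm u = 1" by (simp add: u_def norm_vec_def L2_set_def sum_2 add.commute)
  have u0: "u \<bullet> \<gamma>' 0 = 0" by (simp add: u_def inner_vec_def sum_2)
  define g where "g t = u \<bullet> \<gamma> t" for t
  have cg: "continuous_on {0..l} g" unfolding g_def by (intro continuous_intros continuous)
  obtain t1 where t1: "t1 \<in> {0..l}" "\<And>t. t \<in> {0..l} \<Longrightarrow> g t1 \<le> g t"
    using continuous_attains_inf[OF _ _ cg] 0 by auto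
  obtain t2 where t2: "t2 \<in> {0..l}" "\<And>t. t \<in> {0..l} \<Longrightarrow> g t \<le> g t2"
    using continuous_attains_sup[OF _ _ cg] 0 by auto
  have "norm (g t2 - g t1) \<le> 2 * \<kappa> * l * norm (t2 - t1)"
  proof (rule field_differentiable_bound[of "{0..l}" g "\<lambda>t. u \<bullet> \<gamma>' t"])
    fix t assume t: "t \<in> {0..l}"
    show "(g has_field_derivative u \<bullet> \<gamma>' t) (at t within {0..l})"
      unfolding g_def by (rule component_derivative[OF t])
    have "u \<bullet> \<gamma>' t = u \<bullet> (\<gamma>' t - \<gamma>' 0)" by (simp add: inner_diff_right u0)
    then have "norm (u \<bullet> \<gamma>' t) \<le> norm u * norm (\<gamma>' t - \<gamma>' 0)" using Cauchy_Schwarz_ineq2 by simp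
    also have "\<dots> \<le> 2 * \<kappa> * \<bar>t - 0\<bar>" using tangent_lipschitz[OF t 0] nu by simp
    also have "\<dots> \<le> 2 * \<kappa> * l" using t \<kappa>(1) by (intro mult_left_mono) auto
    finally show "norm (u \<bullet> \<gamma>' t) \<le> 2 * \<kappa> * l" .
  qed (use t1 t2 in auto)
  also have "\<dots> \<le> 2 * \<kappa> * l * l" using t1(1) t2(1) \<kappa>(1) l by (intro mult_left_mono) auto
  finally have gd: "\<bar>g t2 - g t1\<bar> \<le> 2 * \<kappa> * l\<^sup>2" by (simp add: power2_eq_square)
  define L where "L c = {x. u \<bullet> x = c}" for c
  have sup: "parallel_supporting_lines (\<gamma> ` {0..l}) (L (g t1)) (L (g t2))"
    unfolding parallel_supporting_lines_def
  proof (rule exI[of _ u], rule exI[of _ "g t1"], rule exI[of _ "g t2"], intro conjI)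
    have "\<gamma> t1 \<in> \<gamma> ` {0..l} \<inter> L (g t1)" "\<gamma> t2 \<in> \<gamma> ` {0..l} \<inter> L (g t2)"
      using t1(1) t2(1) by (auto simp: L_def g_def)
    then show "\<gamma> ` {0..l} \<inter> L (g t1) \<noteq> {}" "\<gamma> ` {0..l} \<inter> L (g t2) \<noteq> {}" by blast+
    show "\<forall>x\<in>\<gamma> ` {0..l}. g t1 \<le> u \<bullet> x \<and> u \<bullet> x \<le> g t2" using t1(2) t2(2) by (auto simp: g_def)
  qed (use nu in \<open>simp_all add: L_def\<close>)
  have in_L: "c *\<^sub>R u \<in> L c" for c using nu by (simp add: L_def dot_square_norm)
  have "width (\<gamma> ` {0..l}) \<le> setdist (L (g t1)) (L (g t2))"
    unfolding width_def
  proof (rule cInf_lower)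
    show "bdd_below {setdist L1 L2 |L1 L2. parallel_supporting_lines (\<gamma> ` {0..l}) L1 L2}"
      by (rule bdd_belowI[of _ 0]) (auto simp: setdist_pos_le)
  qed (use sup in blast)
  also have "\<dots> \<le> dist (g t1 *\<^sub>R u) (g t2 *\<^sub>R u)" by (intro setdist_le_dist in_L)
  also have "\<dots> = \<bar>g t2 - g t1\<bar>"
    using nu by (simp add: dist_norm abs_minus_commute flip: scaleR_diff_left)
  finally show ?thesis using gd by linarith
qed

text \<open>Two coordinates below 7/10 do not make a unit vector, and over half of the arc the
  tangent moves by at most 1/2, which leaves 7/10 - 1/2 = 1/5. This is the reason for cutting arcs
  into halves.\<close>

lemma half_arc_steep_coordinate:
  assumes ab: "0 \<le> a" "b \<le> l" "b - a \<le> l / 2"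
  shows "\<exists>i. \<forall>t\<in>{a..b}. 1 / 5 \<le> \<bar>\<gamma>' t $ i\<bar>"
proof (cases "a \<le> b")
  case True
  have a: "a \<in> {0..l}" using ab True by auto
  have n: "(\<gamma>' a $ 1)\<^sup>2 + (\<gamma>' a $ 2)\<^sup>2 = 1"
    using unit[OF a] by (simp add: norm_vec_def L2_set_def sum_2)
  have "\<exists>i. 7 / 10 \<le> \<bar>\<gamma>' a $ i\<bar>"
  proof (rule ccontr)
    assume "\<nexists>i. 7 / 10 \<le> \<bar>\<gamma>' a $ i\<bar>"
    then have "\<bar>\<gamma>' a $ i\<bar> < 7 / 10" for i by (simp add: not_le)
    then have "(\<gamma>' a $ i)\<^sup>2 < (7 / 10)\<^sup>2" for i by (subst power2_abs[symmetric]) (intro power_strict_mono, auto)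
    from this[of 1] this[of 2] n show False by (simp add: power2_eq_square)
  qed
  then obtain i where i: "7 / 10 \<le> \<bar>\<gamma>' a $ i\<bar>" by blast
  have "1 / 5 \<le> \<bar>\<gamma>' t $ i\<bar>" if t: "t \<in> {a..b}" for t
  proof -
    have t': "t \<in> {0..l}" using t ab by auto
    have "\<bar>\<gamma>' t $ i - \<gamma>' a $ i\<bar> \<le> norm (\<gamma>' t - \<gamma>' a)"
      using component_le_norm_cart[of "\<gamma>' t - \<gamma>' a" i] by simp
    also have "\<dots> \<le> 2 * \<kappa> * \<bar>t - a\<bar>" by (rule tangent_lipschitz[OF t' a])
    also have "\<dots> \<le> 2 * \<kappa> * (l / 2)" using t ab \<kappa>(1) by (intro mult_left_mono) auto
    finally have "\<bar>\<gamma>' t $ i - \<gamma>' a $ i\<bar> \<le> 1 / 2" using \<kappa>(4) by simp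
    then show ?thesis using i by linarith
  qed
  then show ?thesis by blast
qed auto

end

section \<open>Time spent by an arc in a small square of the torus\<close>

definition int_vecs :: "(real^2) set"
  where "int_vecs = {z. \<forall>i. z $ i \<in> \<int>}"

text \<open>Arcs are handled through a lift, while Q is a subset of the plane that represents a
  subset of the torus; hence the lattice translates.\<close>

definition hits :: "(real \<Rightarrow> real^2) \<Rightarrow> (real^2) set \<Rightarrow> real set \<Rightarrow> real set"
  where "hits \<gamma> Q I = {t \<in> I. \<exists>z\<in>int_vecs. \<gamma> t - z \<in> Q}"

definition square :: "real^2 \<Rightarrow> real \<Rightarrow> (real^2) set"
  where "square p h = {q. \<forall>i. p $ i \<le> q $ i \<and> q $ i \<le> p $ i + h}"

abbreviation chord :: "torus2 set \<Rightarrow> real^2 \<Rightarrow> real \<Rightarrow> 2 \<Rightarrow> real \<Rightarrow> (real^2) set"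
  where "chord Z p h i x \<equiv> {q \<in> square p h. q $ i = x \<and> torus_proj q \<in> Z}"

lemma closed_square: "closed (square p h)"
  unfolding square_def by (intro closed_Collect_all closed_Collect_conj closed_Collect_le continuous_intros)

text \<open>Two points of a half arc are at distance at most 1/2 and the side of the square is below
  1/2, so lattice vectors that occur for them differ by less than 1 in each coordinate and
  coincide.\<close>

lemma (in regular_curve) hits_half_arc:
  assumes ab: "0 \<le> a" "b \<le> l" "b - a \<le> l / 2" and h: "0 \<le> h" "h < 1 / 2"
  shows "\<exists>z\<in>int_vecs. hits \<gamma> (square p h) {a..b} = {t \<in> {a..b}. \<gamma> t - z \<in> square p h}"
proof (cases "hits \<gamma> (square p h) {a..b} = {}")
  case True
  have "0 \<in> int_vecs" by (simp add: int_vecs_def)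
  moreover have "hits \<gamma> (square p h) {a..b} = {t \<in> {a..b}. \<gamma> t - 0 \<in> square p h}"
    using True \<open>0 \<in> int_vecs\<close> unfolding hits_def by blast
  ultimately show ?thesis by blast
next
  case False
  then obtain s z where s: "s \<in> {a..b}" "z \<in> int_vecs" "\<gamma> s - z \<in> square p h"
    unfolding hits_def by blast
  have "w = z" if t: "t \<in> {a..b}" "w \<in> int_vecs" "\<gamma> t - w \<in> square p h" for t w
  proof -
    have "w $ i - z $ i = 0" for i
    proof (rule Ints_nonzero_abs_less1)
      show "w $ i - z $ i \<in> \<int>" using t s by (auto simp: int_vecs_def)
      have "\<bar>\<gamma> t $ i - \<gamma> s $ i\<bar> \<le> norm (\<gamma> t - \<gamma> s)"
        using component_le_norm_cart[of "\<gamma> t - \<gamma> s" i] by simp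
      also have "\<dots> \<le> \<bar>t - s\<bar>" using t s ab by (intro lipschitz) auto
      also have "\<dots> \<le> b - a" using t(1) s(1) by auto
      finally have 1: "\<bar>\<gamma> t $ i - \<gamma> s $ i\<bar> \<le> 1 / 2" using ab l by linarith
      have "p $ i \<le> \<gamma> t $ i - w $ i" "\<gamma> t $ i - w $ i \<le> p $ i + h"
        "p $ i \<le> \<gamma> s $ i - z $ i" "\<gamma> s $ i - z $ i \<le> p $ i + h"
        using t s by (auto simp: square_def)
      then show "\<bar>w $ i - z $ i\<bar> < 1" using 1 h by linarith
    qed
    then show ?thesis by (simp add: Finite_Cartesian_Product.vec_eq_iff)
  qed
  then have "hits \<gamma> (square p h) {a..b} = {t \<in> {a..b}. \<gamma> t - z \<in> square p h}"
    using s unfolding hits_def by blast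
  then show ?thesis using s by blast
qed

text \<open>Along the half arc one coordinate changes with speed at least 1/5, so its image S
  retains at least a fifth of the measure. With a single lattice vector, S becomes a set of
  coordinates of points of one square.\<close>

lemma (in regular_curve) hits_half_arc_measure:
  assumes ab: "0 \<le> a" "b \<le> l" "b - a \<le> l / 2" and h: "0 \<le> h" "h < 1 / 2"
  shows "\<exists>z\<in>int_vecs. \<exists>i. \<exists>S. compact (hits \<gamma> (square p h) {a..b}) \<and>
     S = (\<lambda>t. (\<gamma> t - z) $ i) ` hits \<gamma> (square p h) {a..b} \<and> compact S \<and>
     (\<forall>t\<in>hits \<gamma> (square p h) {a..b}. \<gamma> t - z \<in> square p h) \<and>
     measure lebesgue (hits \<gamma> (square p h) {a..b}) \<le> 5 * measure lebesgue S"
proof -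
  define T where "T = hits \<gamma> (square p h) {a..b}"
  obtain z where z: "z \<in> int_vecs" "T = {t \<in> {a..b}. \<gamma> t - z \<in> square p h}"
    using hits_half_arc[OF ab h] unfolding T_def by blast
  have sub: "{a..b} \<subseteq> {0..l}" using ab by auto
  have cg: "continuous_on {a..b} \<gamma>" "continuous_on {a..b} \<gamma>'"
    using continuous continuous_on_subset[OF _ sub] by blast+
  have "closed ({a..b} \<inter> (\<lambda>t. \<gamma> t - z) -` square p h)"
    by (intro continuous_closed_preimage continuous_intros cg closed_square)
  moreover have "{a..b} \<inter> (\<lambda>t. \<gamma> t - z) -` square p h = T" using z(2) by auto
  ultimately have "closed T" by simp
  moreover have TI: "T \<subseteq> {a..b}" using z(2) by auto
  ultimately have cT: "compact T"
    using compact_Int_closed[OF compact_Icc[of a b], of T] by (simp add: Int_absorb1)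
  obtain i where i: "\<forall>t\<in>{a..b}. 1 / 5 \<le> \<bar>\<gamma>' t $ i\<bar>" using half_arc_steep_coordinate[OF ab] by blast
  define g where "g t = (\<gamma> t - z) $ i" for t
  have dg: "(g has_real_derivative \<gamma>' t $ i) (at t within {a..b})" if t: "t \<in> {a..b}" for t
  proof -
    have "((\<lambda>t. axis i 1 \<bullet> \<gamma> t - z $ i) has_real_derivative axis i 1 \<bullet> \<gamma>' t - 0) (at t within {0..l})"
      using t sub by (intro DERIV_diff component_derivative DERIV_const) auto
    then show ?thesis unfolding g_def using DERIV_subset[OF _ sub] by (simp add: inner_axis')
  qed
  have gT: "continuous_on T g" unfolding g_def
    by (intro continuous_intros continuous_on_subset[OF cg(1) TI])
  have cS: "compact (g ` T)" by (rule compact_continuous_image[OF gT cT])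
  have "1 / 5 * measure lebesgue T \<le> measure lebesgue (g ` T)"
    by (rule measure_le_of_derivative_ge[OF dg]) (use i cT TI in \<open>auto intro!: continuous_intros cg\<close>)
  then have "measure lebesgue T \<le> 5 * measure lebesgue (g ` T)" by simp
  then show ?thesis using z cT cS unfolding T_def[symmetric] g_def
    by (intro bexI[of _ z] exI[of _ i] exI[of _ "g ` T"]) (auto simp: g_def)
qed

text \<open>Integration of the counting function; a finite X is negligible. Later X takes up the
  lines on which the nodal set may contain a whole segment.\<close>

lemma sum_measure_le_multiplicity:
  fixes S :: "'i \<Rightarrow> real set" and n :: real
  assumes I: "finite I" and S: "\<And>i. i \<in> I \<Longrightarrow> S i \<in> lmeasurable" "\<And>i. i \<in> I \<Longrightarrow> S i \<subseteq> {a..b}"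
    and ab: "a \<le> b" and n: "0 \<le> n" and X: "finite X"
    and mult: "\<And>x. x \<in> {a..b} - X \<Longrightarrow> real (card {i\<in>I. x \<in> S i}) \<le> n"
  shows "(\<Sum>i\<in>I. measure lebesgue (S i)) \<le> n * (b - a)"
proof -
  have nX: "negligible X" using X by (rule negligible_finite)
  define R where "R i = S i - X" for i
  have R: "R i \<in> lmeasurable" if "i \<in> I" for i
    unfolding R_def using S(1)[OF that] nX by (intro fmeasurable.Diff) (auto simp: negligible_iff_measure)
  have mR: "measure lebesgue (S i) = integral UNIV (indicat_real (R i))" if "i \<in> I" for i
  proof -
    have "measure lebesgue (S i) = measure lebesgue (R i)"
      unfolding R_def using measure_Diff_null_set[of "S i" lebesgue X] nX S(1)[OF that]
      by (simp add: negligible_iff_null_sets fmeasurableD)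
    then show ?thesis using lmeasure_integral_UNIV[OF R[OF that]] by simp
  qed
  have iR: "indicat_real (R i) integrable_on UNIV" if "i \<in> I" for i
    using R[OF that] integrable_on_indicator[of "R i" UNIV] by simp
  have "(\<Sum>i\<in>I. measure lebesgue (S i)) = (\<Sum>i\<in>I. integral UNIV (indicat_real (R i)))"
    using mR by (intro sum.cong) auto
  also have "\<dots> = integral UNIV (\<lambda>x. \<Sum>i\<in>I. indicat_real (R i) x)"
    using I iR by (intro integral_sum[symmetric]) auto
  also have "\<dots> \<le> integral UNIV (\<lambda>x. n * indicat_real {a..b} x)"
  proof (rule integral_le)
    show "(\<lambda>x. \<Sum>i\<in>I. indicat_real (R i) x) integrable_on UNIV"
      using I iR by (intro integrable_sum) auto
    show "(\<lambda>x. n * indicat_real {a..b} x) integrable_on UNIV"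
      by (intro integrable_on_mult_right) (simp add: integrable_on_indicator)
    fix x :: real
    have "(\<Sum>i\<in>I. indicat_real (R i) x) = real (card {i\<in>I. x \<in> R i})"
      using I by (simp add: indicator_def sum.If_cases Int_def)
    also have "\<dots> \<le> n * indicat_real {a..b} x"
    proof (cases "x \<in> {a..b} - X")
      case True
      have "{i\<in>I. x \<in> R i} \<subseteq> {i\<in>I. x \<in> S i}" by (auto simp: R_def)
      then have "card {i\<in>I. x \<in> R i} \<le> card {i\<in>I. x \<in> S i}" using I by (intro card_mono) auto
      then show ?thesis using mult[OF True] True by simp
    next
      case False
      then have "{i\<in>I. x \<in> R i} = {}" using S(2) unfolding R_def by blast
      then have "card {i\<in>I. x \<in> R i} = 0" by (simp only: card.empty)
      then show ?thesis using n by simp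
    qed
    finally show "(\<Sum>i\<in>I. indicat_real (R i) x) \<le> n * indicat_real {a..b} x" .
  qed
  also have "\<dots> = n * (b - a)"
  proof -
    have "integral UNIV (indicat_real {a..b}) = b - a"
      using lmeasure_integral_UNIV[of "{a..b}"] ab by simp
    then show ?thesis by simp
  qed
  finally show ?thesis .
qed

lemma torus_proj_diff_int: "z \<in> int_vecs \<Longrightarrow> torus_proj (x - z) = torus_proj x"
  by (simp add: torus_proj_eq_iff int_vecs_def)

text \<open>Local form of the Crofton estimate: a half arc is a graph over one of the axes, and each line parallel to
  the other axis meets the disjoint arcs in few points.\<close>

lemma arcs_in_square_length:
  fixes n :: nat
  assumes F: "finite F" "pairwise disjnt F" and arcs: "\<And>C. C \<in> F \<Longrightarrow> arc_lift C (l C) (\<gamma> C)" "\<And>C. C \<in> F \<Longrightarrow> C \<subseteq> Z"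
    and h: "0 \<le> h" "h < 1 / 2"
    and lines: "\<And>i. \<exists>X. finite X \<and> (\<forall>x\<in>{p $ i..p $ i + h} - X.
        finite (chord Z p h i x) \<and> card (chord Z p h i x) \<le> n)"
  shows "(\<Sum>C\<in>F. measure lebesgue (hits (\<gamma> C) (square p h) {0..l C})) \<le> 20 * real n * h"
proof -
  \<comment> \<open>Each arc is cut into two halves, labelled by a truth value.\<close>
  define I where "I C k = (if k then {l C / 2..l C} else {0..l C / 2})" for C and k :: bool
  define T where "T C k = hits (\<gamma> C) (square p h) (I C k)" for C k
  have reg: "\<exists>\<kappa> \<gamma>' \<gamma>''. regular_curve (l C) \<kappa> (\<gamma> C) \<gamma>' \<gamma>''" if "C \<in> F" for C
    using arcs(1)[OF that] regular_param_curve unfolding arc_lift_def by metis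
  \<comment> \<open>One predicate for a pair, so that a single choice function yields the lattice
    vector and the coordinate together.\<close>
  define Q where "Q c w \<longleftrightarrow> fst w \<in> int_vecs \<and> compact (T (fst c) (snd c)) \<and>
      compact ((\<lambda>t. (\<gamma> (fst c) t - fst w) $ snd w) ` T (fst c) (snd c)) \<and>
      (\<forall>t\<in>T (fst c) (snd c). \<gamma> (fst c) t - fst w \<in> square p h) \<and>
      measure lebesgue (T (fst c) (snd c)) \<le> 5 * measure lebesgue ((\<lambda>t. (\<gamma> (fst c) t - fst w) $ snd w) ` T (fst c) (snd c))"
    for c :: "torus2 set \<times> bool" and w :: "(real^2) \<times> 2"
  have "\<exists>w. Q c w" if c: "fst c \<in> F" for c
  proof -
    obtain \<kappa> \<gamma>' \<gamma>'' where r: "regular_curve (l (fst c)) \<kappa> (\<gamma> (fst c)) \<gamma>' \<gamma>''" using reg[OF c] by blast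
    define a b where "a = (if snd c then l (fst c) / 2 else 0)" and "b = (if snd c then l (fst c) else l (fst c) / 2)"
    have "0 < l (fst c)" using r by (simp add: regular_curve_def)
    then have ab: "0 \<le> a" "b \<le> l (fst c)" "b - a \<le> l (fst c) / 2" by (auto simp: a_def b_def)
    have "T (fst c) (snd c) = hits (\<gamma> (fst c)) (square p h) {a..b}" by (simp add: T_def I_def a_def b_def)
    with regular_curve.hits_half_arc_measure[OF r ab h, of p] show ?thesis unfolding Q_def by fastforce
  qed
  then obtain w where w: "\<And>c. fst c \<in> F \<Longrightarrow> Q c (w c)" by metis
  define z where "z C k = fst (w (C, k))" for C k
  define i where "i C k = snd (w (C, k))" for C k
  define S where "S C k = (\<lambda>t. (\<gamma> C t - z C k) $ i C k) ` T C k" for C k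
  have *: "z C k \<in> int_vecs" "compact (T C k)" "S C k = (\<lambda>t. (\<gamma> C t - z C k) $ i C k) ` T C k"
    "compact (S C k)" "\<And>t. t \<in> T C k \<Longrightarrow> \<gamma> C t - z C k \<in> square p h"
    "measure lebesgue (T C k) \<le> 5 * measure lebesgue (S C k)" if "C \<in> F" for C k
    using w[of "(C, k)"] that by (simp_all add: Q_def S_def z_def i_def)
  define P where "P = F \<times> (UNIV :: bool set)"
  have finP: "finite P" using F by (simp add: P_def)
  have coord: "(\<Sum>(C, k)\<in>{(C, k)\<in>P. i C k = i0}. measure lebesgue (S C k)) \<le> real (2 * n) * h" for i0
  proof -
    obtain X where X: "finite X" "\<And>x. x \<in> {p $ i0..p $ i0 + h} - X \<Longrightarrow>
        finite (chord Z p h i0 x) \<and> card (chord Z p h i0 x) \<le> n"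
      using lines[of i0] by blast
    define P' where "P' = {(C, k)\<in>P. i C k = i0}"
    have finP': "finite P'" using finP by (rule finite_subset[rotated]) (auto simp: P'_def)
    have "(\<Sum>c\<in>P'. measure lebesgue (S (fst c) (snd c))) \<le> real (2 * n) * (p $ i0 + h - p $ i0)"
    proof (rule sum_measure_le_multiplicity[OF finP' _ _ _ _ X(1)])
      fix c assume "c \<in> P'"
      then have c: "fst c \<in> F" "i (fst c) (snd c) = i0" by (auto simp: P'_def P_def)
      show "S (fst c) (snd c) \<in> lmeasurable" using *(4)[OF c(1)] by (rule lmeasurable_compact)
      show "S (fst c) (snd c) \<subseteq> {p $ i0..p $ i0 + h}"
        unfolding *(3)[OF c(1)] using *(5)[OF c(1)] c(2) by (auto simp: square_def)
    next
      fix x assume x: "x \<in> {p $ i0..p $ i0 + h} - X"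
      define L where "L = chord Z p h i0 x"
      define J where "J = {c\<in>P'. x \<in> S (fst c) (snd c)}"
      have "\<exists>q\<in>L. torus_proj q \<in> fst c" if "c \<in> J" for c
      proof -
        have c: "fst c \<in> F" "i (fst c) (snd c) = i0" "x \<in> S (fst c) (snd c)" using that by (auto simp: J_def P'_def P_def)
        then obtain t where t: "t \<in> T (fst c) (snd c)" "x = (\<gamma> (fst c) t - z (fst c) (snd c)) $ i0"
          using *(3)[OF c(1), of "snd c"] by auto
        define q where "q = \<gamma> (fst c) t - z (fst c) (snd c)"
        have "0 < l (fst c)" using arcs(1)[OF c(1)] by (auto simp: arc_lift_def regular_param_def)
        then have "t \<in> {0..l (fst c)}" using t(1) by (auto simp: T_def hits_def I_def split: if_splits)
        then have "torus_proj (\<gamma> (fst c) t) \<in> fst c" using arcs(1)[OF c(1)] unfolding arc_lift_def by blast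
        then have "torus_proj q \<in> fst c" unfolding q_def using torus_proj_diff_int *(1)[OF c(1)] by simp
        moreover have "q \<in> L" using calculation arcs(2)[OF c(1)] *(5)[OF c(1) t(1)] t(2) by (auto simp: L_def q_def)
        ultimately show ?thesis by blast
      qed
      then obtain q where q: "\<And>c. c \<in> J \<Longrightarrow> q c \<in> L" "\<And>c. c \<in> J \<Longrightarrow> torus_proj (q c) \<in> fst c" by metis
      \<comment> \<open>A point of the chord lies on at most one of the disjoint arcs, and the truth
        value tells the half; so the multiplicity is at most 2 n.\<close>
      have "inj_on (\<lambda>c. (q c, snd c)) J"
      proof (rule inj_onI)
        fix c d assume cd: "c \<in> J" "d \<in> J" "(q c, snd c) = (q d, snd d)"
        have "fst c \<in> F" "fst d \<in> F" using cd by (auto simp: J_def P'_def P_def)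
        moreover have "torus_proj (q c) \<in> fst c \<inter> fst d" using q(2)[OF cd(1)] q(2)[OF cd(2)] cd(3) by simp
        ultimately have "fst c = fst d" using F(2) by (auto simp: pairwise_def disjnt_def)
        then show "c = d" using cd(3) by (simp add: prod_eq_iff)
      qed
      moreover have "(\<lambda>c. (q c, snd c)) ` J \<subseteq> L \<times> UNIV" using q(1) by auto
      moreover have "finite (L \<times> (UNIV :: bool set))" using X(2)[OF x] by (simp add: L_def)
      ultimately have "card J \<le> card (L \<times> (UNIV :: bool set))" by (rule card_inj_on_le)
      also have "\<dots> \<le> n * 2" using X(2)[OF x] by (simp add: L_def card_cartesian_product)
      finally have "real (card J) \<le> real (2 * n)" by linarith
      then show "real (card {c\<in>P'. x \<in> S (fst c) (snd c)}) \<le> real (2 * n)" by (simp only: J_def)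
    qed (use h in auto)
    then show ?thesis by (simp add: P'_def case_prod_beta)
  qed
  have "(\<Sum>C\<in>F. measure lebesgue (hits (\<gamma> C) (square p h) {0..l C})) \<le> (\<Sum>C\<in>F. \<Sum>k\<in>UNIV. measure lebesgue (T C k))"
  proof (rule sum_mono)
    fix C assume C: "C \<in> F"
    have "0 < l C" using arcs(1)[OF C] by (auto simp: arc_lift_def regular_param_def)
    then have "hits (\<gamma> C) (square p h) {0..l C} = T C False \<union> T C True"
      by (auto simp: hits_def T_def I_def)
    moreover have "measure lebesgue (T C False \<union> T C True) \<le> measure lebesgue (T C False) + measure lebesgue (T C True)"
      using *(2)[OF C] by (intro measure_Un_le) (auto intro: fmeasurableD lmeasurable_compact)
    ultimately show "measure lebesgue (hits (\<gamma> C) (square p h) {0..l C}) \<le> (\<Sum>k\<in>UNIV. measure lebesgue (T C k))"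
      by (simp add: UNIV_bool)
  qed
  also have "\<dots> \<le> (\<Sum>C\<in>F. \<Sum>k\<in>UNIV. 5 * measure lebesgue (S C k))"
    using *(6) by (intro sum_mono) auto
  also have "\<dots> = 5 * (\<Sum>(C, k)\<in>P. measure lebesgue (S C k))"
    by (simp add: P_def sum.cartesian_product sum_distrib_left case_prod_beta)
  also have "(\<Sum>(C, k)\<in>P. measure lebesgue (S C k)) =
     (\<Sum>(C, k)\<in>{(C, k)\<in>P. i C k = 1}. measure lebesgue (S C k)) + (\<Sum>(C, k)\<in>{(C, k)\<in>P. i C k = 2}. measure lebesgue (S C k))"
  proof -
    have "P = {(C, k)\<in>P. i C k = 1} \<union> {(C, k)\<in>P. i C k = 2}" using exhaust_2 by blast
    moreover have "{(C, k)\<in>P. i C k = 1} \<inter> {(C, k)\<in>P. i C k = 2} = {}" by auto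
    ultimately show ?thesis using finP
      by (metis (no_types, lifting) finite_Un sum.union_disjoint)
  qed
  \<comment> \<open>Multiplicity 2 n, two coordinates and the factor 5 of the projection give 20 n
    h.\<close>
  also have "5 * \<dots> \<le> 5 * (real (2 * n) * h + real (2 * n) * h)"
    by (intro mult_left_mono add_mono coord) auto
  finally show ?thesis by (simp add: mult_ac)
qed

section \<open>Plane waves\<close>

definition plane_wave :: "real^2 \<Rightarrow> real^2 \<Rightarrow> complex"
  where "plane_wave v x = exp (\<i> * of_real (2 * pi * (v \<bullet> x)))"

abbreviation trig_sum :: "(int^2 \<Rightarrow> complex) \<Rightarrow> (int^2) set \<Rightarrow> real^2 \<Rightarrow> complex"
  where "trig_sum a K x \<equiv> \<Sum>\<xi>\<in>K. a \<xi> * plane_wave (frequency_vec \<xi>) x"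

lemma norm_plane_wave [simp]: "cmod (plane_wave v x) = 1"
  by (simp add: plane_wave_def)

lemma plane_wave_add_left: "plane_wave (v + w) x = plane_wave v x * plane_wave w x"
  by (simp add: plane_wave_def inner_add_left algebra_simps flip: exp_add)

lemma plane_wave_add_right: "plane_wave v (x + y) = plane_wave v x * plane_wave v y"
  by (simp add: plane_wave_def inner_add_right algebra_simps flip: exp_add)

lemma cnj_plane_wave: "cnj (plane_wave v x) = plane_wave (- v) x"
  by (simp add: plane_wave_def exp_cnj)

lemma torus_char_proj: "torus_char \<xi> (torus_proj x) = plane_wave (frequency_vec \<xi>) x"
proof -
  have "torus_char \<xi> (torus_proj x) = exp (2 * of_real pi * \<i> * of_real (x \<bullet> frequency_vec \<xi>))"
    by transfer simp
  then show ?thesis by (simp add: plane_wave_def inner_commute algebra_simps)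
qed

lemma continuous_on_plane_wave: "continuous_on S g \<Longrightarrow> continuous_on S (\<lambda>t. plane_wave v (g t))"
  unfolding plane_wave_def by (intro continuous_intros)

lemma cmod_exp_i_minus_one_le: "cmod (exp (\<i> * of_real x) - 1) \<le> \<bar>x\<bar>"
  using abs_sin_x_le_abs_x[of "x / 2"] unfolding dist_exp_i_1 by simp

lemma plane_wave_lipschitz: "cmod (plane_wave v x - plane_wave v y) \<le> 2 * pi * (norm v * norm (x - y))"
proof -
  have "plane_wave v x - plane_wave v y = plane_wave v y * (plane_wave v (x - y) - 1)"
    by (simp add: algebra_simps flip: plane_wave_add_right)
  then have "cmod (plane_wave v x - plane_wave v y) = cmod (exp (\<i> * of_real (2 * pi * (v \<bullet> (x - y)))) - 1)"
    by (simp add: norm_mult) (simp add: plane_wave_def)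
  also have "\<dots> \<le> \<bar>2 * pi * (v \<bullet> (x - y))\<bar>" by (rule cmod_exp_i_minus_one_le)
  also have "\<dots> \<le> 2 * pi * (norm v * norm (x - y))"
    using Cauchy_Schwarz_ineq2[of v "x - y"] by (simp add: abs_mult)
  finally show ?thesis .
qed

text \<open>On an arc of the nodal set the sum over \<open>K\<close> equals minus the sum over \<open>\<Omega> - K\<close>, so that the mean square of
  the former is a sum of oscillatory integrals only.\<close>

lemma (in regular_curve) cluster_mean_square:
  fixes a :: "int^2 \<Rightarrow> complex"
  assumes fin: "finite \<Omega>" and K: "K \<subseteq> \<Omega>" and R: "0 < R"
    and zero: "\<And>t. t \<in> {0..l} \<Longrightarrow> (trig_sum a \<Omega> (\<gamma> t)) = 0"
    and sep: "\<And>\<xi> \<eta>. \<xi> \<in> K \<Longrightarrow> \<eta> \<in> \<Omega> - K \<Longrightarrow> R < norm (frequency_vec \<eta> - frequency_vec \<xi>)"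
    and A: "\<And>\<xi>. \<xi> \<in> \<Omega> \<Longrightarrow> cmod (a \<xi>) \<le> A"
  shows "integral {0..l} (\<lambda>t. (cmod (trig_sum a K (\<gamma> t)))\<^sup>2)
    \<le> (real (card \<Omega>))\<^sup>2 * A\<^sup>2 * (4 / R + 8 / sqrt (\<kappa> * R))"
proof -
  define B where "B = 4 / R + 8 / sqrt (\<kappa> * R)"
  define f where "f v t = plane_wave v (\<gamma> t)" for v t
  define PK where "PK t = (\<Sum>\<xi>\<in>K. a \<xi> * f (frequency_vec \<xi>) t)" for t
  have finK: "finite K" "finite (\<Omega> - K)" using fin K finite_subset by auto
  have cf: "continuous_on {0..l} (f v)" for v
    unfolding f_def by (rule continuous_on_plane_wave[OF continuous(1)])
  have B0: "B \<ge> 0" using R \<kappa>(1) by (simp add: B_def)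
  have eq: "of_real ((cmod (PK t))\<^sup>2) = - (\<Sum>\<eta>\<in>\<Omega> - K. \<Sum>\<xi>\<in>K. a \<eta> * cnj (a \<xi>) * f (frequency_vec \<eta> - frequency_vec \<xi>) t)"
    if t: "t \<in> {0..l}" for t
  proof -
    have "(\<Sum>\<xi>\<in>\<Omega>. a \<xi> * f (frequency_vec \<xi>) t) = (\<Sum>\<xi>\<in>\<Omega> - K. a \<xi> * f (frequency_vec \<xi>) t) + PK t"
      unfolding PK_def by (rule sum.subset_diff[OF K fin])
    moreover have "(\<Sum>\<xi>\<in>\<Omega>. a \<xi> * f (frequency_vec \<xi>) t) = 0" using zero[OF t] by (simp only: f_def)
    ultimately have PK: "PK t = - (\<Sum>\<eta>\<in>\<Omega> - K. a \<eta> * f (frequency_vec \<eta>) t)"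
      by (simp only: eq_neg_iff_add_eq_0 add.commute)
    have "cnj (PK t) = (\<Sum>\<xi>\<in>K. cnj (a \<xi>) * f (- frequency_vec \<xi>) t)"
      by (simp only: PK_def f_def cnj_sum complex_cnj_mult cnj_plane_wave)
    then have "PK t * cnj (PK t) = - ((\<Sum>\<eta>\<in>\<Omega> - K. a \<eta> * f (frequency_vec \<eta>) t) * (\<Sum>\<xi>\<in>K. cnj (a \<xi>) * f (- frequency_vec \<xi>) t))"
      using PK by simp
    also have "\<dots> = - (\<Sum>\<eta>\<in>\<Omega> - K. \<Sum>\<xi>\<in>K. a \<eta> * cnj (a \<xi>) * f (frequency_vec \<eta> - frequency_vec \<xi>) t)"
    proof -
      have "f (frequency_vec \<eta> - frequency_vec \<xi>) t = f (frequency_vec \<eta>) t * f (- frequency_vec \<xi>) t" for \<eta> \<xi> :: "int^2"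
        unfolding f_def plane_wave_add_left[symmetric] by simp
      then show ?thesis unfolding sum_product by (simp add: mult_ac)
    qed
    finally show ?thesis unfolding complex_norm_square .
  qed
  have iv: "(\<lambda>t. a \<eta> * cnj (a \<xi>) * f (frequency_vec \<eta> - frequency_vec \<xi>) t) integrable_on {0..l}" for \<eta> \<xi>
    by (intro integrable_continuous_real continuous_intros cf)
  have ib: "cmod (integral {0..l} (\<lambda>t. a \<eta> * cnj (a \<xi>) * f (frequency_vec \<eta> - frequency_vec \<xi>) t)) \<le> A\<^sup>2 * B"
    if \<eta>: "\<eta> \<in> \<Omega> - K" and \<xi>: "\<xi> \<in> K" for \<eta> \<xi>
  proof -
    define v where "v = frequency_vec \<eta> - frequency_vec \<xi>"
    have v: "R < norm v" using sep[OF \<xi> \<eta>] by (simp add: v_def)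
    have "cmod (integral {0..l} (f v)) \<le> 4 / norm v + 8 / sqrt (\<kappa> * norm v)"
      unfolding f_def plane_wave_def using v R by (intro oscillation) auto
    also have "\<dots> \<le> B" unfolding B_def
      using v R \<kappa>(1) by (intro add_mono divide_left_mono real_sqrt_le_mono mult_left_mono) (auto intro!: mult_pos_pos)
    finally have "cmod (integral {0..l} (f v)) \<le> B" .
    moreover have "cmod (a \<eta> * cnj (a \<xi>)) \<le> A\<^sup>2"
    proof -
      have "0 \<le> A" using A[of \<xi>] \<xi> K by (meson norm_ge_zero order_trans subsetD)
      then show ?thesis using A[of \<eta>] A[of \<xi>] \<eta> \<xi> K by (auto simp: norm_mult power2_eq_square intro!: mult_mono)
    qed
    ultimately show ?thesis
      by (simp add: norm_mult mult_mono flip: v_def)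
  qed
  have "complex_of_real (integral {0..l} (\<lambda>t. (cmod (PK t))\<^sup>2)) = integral {0..l} (\<lambda>t. of_real ((cmod (PK t))\<^sup>2))"
  proof -
    have "(\<lambda>t. (cmod (PK t))\<^sup>2) integrable_on {0..l}"
      unfolding PK_def by (intro integrable_continuous_real continuous_intros cf)
    from integral_linear[OF this bounded_linear_of_real[where 'a = complex]] show ?thesis by (simp add: o_def)
  qed
  also have "\<dots> = integral {0..l} (\<lambda>t. - (\<Sum>\<eta>\<in>\<Omega> - K. \<Sum>\<xi>\<in>K. a \<eta> * cnj (a \<xi>) * f (frequency_vec \<eta> - frequency_vec \<xi>) t))"
    using eq by (intro integral_cong) auto
  also have "\<dots> = - (\<Sum>\<eta>\<in>\<Omega> - K. \<Sum>\<xi>\<in>K. integral {0..l} (\<lambda>t. a \<eta> * cnj (a \<xi>) * f (frequency_vec \<eta> - frequency_vec \<xi>) t))"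
    using finK iv by (simp only: integral_neg integral_sum integrable_sum)
  finally have "cmod (complex_of_real (integral {0..l} (\<lambda>t. (cmod (PK t))\<^sup>2))) \<le> (\<Sum>\<eta>\<in>\<Omega> - K. \<Sum>\<xi>\<in>K. A\<^sup>2 * B)"
    by (simp only: norm_minus_cancel) (intro sum_norm_le ib)
  also have "\<dots> = real (card (\<Omega> - K)) * real (card K) * (A\<^sup>2 * B)" by simp
  also have "\<dots> \<le> real (card \<Omega>) * real (card \<Omega>) * (A\<^sup>2 * B)"
    using fin K B0 by (intro mult_right_mono mult_mono) (auto intro: card_mono)
  finally show ?thesis unfolding B_def PK_def f_def norm_of_real by (simp add: power2_eq_square abs_le_iff mult_ac)
qed

section \<open>Characters close to 1 on a box of integers\<close>

lemma half_le_sin: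
  assumes "0 \<le> x" "x \<le> pi / 2" shows "x / 2 \<le> sin x"
proof (cases "x \<le> pi / 3")
  case True
  show ?thesis
  proof (cases "x = 0")
    case False
    then have x: "0 < x" using assms by simp
    obtain y where y: "0 < y" "y < x" "sin x - sin 0 = (x - 0) * cos y"
      using MVT2[OF x, of sin cos] DERIV_sin by blast
    have "cos (pi / 3) \<le> cos y" using y True by (intro cos_monotone_0_pi_le) auto
    then have "x * (1 / 2) \<le> x * cos y" using x by (intro mult_left_mono) (auto simp: cos_60)
    then show ?thesis using y by simp
  qed simp
next
  case False
  have "sin (pi / 3) \<le> sin x" using False assms by (intro sin_monotone_2pi_le) auto
  moreover have "(16 / 10 :: real) \<le> sqrt 3" by (rule real_le_rsqrt) (simp add: power2_eq_square)
  ultimately show ?thesis using assms pi_less_4 pi_approx by (simp add: sin_60)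
qed

text \<open>If y is the signed distance from x to a nearest integer, the modulus is 2 |sin (pi y)|,
  which is at least pi |y|.\<close>

lemma dist_int_le_cmod_exp:
  assumes "cmod (exp (2 * pi * \<i> * of_real x) - 1) < \<tau>"
  shows "\<exists>n::int. \<bar>x - of_int n\<bar> < \<tau>"
proof -
  define n where "n = round x"
  define y where "y = x - of_int n"
  have y: "\<bar>y\<bar> \<le> 1 / 2" using of_int_round_abs_le[of x] by (simp add: y_def n_def abs_minus_commute)
  have arg: "2 * pi * \<i> * of_real x = \<i> * of_real (2 * pi * y) + complex_of_real (2 * of_int n * pi) * \<i>"
    by (simp add: y_def algebra_simps)
  have "exp (2 * pi * \<i> * of_real x) = exp (\<i> * of_real (2 * pi * y))"
    by (simp only: arg exp_add exp_integer_2pi[OF Ints_of_int] mult_1_right)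
  then have "cmod (exp (2 * pi * \<i> * of_real x) - 1) = 2 * \<bar>sin (pi * y)\<bar>"
    by (simp only: dist_exp_i_1) simp
  then have s: "2 * \<bar>sin (pi * y)\<bar> < \<tau>" using assms by simp
  have "pi * \<bar>y\<bar> / 2 \<le> sin (pi * \<bar>y\<bar>)" using y by (intro half_le_sin) auto
  also have "\<dots> \<le> \<bar>sin (pi * y)\<bar>" by (cases "y \<ge> 0") auto
  finally have "pi * \<bar>y\<bar> < \<tau>" using s by simp
  moreover have "1 * \<bar>y\<bar> \<le> pi * \<bar>y\<bar>" using pi_gt3 by (intro mult_right_mono) auto
  ultimately show ?thesis by (intro exI[of _ n]) (simp add: y_def)
qed

lemma card_int_interval_le:
  fixes B :: "int set"
  assumes r: "0 \<le> r" and B: "\<And>h. h \<in> B \<Longrightarrow> \<bar>of_int h - c\<bar> \<le> r"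
  shows "finite B \<and> real (card B) \<le> 2 * r + 1"
proof -
  have sub: "B \<subseteq> {\<lceil>c - r\<rceil>..\<lfloor>c + r\<rfloor>}"
    using B by (auto simp: ceiling_le_iff le_floor_iff abs_le_iff) (smt (verit))+
  then have "card B \<le> nat (\<lfloor>c + r\<rfloor> - \<lceil>c - r\<rceil> + 1)" using card_mono[OF _ sub] by simp
  moreover have "real_of_int (\<lfloor>c + r\<rfloor> - \<lceil>c - r\<rceil> + 1) \<le> 2 * r + 1" by linarith
  ultimately have "real (card B) \<le> 2 * r + 1" using r by linarith
  then show ?thesis using sub finite_subset by blast
qed

text \<open>Put D = |d|. At most 2 (D + 1) + 1 <= 5 D integers can be close to d h / M + c, and each
  of them confines h to an interval of length 2 \<tau> M / D. Counting integers adds 1 for each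
  interval, which is harmless because of D <= \<tau> M; hence the need for a lower threshold on
  \<tau>.\<close>

lemma character_concentration_1d:
  fixes d :: int and M :: nat and \<tau> c :: real
  assumes M: "M > 0" and d: "d \<noteq> 0" "real_of_int \<bar>d\<bar> \<le> \<tau> * M"
  shows "real (card {h \<in> {- int M..int M}. cmod (exp (2 * pi * \<i> * of_real (of_int (d * h) / M + c)) - 1) < \<tau>}) \<le> 15 * \<tau> * M"
proof -
  define G where "G = {h \<in> {- int M..int M}. cmod (exp (2 * pi * \<i> * of_real (of_int (d * h) / M + c)) - 1) < \<tau>}"
  define D where "D = real_of_int \<bar>d\<bar>"
  have D: "D \<ge> 1" "D \<le> \<tau> * M" using d by (auto simp: D_def)
  have \<tau>0: "\<tau> > 0" using D M by (smt (verit) mult_nonpos_nonneg of_nat_0_le_iff)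
  show ?thesis
  proof (cases "\<tau> \<le> 1")
    case False
    have "card G \<le> card {- int M..int M}" unfolding G_def by (intro card_mono) auto
    then have "real (card G) \<le> 3 * M" using M by simp
    also have "\<dots> \<le> 15 * \<tau> * M" using False M by simp
    finally show ?thesis by (simp only: G_def)
  next
    case True
    define Ns where "Ns = {n::int. \<bar>of_int n - c\<bar> \<le> D + 1}"
    define H where "H n = {h \<in> {- int M..int M}. \<bar>of_int (d * h) / M + c - of_int n\<bar> < \<tau>}" for n :: int
    have Ns: "finite Ns" "real (card Ns) \<le> 2 * (D + 1) + 1"
      using card_int_interval_le[of "D + 1" Ns c] D by (auto simp: Ns_def)
    have sub: "G \<subseteq> (\<Union>n\<in>Ns. H n)"
    proof
      fix h assume h: "h \<in> G"
      then obtain n :: int where n: "\<bar>of_int (d * h) / M + c - of_int n\<bar> < \<tau>"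
        using dist_int_le_cmod_exp unfolding G_def by blast
      have hM: "real_of_int \<bar>h\<bar> \<le> M" using h by (auto simp: G_def)
      have "\<bar>real_of_int (d * h) / M\<bar> = D * real_of_int \<bar>h\<bar> / M" using M by (simp add: D_def abs_mult)
      also have "\<dots> \<le> D * M / M" using hM D by (intro divide_right_mono mult_left_mono) auto
      finally have "\<bar>real_of_int (d * h) / M\<bar> \<le> D" using M by simp
      then have "\<bar>real_of_int n - c\<bar> \<le> D + 1" using n True by linarith
      then show "h \<in> (\<Union>n\<in>Ns. H n)" using h n by (auto simp: Ns_def H_def G_def)
    qed
    have Hn: "real (card (H n)) \<le> 2 * (\<tau> * M / D) + 1" for n
    proof -
      have "\<bar>of_int h - (of_int n - c) * M / of_int d\<bar> \<le> \<tau> * M / D" if h: "h \<in> H n" for h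
      proof -
        have "of_int h - (of_int n - c) * M / of_int d = (of_int (d * h) / M + c - of_int n) * (M / of_int d)"
          using M d by (simp add: field_simps)
        then have "\<bar>of_int h - (of_int n - c) * M / of_int d\<bar> = \<bar>of_int (d * h) / M + c - of_int n\<bar> * (M / D)"
          by (simp only: abs_mult abs_divide) (simp add: D_def)
        also have "\<dots> \<le> \<tau> * (M / D)" using h D by (intro mult_right_mono) (auto simp: H_def)
        finally show ?thesis by simp
      qed
      then show ?thesis using card_int_interval_le[of "\<tau> * M / D" "H n" "(of_int n - c) * M / of_int d"] D \<tau>0 by simp
    qed
    have finH: "finite (H n)" for n by (rule finite_subset[of _ "{- int M..int M}"]) (auto simp: H_def)
    have "card G \<le> card (\<Union>n\<in>Ns. H n)" using sub Ns finH by (intro card_mono) auto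
    also have "\<dots> \<le> (\<Sum>n\<in>Ns. card (H n))" by (rule card_UN_le[OF Ns(1)])
    finally have "real (card G) \<le> (\<Sum>n\<in>Ns. real (card (H n)))" by (metis of_nat_le_iff of_nat_sum)
    also have "\<dots> \<le> (\<Sum>n\<in>Ns. 2 * (\<tau> * M / D) + 1)" by (intro sum_mono Hn)
    also have "\<dots> = real (card Ns) * (2 * (\<tau> * M / D) + 1)" by simp
    also have "\<dots> \<le> (5 * D) * (2 * (\<tau> * M / D) + 1)"
      using Ns(2) D \<tau>0 by (intro mult_right_mono) auto
    also have "\<dots> = 10 * (\<tau> * M) + 5 * D" using D by (simp add: field_simps)
    also have "\<dots> \<le> 15 * \<tau> * M" using D by simp
    finally show ?thesis by (simp only: G_def)
  qed
qed

abbreviation resonant_shifts :: "int set \<Rightarrow> nat \<Rightarrow> int \<Rightarrow> int \<Rightarrow> real \<Rightarrow> (int \<times> int) set"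
  where "resonant_shifts B M d1 d2 \<tau> \<equiv>
    {h \<in> B \<times> B. cmod (exp (2 * pi * \<i> * of_real (of_int (d1 * fst h + d2 * snd h) / real M)) - 1) < \<tau>}"

text \<open>Fibre by fibre: for a fixed second coordinate y the term d2 y / M is the phase c of the
  one-dimensional count. If d1 = 0, the coordinates are swapped.\<close>

lemma character_concentration_2d:
  fixes d1 d2 :: int and M :: nat and \<tau> :: real
  assumes M: "M > 0" and d: "d1 \<noteq> 0 \<or> d2 \<noteq> 0" "real_of_int \<bar>d1\<bar> \<le> \<tau> * M" "real_of_int \<bar>d2\<bar> \<le> \<tau> * M"
  defines "B \<equiv> {- int M..int M}"
  shows "real (card (resonant_shifts B M d1 d2 \<tau>))
    \<le> 8 * \<tau> * real (card (B \<times> B))"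
proof -
  have *: "real (card (resonant_shifts B M d1 d2 \<tau>))
    \<le> 8 * \<tau> * real (card (B \<times> B))"
    if d: "d1 \<noteq> 0" "real_of_int \<bar>d1\<bar> \<le> \<tau> * M" for d1 d2 :: int
  proof -
    define G where "G y = {x \<in> B. cmod (exp (2 * pi * \<i> * of_real (of_int (d1 * x) / M + of_int (d2 * y) / M)) - 1) < \<tau>}" for y
    have finB: "finite B" by (simp add: B_def)
    have "0 < \<tau> * M" using d by linarith
    then have \<tau>: "0 < \<tau>" using M by (simp add: zero_less_mult_iff)
    have "bij_betw (\<lambda>(y, x). (x, y)) (SIGMA y:B. G y) (resonant_shifts B M d1 d2 \<tau>)"
      by (rule bij_betwI[where g = "\<lambda>(x, y). (y, x)"]) (auto simp: G_def add_divide_distrib)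
    then have "real (card (resonant_shifts B M d1 d2 \<tau>))
       = real (card (SIGMA y:B. G y))" by (simp add: bij_betw_same_card)
    also have "\<dots> = (\<Sum>y\<in>B. real (card (G y)))" using finB by (simp add: G_def)
    also have "\<dots> \<le> (\<Sum>y\<in>B. 15 * \<tau> * M)"
      unfolding G_def B_def by (intro sum_mono character_concentration_1d[OF M d])
    also have "\<dots> = real (card B) * (15 * \<tau> * M)" by simp
    also have "\<dots> \<le> real (card B) * (8 * \<tau> * real (card B))"
    proof (intro mult_left_mono)
      have "15 * \<tau> * M \<le> 8 * \<tau> * (2 * M + 1)" using \<tau> by (simp add: algebra_simps)
      then show "15 * \<tau> * M \<le> 8 * \<tau> * real (card B)" by (simp add: B_def algebra_simps)
    qed simp
    also have "\<dots> = 8 * \<tau> * real (card (B \<times> B))" by (simp add: card_cartesian_product)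
    finally show ?thesis .
  qed
  show ?thesis
  proof (cases "d1 = 0")
    case False
    then show ?thesis using *[of d1 d2] d by simp
  next
    case True
    have "bij_betw prod.swap (resonant_shifts B M d1 d2 \<tau>)
       (resonant_shifts B M d2 d1 \<tau>)"
      by (rule bij_betwI[where g = prod.swap]) (auto simp: add.commute)
    then show ?thesis using *[of d2 d1] d True by (simp add: bij_betw_same_card)
  qed
qed

section \<open>Clusters of frequencies and bad squares\<close>

lemma norm_frequencies: "\<xi> \<in> frequencies (lam\<^sup>2) \<Longrightarrow> 0 \<le> lam \<Longrightarrow> norm (frequency_vec \<xi>) = lam"
  by (simp add: frequencies_def power2_eq_iff_nonneg)

lemma cmod_frequency_diff:
  "cmod (Complex (of_int (\<xi> $ 1)) (of_int (\<xi> $ 2)) - Complex (of_int (\<eta> $ 1)) (of_int (\<eta> $ 2)))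
     = norm (frequency_vec \<xi> - frequency_vec \<eta>)"
  by (simp add: frequency_vec_def cmod_def norm_vec_def L2_set_def sum_2)

text \<open>Balls of radius \<open>j R\<close> around \<open>\<xi>\<^sub>0\<close> cannot all gain a point as \<open>j\<close> increases.\<close>

lemma separated_cluster_exists:
  assumes lam: "0 < lam" and L: "0 < L" and R: "0 < R"
    and sm: "2 * (real (2 * L + 1) * R) < lam powr (real L / real (2 * L + 1))"
    and \<xi>0: "\<xi>0 \<in> frequencies (lam\<^sup>2)"
  shows "\<exists>K\<subseteq>frequencies (lam\<^sup>2). \<xi>0 \<in> K \<and> card K \<le> 2 * L \<and>
    (\<forall>\<xi>\<in>K. norm (frequency_vec \<xi> - frequency_vec \<xi>0) \<le> real (2 * L + 1) * R) \<and>
    (\<forall>\<xi>\<in>K. \<forall>\<eta>\<in>frequencies (lam\<^sup>2) - K. R < norm (frequency_vec \<eta> - frequency_vec \<xi>))"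
proof -
  define \<Omega> where "\<Omega> = frequencies (lam\<^sup>2)"
  define B where "B j = {\<xi>\<in>\<Omega>. norm (frequency_vec \<xi> - frequency_vec \<xi>0) \<le> real j * R}" for j
  have fin: "finite \<Omega>" unfolding \<Omega>_def by (rule finite_frequencies)
  have finB: "finite (B j)" for j using fin by (simp add: B_def)
  have B0: "\<xi>0 \<in> B j" for j using \<xi>0 R by (simp add: B_def \<Omega>_def)
  have monoB: "B i \<subseteq> B j" if "i \<le> j" for i j
  proof -
    have "real i * R \<le> real j * R" using that R by (intro mult_right_mono) auto
    then show ?thesis by (auto simp: B_def)
  qed
  have top: "card (B (2 * L + 1)) \<le> 2 * L"
  proof (rule ccontr)
    assume "\<not> ?thesis"
    then have c: "2 * L + 1 \<le> card (B (2 * L + 1))" by simp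
    define \<iota> where "\<iota> = (\<lambda>\<xi>::int^2. Complex (of_int (\<xi> $ 1)) (of_int (\<xi> $ 2)))"
    have bij: "bij_betw \<iota> \<Omega> (lattice_circle (lam\<^sup>2))" unfolding \<iota>_def \<Omega>_def by (rule lattice_circle_bij)
    have sub: "B (2 * L + 1) \<subseteq> \<Omega>" by (auto simp: B_def)
    have "card (\<iota> ` B (2 * L + 1)) = card (B (2 * L + 1))"
      using bij sub by (intro card_image) (auto simp: bij_betw_def intro: inj_on_subset)
    moreover have "\<iota> ` B (2 * L + 1) \<subseteq> lattice_circle (lam\<^sup>2)" using bij sub by (auto simp: bij_betw_def)
    moreover have "cmod (z - w) \<le> 2 * (real (2 * L + 1) * R)"
      if zw: "z \<in> \<iota> ` B (2 * L + 1)" "w \<in> \<iota> ` B (2 * L + 1)" for z w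
    proof -
      obtain \<xi> \<eta> where x: "\<xi> \<in> B (2 * L + 1)" "z = \<iota> \<xi>" "\<eta> \<in> B (2 * L + 1)" "w = \<iota> \<eta>" using zw by blast
      have "cmod (z - w) = norm ((frequency_vec \<xi> - frequency_vec \<xi>0) - (frequency_vec \<eta> - frequency_vec \<xi>0))"
        using x by (simp add: \<iota>_def cmod_frequency_diff)
      also have "\<dots> \<le> norm (frequency_vec \<xi> - frequency_vec \<xi>0) + norm (frequency_vec \<eta> - frequency_vec \<xi>0)"
        by (rule norm_triangle_ineq4)
      also have "\<dots> \<le> real (2 * L + 1) * R + real (2 * L + 1) * R"
        using x(1,3) unfolding B_def by (intro add_mono) blast+
      finally show ?thesis by (simp only: mult_2)
    qed
    ultimately have "lam powr (real L / real (2 * L + 1)) \<le> 2 * (real (2 * L + 1) * R)"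
      using lattice_points_spread[OF L lam, of "\<iota> ` B (2 * L + 1)"] c by simp
    then show False using sm by simp
  qed
  \<comment> \<open>If all 2 L + 1 inclusions were strict, the largest ball would contain at least 2
    L + 2 points.\<close>
  have "\<exists>j\<le>2 * L. B j = B (Suc j)"
  proof (rule ccontr)
    assume no: "\<not> ?thesis"
    have "j + 1 \<le> card (B j)" if "j \<le> 2 * L + 1" for j
      using that
    proof (induction j)
      case 0
      have "card (B 0) \<noteq> 0" using B0 finB by (metis card_0_eq empty_iff)
      then show ?case by simp
    next
      case (Suc j)
      have "B j \<subset> B (Suc j)" using no Suc.prems monoB[of j "Suc j"] by auto
      then have "card (B j) < card (B (Suc j))" using finB psubset_card_mono by blast
      then show ?case using Suc by simp
    qed
    from this[of "2 * L + 1"] show False using top by simp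
  qed
  then obtain j where j: "j \<le> 2 * L" "B j = B (Suc j)" by blast
  show ?thesis
  proof (rule exI[of _ "B j"], intro conjI ballI)
    show "B j \<subseteq> frequencies (lam\<^sup>2)" by (auto simp: B_def \<Omega>_def)
    show "\<xi>0 \<in> B j" by (rule B0)
    have sub: "B j \<subseteq> B (2 * L + 1)" using j by (intro monoB) simp
    then show "card (B j) \<le> 2 * L" using top card_mono[OF finB sub] by simp
    show "norm (frequency_vec \<xi> - frequency_vec \<xi>0) \<le> real (2 * L + 1) * R" if "\<xi> \<in> B j" for \<xi>
      using that sub unfolding B_def by blast
    \<comment> \<open>The shell between the radii j R and (j + 1) R contains no frequency, so the
      triangle inequality separates the ball from the rest by R.\<close>
    fix \<xi> \<eta> assume \<xi>: "\<xi> \<in> B j" and \<eta>: "\<eta> \<in> frequencies (lam\<^sup>2) - B j"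
    have "\<eta> \<notin> B (Suc j)" "\<eta> \<in> \<Omega>" using \<eta> j by (auto simp: \<Omega>_def)
    then have "real (Suc j) * R < norm (frequency_vec \<eta> - frequency_vec \<xi>0)" by (auto simp: B_def)
    moreover have "norm (frequency_vec \<xi> - frequency_vec \<xi>0) \<le> real j * R" using \<xi> by (simp add: B_def)
    moreover have "norm (frequency_vec \<eta> - frequency_vec \<xi>0) \<le> norm (frequency_vec \<eta> - frequency_vec \<xi>) + norm (frequency_vec \<xi> - frequency_vec \<xi>0)"
      using norm_triangle_ineq[of "frequency_vec \<eta> - frequency_vec \<xi>" "frequency_vec \<xi> - frequency_vec \<xi>0"] by simp
    ultimately show "R < norm (frequency_vec \<eta> - frequency_vec \<xi>)" by (simp add: algebra_simps)
  qed
qed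

lemma torus_proj_surj: "\<exists>y. torus_proj y = x"
  by transfer (metis Ints_0 diff_self)

text \<open>On a line parallel to an axis the eigenfunction is a real exponential sum: it vanishes
  identically, or its zeros in the segment are fewer than the frequencies. Every line of the first
  kind produces a zero on the perpendicular line through a point where \<phi> is nonzero, and there
  zeros are few as well.\<close>

lemma nodal_points_on_lines:
  fixes a :: "int^2 \<Rightarrow> complex"
  assumes lam: "0 \<le> lam" and \<phi>: "\<And>x. of_real (\<phi> x) = (\<Sum>\<xi>\<in>frequencies (lam\<^sup>2). a \<xi> * torus_char \<xi> x)"
    and nz: "\<phi> x0 \<noteq> 0" and h: "0 < h" and small: "(1 + 2 * pi * lam * h) ^ card (frequencies (lam\<^sup>2)) < 2"
  shows "\<exists>X. finite X \<and> (\<forall>x\<in>{p $ i..p $ i + h} - X.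
        finite (chord (nodal_set \<phi>) p h i x) \<and>
        card (chord (nodal_set \<phi>) p h i x) \<le> card (frequencies (lam\<^sup>2)))"
proof -
  define \<Omega> where "\<Omega> = frequencies (lam\<^sup>2)"
  have fin: "finite \<Omega>" unfolding \<Omega>_def by (rule finite_frequencies)
  define j :: 2 where "j = (if i = 1 then 2 else 1)"
  have j: "j \<noteq> i" "k = i \<or> k = j" for k
    using exhaust_2[of i] exhaust_2[of k] by (auto simp: j_def)
  define pt where "pt x y = (\<chi> k. if k = i then x else y)" for x y :: real
  have pti: "pt x y $ i = x" "pt x y $ j = y" for x y using j(1) by (auto simp: pt_def)
  have ptq: "q = pt (q $ i) (q $ j)" for q
  proof -
    have "q $ k = pt (q $ i) (q $ j) $ k" for k using j(1) j(2)[of k] by (auto simp: pt_def)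
    then show ?thesis unfolding Finite_Cartesian_Product.vec_eq_iff by blast
  qed
  have inner: "v \<bullet> pt x y = v $ i * x + v $ j * y" for v x y
  proof -
    have "(UNIV :: 2 set) = {i, j}" using j(2) by blast
    then have "v \<bullet> pt x y = (\<Sum>k\<in>{i, j}. v $ k * pt x y $ k)" by (simp add: inner_vec_def)
    then show ?thesis using j(1) by (simp add: pti)
  qed
  define \<Phi> where "\<Phi> x = trig_sum a \<Omega> x" for x
  have \<Phi>: "\<Phi> x = of_real (\<phi> (torus_proj x))" for x
    by (simp add: \<Phi>_def \<phi> torus_char_proj \<Omega>_def)
  obtain y0 where y0: "torus_proj y0 = x0" using torus_proj_surj by blast
  define X0 Y0 where "X0 = y0 $ i" and "Y0 = y0 $ j"
  have nz0: "\<Phi> (pt X0 Y0) \<noteq> 0" using nz y0 ptq[of y0] by (simp add: \<Phi> X0_def Y0_def)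
  have pw: "plane_wave v (pt x y) = exp (\<i> * of_real (2 * pi * (v $ i * x))) * exp (\<i> * of_real (2 * pi * (v $ j * y)))" for v x y
    by (simp add: plane_wave_def inner algebra_simps flip: exp_add)
  have bound: "\<bar>2 * pi * (frequency_vec \<xi> $ k)\<bar> \<le> 2 * pi * lam" if "\<xi> \<in> \<Omega>" for \<xi> k
    using component_le_norm_cart[of "frequency_vec \<xi>" k] norm_frequencies[OF that[unfolded \<Omega>_def] lam]
    by (simp add: abs_mult)
  define F where "F t = (\<Sum>\<xi>\<in>\<Omega>. (a \<xi> * exp (\<i> * of_real (2 * pi * (frequency_vec \<xi> $ j * Y0)))) * exp (\<i> * of_real (2 * pi * (frequency_vec \<xi> $ i) * t)))" for t
  have F: "F t = \<Phi> (pt t Y0)" for t by (simp add: F_def \<Phi>_def pw mult_ac)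
  define G where "G x t = (\<Sum>\<xi>\<in>\<Omega>. (a \<xi> * exp (\<i> * of_real (2 * pi * (frequency_vec \<xi> $ i * x)))) * exp (\<i> * of_real (2 * pi * (frequency_vec \<xi> $ j) * t)))" for x t
  have G: "G x t = \<Phi> (pt x t)" for x t by (simp add: G_def \<Phi>_def pw mult_ac)
  have L0: "0 \<le> 2 * pi * lam" using lam by simp
  \<comment> \<open>Excludes the lines with a zero at height Y0; each remaining one carries a
    nonzero value, as the zero count requires.\<close>
  define X where "X = {t\<in>{p $ i..p $ i + h}. F t = 0}"
  have "finite X"
  proof -
    have "finite {t\<in>{p $ i..p $ i + h}. F t = 0} \<and> card {t\<in>{p $ i..p $ i + h}. F t = 0} < card \<Omega>"
      unfolding F_def
      by (rule real_exponential_sum_zeros[OF fin bound L0 h])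
         (use F[unfolded F_def] \<Phi> small nz0 in \<open>auto simp: \<Omega>_def\<close>)
    then show ?thesis by (simp add: X_def)
  qed
  moreover have "finite (chord (nodal_set \<phi>) p h i x) \<and>
        card (chord (nodal_set \<phi>) p h i x) \<le> card \<Omega>" if x: "x \<in> {p $ i..p $ i + h} - X" for x
  proof -
    define Y where "Y = {t\<in>{p $ j..p $ j + h}. G x t = 0}"
    have "\<Phi> (pt x Y0) \<noteq> 0" using x by (auto simp: X_def F)
    then have "finite {t\<in>{p $ j..p $ j + h}. G x t = 0} \<and> card {t\<in>{p $ j..p $ j + h}. G x t = 0} < card \<Omega>"
      unfolding G_def
      by (intro real_exponential_sum_zeros[OF fin bound L0 h, where ?t0.0 = Y0])
         (use G[unfolded G_def] \<Phi> small in \<open>auto simp: \<Omega>_def\<close>)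
    then have Y: "finite Y" "card Y \<le> card \<Omega>" by (auto simp: Y_def)
    have sub: "chord (nodal_set \<phi>) p h i x \<subseteq> pt x ` Y"
    proof
      fix q assume q: "q \<in> chord (nodal_set \<phi>) p h i x"
      then have "q = pt x (q $ j)" using ptq[of q] by simp
      moreover have "\<Phi> q = 0" using q by (simp add: \<Phi> nodal_set_def)
      ultimately show "q \<in> pt x ` Y" using q by (intro image_eqI[of _ _ "q $ j"]) (auto simp: Y_def G square_def)
    qed
    have "card (chord (nodal_set \<phi>) p h i x) \<le> card (pt x ` Y)"
      using sub Y by (intro card_mono) auto
    also have "\<dots> \<le> card \<Omega>" using card_image_le[OF Y(1), of "pt x"] Y(2) by simp
    finally show ?thesis using sub Y finite_subset by blast
  qed
  ultimately show ?thesis unfolding \<Omega>_def by blast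
qed

section \<open>Grid squares on which the cluster sum is small\<close>

definition grid :: "nat \<Rightarrow> int \<times> int \<Rightarrow> real^2"
  where "grid M c = vector [of_int (fst c) / M, of_int (snd c) / M]"

lemma grid_cover:
  assumes M: "0 < M"
  shows "\<exists>c\<in>{0..<int M} \<times> {0..<int M}. \<exists>z\<in>int_vecs. x - z \<in> square (grid M c) (1 / M)"
proof -
  define z :: "real^2" where "z = (\<chi> i. of_int \<lfloor>x $ i\<rfloor>)"
  define k where "k i = \<lfloor>frac (x $ i) * M\<rfloor>" for i
  have k: "0 \<le> k i" "k i < int M" for i
  proof -
    show "0 \<le> k i" by (simp add: k_def)
    have "frac (x $ i) * real M < 1 * real M" using M frac_lt_1 by (intro mult_strict_right_mono) auto
    then show "k i < int M" by (simp add: k_def floor_less_iff)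
  qed
  have kx: "of_int (k i) / M \<le> (x - z) $ i" "(x - z) $ i \<le> of_int (k i) / M + 1 / M" for i
  proof -
    have "of_int (k i) \<le> frac (x $ i) * M" "frac (x $ i) * M \<le> of_int (k i) + 1"
      unfolding k_def by linarith+
    then show "of_int (k i) / M \<le> (x - z) $ i" "(x - z) $ i \<le> of_int (k i) / M + 1 / M"
      using M by (simp_all add: z_def frac_def field_simps)
  qed
  have "x - z \<in> square (grid M (k 1, k 2)) (1 / M)"
    using kx[of 1] kx[of 2] by (simp add: square_def grid_def forall_2)
  moreover have "z \<in> int_vecs" by (simp add: z_def int_vecs_def)
  moreover have "(k 1, k 2) \<in> {0..<int M} \<times> {0..<int M}" using k by simp
  ultimately show ?thesis by blast
qed

text \<open>Applies the lower bound for character sums to the group of grid indices, with H the box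
  that contains all differences and concentration constant A = 8, whence 64 = 8 * 8. The threshold D
  / M is what the concentration estimate asks of \<tau> for frequency differences up to D.\<close>

lemma sparse_small_values:
  fixes a :: "int^2 \<Rightarrow> complex" and \<rho> D b :: real
  assumes M: "0 < M" and K: "finite K" "card K \<le> Suc m"
    and D: "\<And>\<xi> \<eta>. \<xi> \<in> K \<Longrightarrow> \<eta> \<in> K \<Longrightarrow> norm (frequency_vec \<xi> - frequency_vec \<eta>) \<le> D"
    and DM: "D / M \<le> (\<rho> / 64) ^ (4 ^ m)"
    and \<rho>: "0 < \<rho>" "\<rho> \<le> 1" and b: "0 \<le> b" "\<exists>\<xi>\<in>K. b \<le> cmod (a \<xi>)"
    and E: "E \<subseteq> {0..<int M} \<times> {0..<int M}"
      "\<And>c. c \<in> E \<Longrightarrow> cmod (trig_sum a K (grid M c)) < (\<rho> / 64) ^ (4 ^ m) * b"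
  shows "real (card E) \<le> \<rho> * (real (2 * M + 1))\<^sup>2"
proof (rule ccontr)
  assume "\<not> ?thesis"
  then have big: "\<rho> * (real (2 * M + 1))\<^sup>2 < card E" by simp
  define H where "H = {- int M..int M} \<times> {- int M..int M}"
  have cH: "real (card H) = (real (2 * M + 1))\<^sup>2"
    by (simp add: H_def card_cartesian_product power2_eq_square add.commute)
  have finE: "finite E" using E(1) by (rule finite_subset) auto
  have "0 \<le> \<rho> * (real (2 * M + 1))\<^sup>2" using \<rho> by simp
  then have "0 < real (card E)" using big by linarith
  then have Ene: "E \<noteq> {}" by auto
  define chi where "chi \<xi> c = plane_wave (frequency_vec \<xi>) (grid M c)" for \<xi> c
  have grid_add: "grid M (c + d) = grid M c + grid M d" for c d
    unfolding Finite_Cartesian_Product.vec_eq_iff forall_2 by (simp add: grid_def add_divide_distrib)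
  have inner_grid: "v \<bullet> grid M c = (v $ 1 * of_int (fst c) + v $ 2 * of_int (snd c)) / M" for v c
    by (simp add: grid_def inner_vec_def sum_2 add_divide_distrib)
  have "\<exists>c\<in>E. (\<rho> / (8 * 8)) ^ (4 ^ m) * b \<le> cmod (\<Sum>\<xi>\<in>K. a \<xi> * chi \<xi> c)"
  proof (rule character_sum_lower_bound[where H = H and ?\<tau>0.0 = "D / M"])
    show "finite H" by (simp add: H_def)
    show "chi \<xi> (c + d) = chi \<xi> c * chi \<xi> d" for \<xi> c d
      by (simp add: chi_def grid_add plane_wave_add_right)
    show "cmod (chi \<xi> c) = 1" for \<xi> c by (simp add: chi_def)
    show "y - x \<in> H" if "x \<in> E" "y \<in> E" for x y
    proof -
      have "x \<in> {0..<int M} \<times> {0..<int M}" "y \<in> {0..<int M} \<times> {0..<int M}" using E(1) that by blast+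
      then show ?thesis by (cases x, cases y) (auto simp: H_def)
    qed
    show "\<rho> * real (card H) \<le> real (card E)" using big cH by simp
    show "D / real M \<le> (\<rho> / (8 * 8)) ^ 4 ^ m" using DM by simp
    fix \<xi> \<eta> :: "int^2" and \<tau> :: real
    assume K': "\<xi> \<in> K" "\<eta> \<in> K" "\<xi> \<noteq> \<eta>" and \<tau>: "D / M \<le> \<tau>"
    have D\<tau>: "D \<le> \<tau> * M" using \<tau> M by (simp add: pos_divide_le_eq)
    have comp: "real_of_int \<bar>\<xi> $ i - \<eta> $ i\<bar> \<le> \<tau> * M" for i
      using component_le_norm_cart[of "frequency_vec \<xi> - frequency_vec \<eta>" i] D[OF K'(1,2)] D\<tau>
      by (simp add: frequency_vec_def)
    have ne: "\<xi> $ 1 - \<eta> $ 1 \<noteq> 0 \<or> \<xi> $ 2 - \<eta> $ 2 \<noteq> 0" using K'(3) by (simp add: Finite_Cartesian_Product.vec_eq_iff forall_2)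
    have eq: "cmod (chi \<xi> h - chi \<eta> h) = cmod (exp (2 * pi * \<i> * of_real (of_int ((\<xi> $ 1 - \<eta> $ 1) * fst h + (\<xi> $ 2 - \<eta> $ 2) * snd h) / M)) - 1)" for h
    proof -
      define v where "v = frequency_vec \<xi> - frequency_vec \<eta>"
      have "chi \<xi> h = chi \<eta> h * plane_wave v (grid M h)"
        unfolding chi_def plane_wave_add_left[symmetric] by (simp add: v_def)
      then have "chi \<xi> h - chi \<eta> h = chi \<eta> h * (plane_wave v (grid M h) - 1)" by (simp add: algebra_simps)
      then have "cmod (chi \<xi> h - chi \<eta> h) = cmod (plane_wave v (grid M h) - 1)"
        by (simp add: norm_mult chi_def)
      also have "plane_wave v (grid M h) = exp (2 * pi * \<i> * of_real (of_int ((\<xi> $ 1 - \<eta> $ 1) * fst h + (\<xi> $ 2 - \<eta> $ 2) * snd h) / M))"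
        unfolding plane_wave_def inner_grid by (simp add: v_def frequency_vec_def mult_ac)
      finally show ?thesis .
    qed
    show "real (card {h \<in> H. cmod (chi \<xi> h - chi \<eta> h) < \<tau>}) \<le> 8 * \<tau> * real (card H)"
      unfolding eq H_def by (rule character_concentration_2d[OF M ne comp comp])
  qed (use K \<rho> b finE Ene in auto)
  then obtain c where c: "c \<in> E" "(\<rho> / 64) ^ (4 ^ m) * b \<le> cmod (\<Sum>\<xi>\<in>K. a \<xi> * chi \<xi> c)" by auto
  then show False using E(2)[OF c(1)] by (simp add: chi_def)
qed

lemma (in regular_curve) compact_hits:
  assumes h: "0 \<le> h" "h < 1 / 2"
  shows "compact (hits \<gamma> (square p h) {0..l})"
proof -
  have "hits \<gamma> (square p h) {0..l} = hits \<gamma> (square p h) {0..l / 2} \<union> hits \<gamma> (square p h) {l / 2..l}"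
    using l by (auto simp: hits_def)
  moreover have "compact (hits \<gamma> (square p h) {0..l / 2})"
    using hits_half_arc_measure[of 0 "l / 2" h p] l h by auto
  moreover have "compact (hits \<gamma> (square p h) {l / 2..l})"
    using hits_half_arc_measure[of "l / 2" l h p] l h by auto
  ultimately show ?thesis by (simp add: compact_Un)
qed

lemma plane_wave_diff_int:
  assumes "z \<in> int_vecs" shows "plane_wave (frequency_vec \<xi>) (x - z) = plane_wave (frequency_vec \<xi>) x"
  using torus_proj_diff_int[OF assms] by (simp flip: torus_char_proj)

text \<open>Factoring out the plane wave with frequency v leaves the modulus unchanged and only
  frequencies of size at most D. For a cluster around v the modulus thus varies on the scale 1 / D
  instead of the wavelength.\<close>

lemma cluster_sum_variation:
  fixes a :: "int^2 \<Rightarrow> complex"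
  assumes K: "finite K" "card K \<le> m" and D: "\<And>\<xi>. \<xi> \<in> K \<Longrightarrow> norm (frequency_vec \<xi> - v) \<le> D"
    and a: "\<And>\<xi>. \<xi> \<in> K \<Longrightarrow> cmod (a \<xi>) \<le> A" and xy: "norm (x - y) \<le> r" and nn: "0 \<le> A" "0 \<le> D"
  shows "cmod (trig_sum a K y) - cmod (trig_sum a K x)
    \<le> real m * (A * (2 * pi * (D * r)))"
proof -
  define P where "P x = (\<Sum>\<xi>\<in>K. a \<xi> * plane_wave (frequency_vec \<xi> - v) x)" for x
  have r: "0 \<le> r" using xy norm_ge_zero order_trans by blast
  have mod: "cmod (trig_sum a K x) = cmod (P x)" for x
  proof -
    have "plane_wave (frequency_vec \<xi>) x = plane_wave v x * plane_wave (frequency_vec \<xi> - v) x" for \<xi>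
      unfolding plane_wave_add_left[symmetric] by simp
    then have "trig_sum a K x = plane_wave v x * P x"
      by (simp add: P_def sum_distrib_left mult_ac)
    then show ?thesis by (simp add: norm_mult)
  qed
  have "P y - P x = (\<Sum>\<xi>\<in>K. a \<xi> * (plane_wave (frequency_vec \<xi> - v) y - plane_wave (frequency_vec \<xi> - v) x))"
    by (simp add: P_def sum_subtractf right_diff_distrib)
  then have "cmod (P y - P x) \<le> (\<Sum>\<xi>\<in>K. A * (2 * pi * (D * r)))"
  proof (simp only:, intro sum_norm_le)
    fix \<xi> assume \<xi>: "\<xi> \<in> K"
    have "cmod (plane_wave (frequency_vec \<xi> - v) y - plane_wave (frequency_vec \<xi> - v) x)
        \<le> 2 * pi * (norm (frequency_vec \<xi> - v) * norm (y - x))" by (rule plane_wave_lipschitz)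
    also have "\<dots> \<le> 2 * pi * (D * r)"
      using D[OF \<xi>] xy nn by (intro mult_left_mono mult_mono) (auto simp: norm_minus_commute)
    finally show "cmod (a \<xi> * (plane_wave (frequency_vec \<xi> - v) y - plane_wave (frequency_vec \<xi> - v) x)) \<le> A * (2 * pi * (D * r))"
      unfolding norm_mult using a[OF \<xi>] nn by (intro mult_mono) auto
  qed
  also have "\<dots> = real (card K) * (A * (2 * pi * (D * r)))" by simp
  also have "\<dots> \<le> real m * (A * (2 * pi * (D * r)))"
    using K(2) nn r by (intro mult_right_mono) auto
  finally show ?thesis unfolding mod using norm_triangle_ineq2[of "P y" "P x"] by linarith
qed

lemma square_norm_le:
  assumes "x \<in> square p h" shows "norm (x - p) \<le> 2 * h"
proof -
  have "norm (x - p) \<le> (\<Sum>i\<in>UNIV. \<bar>(x - p) $ i\<bar>)" by (rule norm_le_l1_cart)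
  also have "\<dots> \<le> (\<Sum>i\<in>(UNIV :: 2 set). h)"
    using assms by (intro sum_mono) (auto simp: square_def abs_le_iff algebra_simps)
  finally show ?thesis by simp
qed

text \<open>Chebyshev's inequality: the parameters at which the sum is at least s have measure at
  most l / 2, and all others fall into squares of E.\<close>

lemma (in regular_curve) length_le_bad_squares:
  fixes a :: "int^2 \<Rightarrow> complex"
  assumes M: "2 < M" and s: "0 < s" and K: "finite K"
    and E: "E \<subseteq> {0..<int M} \<times> {0..<int M}"
    and large: "\<And>c x. c \<in> {0..<int M} \<times> {0..<int M} - E \<Longrightarrow> x \<in> square (grid M c) (1 / M) \<Longrightarrow>
        s \<le> cmod (trig_sum a K x)"
    and mean: "integral {0..l} (\<lambda>t. (cmod (trig_sum a K (\<gamma> t)))\<^sup>2) \<le> s\<^sup>2 * (l / 2)"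
  shows "l \<le> 2 * (\<Sum>c\<in>E. measure lebesgue (hits \<gamma> (square (grid M c) (1 / M)) {0..l}))"
proof -
  define P where "P x = trig_sum a K x" for x
  define Hc where "Hc c = hits \<gamma> (square (grid M c) (1 / M)) {0..l}" for c
  have finE: "finite E" using E by (rule finite_subset) auto
  have h: "0 \<le> 1 / real M" "1 / real M < 1 / 2" using M by auto
  have cH: "Hc c \<in> lmeasurable" for c unfolding Hc_def by (intro lmeasurable_compact compact_hits h)
  have cP: "continuous_on {0..l} (\<lambda>t. cmod (P (\<gamma> t)))"
    unfolding P_def by (intro continuous_intros continuous_on_plane_wave continuous)
  define W where "W = {t\<in>{0..l}. s \<le> cmod (P (\<gamma> t))}"
  have "closed ({0..l} \<inter> (\<lambda>t. cmod (P (\<gamma> t))) -` {s..})"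
    using cP by (intro continuous_closed_preimage) auto
  moreover have "{0..l} \<inter> (\<lambda>t. cmod (P (\<gamma> t))) -` {s..} = W" by (auto simp: W_def)
  ultimately have "compact ({0..l} \<inter> W)" by (intro compact_Int_closed) auto
  moreover have "{0..l} \<inter> W = W" by (auto simp: W_def)
  ultimately have mW: "W \<in> lmeasurable" by (simp add: lmeasurable_compact)
  have cover: "{0..l} \<subseteq> W \<union> (\<Union>c\<in>E. Hc c)"
  proof
    fix t assume t: "t \<in> {0..l}"
    obtain c z where cz: "c \<in> {0..<int M} \<times> {0..<int M}" "z \<in> int_vecs" "\<gamma> t - z \<in> square (grid M c) (1 / M)"
      using grid_cover[of M "\<gamma> t"] M by auto
    show "t \<in> W \<union> (\<Union>c\<in>E. Hc c)"
    proof (cases "c \<in> E")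
      case True
      then show ?thesis using t cz by (auto simp: Hc_def hits_def)
    next
      case False
      then have "s \<le> cmod (P (\<gamma> t - z))" using large[of c "\<gamma> t - z"] cz by (simp add: P_def)
      also have "P (\<gamma> t - z) = P (\<gamma> t)" using cz by (simp add: P_def plane_wave_diff_int)
      finally show ?thesis using t by (simp add: W_def)
    qed
  qed
  have cP2: "continuous_on {0..l} (\<lambda>t. (cmod (P (\<gamma> t)))\<^sup>2)" by (rule continuous_on_power[OF cP])
  then have "(\<lambda>t. (cmod (P (\<gamma> t)))\<^sup>2) absolutely_integrable_on {0..l}"
    by (rule absolutely_integrable_continuous_real)
  then have "(\<lambda>t. (cmod (P (\<gamma> t)))\<^sup>2) absolutely_integrable_on W"
    by (rule set_integrable_subset) (use mW in \<open>auto simp: W_def\<close>)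
  then have iW: "(\<lambda>t. (cmod (P (\<gamma> t)))\<^sup>2) integrable_on W"
    using set_lebesgue_integral_eq_integral(1) by blast
  have "s\<^sup>2 * measure lebesgue W = integral W (\<lambda>x. s\<^sup>2)"
    using mW by (simp add: lmeasure_integral flip: integral_mult_right)
  also have "\<dots> \<le> integral W (\<lambda>t. (cmod (P (\<gamma> t)))\<^sup>2)"
  proof (rule integral_le)
    show "(\<lambda>x. s\<^sup>2) integrable_on W" using mW by (simp add: integrable_on_const)
    show "(\<lambda>t. (cmod (P (\<gamma> t)))\<^sup>2) integrable_on W" by (rule iW)
    show "s\<^sup>2 \<le> (cmod (P (\<gamma> t)))\<^sup>2" if "t \<in> W" for t
      using that s by (intro power_mono) (auto simp: W_def)
  qed
  also have "\<dots> \<le> integral {0..l} (\<lambda>t. (cmod (P (\<gamma> t)))\<^sup>2)"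
  proof (rule integral_subset_le)
    show "W \<subseteq> {0..l}" by (auto simp: W_def)
    show "(\<lambda>t. (cmod (P (\<gamma> t)))\<^sup>2) integrable_on W" by (rule iW)
    show "(\<lambda>t. (cmod (P (\<gamma> t)))\<^sup>2) integrable_on {0..l}"
      using cP2 by (rule integrable_continuous_real)
  qed auto
  also have "\<dots> \<le> s\<^sup>2 * (l / 2)" using mean by (simp add: P_def)
  finally have W2: "measure lebesgue W \<le> l / 2" using s by simp
  have "l = measure lebesgue {0..l}" using l by simp
  also have "\<dots> \<le> measure lebesgue (W \<union> (\<Union>c\<in>E. Hc c))"
    using cover mW cH finE by (intro measure_mono_fmeasurable fmeasurable.Un fmeasurable.finite_UN) auto
  also have "\<dots> \<le> measure lebesgue W + measure lebesgue (\<Union>c\<in>E. Hc c)"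
    using mW cH finE by (intro measure_Un_le) (auto intro: fmeasurableD)
  also have "\<dots> \<le> l / 2 + (\<Sum>c\<in>E. measure lebesgue (Hc c))"
    using W2 cH finE by (intro add_mono measure_UNION_le) (auto intro: fmeasurableD)
  finally show ?thesis by (simp add: Hc_def)
qed

text \<open>Gathers what the parameters have to satisfy, before any exponents are chosen. Smallness
  is relative to the largest coefficient A: with s = \<sigma> A, the condition \<open>osc\<close>
  makes the mean square over each arc at most s^2 / 2.\<close>

lemma nodal_arcs_length_bound:
  fixes F :: "torus2 set set" and \<sigma> \<rho> R W :: real and N :: nat
  assumes lam: "0 < lam" and eig: "laplace_eigenfunction (lam\<^sup>2) \<phi>"
    and F: "finite F" "pairwise disjnt F"
    and arcs: "\<And>C. C \<in> F \<Longrightarrow> regular_arc C \<and> C \<subseteq> nodal_set \<phi> \<and> W < arc_width C"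
    and L: "0 < L" and R: "0 < R" and RL: "2 * (real (2 * L + 1) * R) < lam powr (real L / real (2 * L + 1))"
    and N: "N = card (frequencies (lam\<^sup>2))"
    and M: "2 < M" "(1 + 2 * pi * lam * (1 / M)) ^ N < 2"
    and \<sigma>: "0 < \<sigma>" "real (2 * L) * (2 * pi * (real (2 * L + 1) * R * (2 * (1 / M)))) \<le> \<sigma>"
    and \<rho>: "0 < \<rho>" "\<rho> \<le> 1" "2 * \<sigma> \<le> (\<rho> / 64) ^ (4 ^ (2 * L))"
      "2 * (real (2 * L + 1) * R) / M \<le> (\<rho> / 64) ^ (4 ^ (2 * L))"
    and osc: "\<And>l \<kappa>. 0 < l \<Longrightarrow> 0 < \<kappa> \<Longrightarrow> 2 * \<kappa> * l < 1 \<Longrightarrow> W < 2 * \<kappa> * l\<^sup>2 \<Longrightarrow>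
      (real N)\<^sup>2 * (4 / R + 8 / sqrt (\<kappa> * R)) \<le> \<sigma>\<^sup>2 * (l / 2)"
  shows "(\<Sum>C\<in>F. arc_length C) \<le> 360 * real N * \<rho> * real M"
proof -
  define \<Omega> where "\<Omega> = frequencies (lam\<^sup>2)"
  have fin: "finite \<Omega>" unfolding \<Omega>_def by (rule finite_frequencies)
  obtain a x0 where a: "\<And>x. of_real (\<phi> x) = (\<Sum>\<xi>\<in>\<Omega>. a \<xi> * torus_char \<xi> x)" and x0: "\<phi> x0 \<noteq> 0"
    using eig unfolding laplace_eigenfunction_def \<Omega>_def by blast
  have "\<exists>\<xi>\<in>\<Omega>. a \<xi> \<noteq> 0"
  proof (rule ccontr)
    assume "\<not> ?thesis"
    then have "complex_of_real (\<phi> x0) = 0" unfolding a by (intro sum.neutral) auto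
    then show False using x0 by simp
  qed
  then obtain \<xi>1 where \<xi>1: "\<xi>1 \<in> \<Omega>" "a \<xi>1 \<noteq> 0" by blast
  define A where "A = Max ((\<lambda>\<xi>. cmod (a \<xi>)) ` \<Omega>)"
  have A: "cmod (a \<xi>) \<le> A" if "\<xi> \<in> \<Omega>" for \<xi> unfolding A_def using fin that by (intro Max_ge) auto
  have A0: "0 < A" using A[OF \<xi>1(1)] \<xi>1(2) by (smt (verit) zero_less_norm_iff)
  have "A \<in> (\<lambda>\<xi>. cmod (a \<xi>)) ` \<Omega>" unfolding A_def using fin \<xi>1 by (intro Max_in) auto
  then obtain \<xi>0 where \<xi>0: "\<xi>0 \<in> \<Omega>" "cmod (a \<xi>0) = A" by auto
  define D where "D = real (2 * L + 1) * R"
  have D0: "0 < D" using R by (simp add: D_def)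
  obtain K where K: "K \<subseteq> \<Omega>" "\<xi>0 \<in> K" "card K \<le> 2 * L"
    "\<And>\<xi>. \<xi> \<in> K \<Longrightarrow> norm (frequency_vec \<xi> - frequency_vec \<xi>0) \<le> D"
    "\<And>\<xi> \<eta>. \<xi> \<in> K \<Longrightarrow> \<eta> \<in> \<Omega> - K \<Longrightarrow> R < norm (frequency_vec \<eta> - frequency_vec \<xi>)"
    using separated_cluster_exists[OF lam L R RL \<xi>0(1)[unfolded \<Omega>_def]] unfolding \<Omega>_def D_def by blast
  have finK: "finite K" using K(1) fin finite_subset by blast
  define P where "P x = trig_sum a K x" for x
  define s where "s = \<sigma> * A"
  have s: "0 < s" using \<sigma> A0 by (simp add: s_def)
  have M0: "0 < M" using M by simp
  define G where "G = {0..<int M} \<times> {0..<int M}"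
  \<comment> \<open>The threshold at the grid point is twice s because the modulus changes by at
    most s within a square.\<close>
  define E where "E = {c\<in>G. cmod (P (grid M c)) < 2 * s}"
  have EG: "E \<subseteq> {0..<int M} \<times> {0..<int M}" by (auto simp: E_def G_def)
  have h: "0 \<le> 1 / real M" "1 / real M < 1 / 2" "0 < 1 / real M" using M by auto
  have large: "s \<le> cmod (P x)" if c: "c \<in> {0..<int M} \<times> {0..<int M} - E" and x: "x \<in> square (grid M c) (1 / M)" for c x
  proof -
    have "2 * s \<le> cmod (P (grid M c))" using c by (auto simp: E_def G_def)
    moreover have "cmod (P (grid M c)) - cmod (P x) \<le> real (2 * L) * (A * (2 * pi * (D * (2 * (1 / M)))))"
      unfolding P_def
      by (rule cluster_sum_variation[OF finK K(3,4)]) (use A K(1) square_norm_le[OF x] A0 D0 in auto)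
    moreover have "real (2 * L) * (A * (2 * pi * (D * (2 * (1 / M))))) \<le> s"
      using mult_left_mono[OF \<sigma>(2), of A] A0 by (simp add: s_def D_def mult_ac)
    ultimately show ?thesis by linarith
  qed
  have cardE: "real (card E) \<le> \<rho> * (real (2 * M + 1))\<^sup>2"
  proof (rule sparse_small_values[OF M0 finK])
    show "card K \<le> Suc (2 * L)" using K(3) by simp
    show "norm (frequency_vec \<xi> - frequency_vec \<eta>) \<le> 2 * D" if "\<xi> \<in> K" "\<eta> \<in> K" for \<xi> \<eta>
      using norm_triangle_ineq4[of "frequency_vec \<xi> - frequency_vec \<xi>0" "frequency_vec \<eta> - frequency_vec \<xi>0"] K(4)[OF that(1)] K(4)[OF that(2)]
      by simp
    show "2 * D / real M \<le> (\<rho> / 64) ^ 4 ^ (2 * L)" using \<rho>(4) by (simp add: D_def)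
    show "\<exists>\<xi>\<in>K. A \<le> cmod (a \<xi>)" using K(2) \<xi>0(2) by force
    fix c assume "c \<in> E"
    then have "cmod (P (grid M c)) < 2 * s" by (simp add: E_def)
    also have "\<dots> \<le> (\<rho> / 64) ^ 4 ^ (2 * L) * A"
      using mult_right_mono[OF \<rho>(3), of A] A0 by (simp add: s_def)
    finally show "cmod (trig_sum a K (grid M c)) < (\<rho> / 64) ^ 4 ^ (2 * L) * A"
      by (simp add: P_def)
  qed (use \<rho> EG A0 in auto)
  have "\<forall>C. \<exists>w. C \<in> F \<longrightarrow> arc_lift C (fst w) (snd w)"
    using arcs unfolding regular_arc_def by auto
  from choice[OF this] obtain w where w: "\<And>C. C \<in> F \<Longrightarrow> arc_lift C (fst (w C)) (snd (w C))" by blast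
  define l \<gamma> where "l C = fst (w C)" and "\<gamma> C = snd (w C)" for C
  have lift: "arc_lift C (l C) (\<gamma> C)" if "C \<in> F" for C using w[OF that] by (simp add: l_def \<gamma>_def)
  define h where "h = 1 / real M"
  have len: "l C \<le> 2 * (\<Sum>c\<in>E. measure lebesgue (hits (\<gamma> C) (square (grid M c) h) {0..l C}))" if C: "C \<in> F" for C
  proof -
    obtain \<kappa> \<gamma>' \<gamma>'' where r: "regular_curve (l C) \<kappa> (\<gamma> C) \<gamma>' \<gamma>''"
      using regular_param_curve lift[OF C] unfolding arc_lift_def by metis
    interpret regular_curve "l C" \<kappa> "\<gamma> C" \<gamma>' \<gamma>'' by (rule r)
    have "W < width (\<gamma> C ` {0..l C})" using arcs[OF C] arc_width_eq[OF lift[OF C]] by simp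
    then have W: "W < 2 * \<kappa> * (l C)\<^sup>2" using width_le by linarith
    have "integral {0..l C} (\<lambda>t. (cmod (trig_sum a K (\<gamma> C t)))\<^sup>2)
      \<le> (real (card \<Omega>))\<^sup>2 * A\<^sup>2 * (4 / R + 8 / sqrt (\<kappa> * R))"
    proof (rule cluster_mean_square[OF fin K(1) R _ K(5) A])
      fix t assume "t \<in> {0..l C}"
      then have "torus_proj (\<gamma> C t) \<in> C" using lift[OF C] unfolding arc_lift_def by blast
      then have "\<phi> (torus_proj (\<gamma> C t)) = 0" using arcs[OF C] by (auto simp: nodal_set_def)
      then show "trig_sum a \<Omega> (\<gamma> C t) = 0"
        using a[of "torus_proj (\<gamma> C t)"] by (simp add: torus_char_proj)
    qed auto
    also have "\<dots> = A\<^sup>2 * ((real N)\<^sup>2 * (4 / R + 8 / sqrt (\<kappa> * R)))" by (simp add: N \<Omega>_def mult_ac)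
    also have "\<dots> \<le> A\<^sup>2 * (\<sigma>\<^sup>2 * (l C / 2))"
      using osc[OF l(1) \<kappa>(1) \<kappa>(4) W] by (rule mult_left_mono) simp
    also have "\<dots> = s\<^sup>2 * (l C / 2)" by (simp add: s_def power_mult_distrib)
    finally show ?thesis
      using length_le_bad_squares[OF M(1) s finK EG large[unfolded P_def]] by (simp add: h_def)
  qed
  have sq: "(\<Sum>C\<in>F. measure lebesgue (hits (\<gamma> C) (square (grid M c) h) {0..l C})) \<le> 20 * real N * h" for c
  proof (rule arcs_in_square_length[OF F lift])
    show "C \<in> F \<Longrightarrow> C \<subseteq> nodal_set \<phi>" for C using arcs by blast
    show "\<exists>X. finite X \<and> (\<forall>x\<in>{grid M c $ i..grid M c $ i + h} - X.
        finite (chord (nodal_set \<phi>) (grid M c) h i x) \<and>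
        card (chord (nodal_set \<phi>) (grid M c) h i x) \<le> N)" for i
      unfolding N by (rule nodal_points_on_lines[OF _ a[unfolded \<Omega>_def] x0]) (use lam M N in \<open>auto simp: h_def\<close>)
  qed (use M in \<open>auto simp: h_def\<close>)
  have "(\<Sum>C\<in>F. arc_length C) = (\<Sum>C\<in>F. l C)"
    using arc_length_eq[OF lift] by (intro sum.cong) auto
  also have "\<dots> \<le> (\<Sum>C\<in>F. 2 * (\<Sum>c\<in>E. measure lebesgue (hits (\<gamma> C) (square (grid M c) h) {0..l C})))"
    by (intro sum_mono len)
  \<comment> \<open>Interchanging the sums lets the disjointness of the arcs act inside each single
    square.\<close>
  also have "\<dots> = 2 * (\<Sum>c\<in>E. \<Sum>C\<in>F. measure lebesgue (hits (\<gamma> C) (square (grid M c) h) {0..l C}))"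
    by (subst sum.swap) (simp add: sum_distrib_left)
  also have "\<dots> \<le> 2 * (\<Sum>c\<in>E. 20 * real N * h)" by (intro mult_left_mono sum_mono sq) auto
  also have "\<dots> = 40 * real N * h * real (card E)" by simp
  also have "\<dots> \<le> 40 * real N * h * (\<rho> * (real (2 * M + 1))\<^sup>2)"
    using cardE by (intro mult_left_mono) (auto simp: h_def)
  also have "\<dots> \<le> 40 * real N * h * (\<rho> * (3 * real M)\<^sup>2)"
    using \<rho>(1) M by (intro mult_left_mono power_mono) (auto simp: h_def)
  also have "\<dots> = 360 * real N * \<rho> * real M" using M0 by (simp add: h_def power2_eq_square field_simps)
  finally show ?thesis .
qed

section \<open>The length estimate\<close>

lemma eventually_powr_less:
  fixes a b C :: real
  assumes "a < b" shows "eventually (\<lambda>x. C * x powr a < x powr b) at_top"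
proof -
  have "filterlim (\<lambda>x::real. x powr (b - a)) at_top at_top"
    using assms by (intro real_powr_at_top) auto
  then have "eventually (\<lambda>x::real. C < x powr (b - a)) at_top"
    by (simp add: filterlim_at_top_dense)
  then show ?thesis using eventually_gt_at_top[of 0]
  proof eventually_elim
    case (elim x)
    then have "C * x powr a < x powr (b - a) * x powr a" by (intro mult_strict_right_mono) auto
    then show ?case by (simp flip: powr_add)
  qed
qed

text \<open>The constant 0.65 lies below 2/3 <= ln 2 and above 2 pi / 10, the value that will
  occur.\<close>

lemma power_one_plus_less_2:
  fixes x :: real
  assumes "0 \<le> x" "real N * x \<le> 65 / 100" shows "(1 + x) ^ N < 2"
proof -
  have "(1 + x) ^ N \<le> exp x ^ N" using assms by (intro power_mono exp_ge_add_one_self) auto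
  also have "\<dots> = exp (real N * x)" by (simp add: exp_of_nat_mult)
  also have "\<dots> < exp (ln 2)" using assms ln2_ge_two_thirds by (subst exp_less_cancel_iff) linarith
  finally show ?thesis by simp
qed

text \<open>Let W = lam^(-1/2 + e) and R = lam^(1/2 - e/2). As 2 \<kappa> l < 1, the width condition
  gives l > W, which controls 1 / R. It also gives \<kappa> > W / (2 l^2), hence \<kappa> R >
  lam^(e/2) / (2 l^2), which controls the square root.\<close>

lemma oscillation_parameters:
  fixes e lam l \<kappa> :: real
  assumes lam: "1 \<le> lam" and e: "0 < e" and l: "0 < l" "0 < \<kappa>" "2 * \<kappa> * l < 1"
    and W: "lam powr (- 1 / 2 + e) < 2 * \<kappa> * l\<^sup>2"
  shows "4 / lam powr (1 / 2 - e / 2) + 8 / sqrt (\<kappa> * lam powr (1 / 2 - e / 2)) \<le> 20 * lam powr (- e / 4) * l"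
proof -
  have "2 * \<kappa> * l\<^sup>2 = (2 * \<kappa> * l) * l" by (simp add: power2_eq_square)
  also have "\<dots> \<le> 1 * l" using l by (intro mult_right_mono) auto
  finally have Wl: "lam powr (- 1 / 2 + e) \<le> l" using W by simp
  have "4 / lam powr (1 / 2 - e / 2) = 4 * lam powr (- 1 / 2 + e / 2)"
  proof -
    have "- 1 / 2 + e / 2 = - (1 / 2 - e / 2)" by simp
    then show ?thesis by (simp only: powr_minus_divide mult_1_right times_divide_eq_right)
  qed
  also have "\<dots> = 4 * (lam powr (- e / 2) * lam powr (- 1 / 2 + e))" by (simp flip: powr_add)
  also have "\<dots> \<le> 4 * (lam powr (- e / 4) * l)"
    using lam e Wl by (intro mult_left_mono mult_mono powr_mono) auto
  finally have 1: "4 / lam powr (1 / 2 - e / 2) \<le> 4 * (lam powr (- e / 4) * l)" .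
  have "lam powr (e / 4) / (2 * l) \<le> sqrt (\<kappa> * lam powr (1 / 2 - e / 2))"
  proof (rule real_le_rsqrt)
    have "(lam powr (e / 4) / (2 * l))\<^sup>2 = (lam powr (e / 4))\<^sup>2 / (4 * l\<^sup>2)"
      by (simp add: power_divide power_mult_distrib)
    also have "(lam powr (e / 4))\<^sup>2 = lam powr (e / 2)"
      by (simp add: power2_eq_square flip: powr_add)
    also have "lam powr (e / 2) / (4 * l\<^sup>2) \<le> lam powr (e / 2) / (2 * l\<^sup>2)"
      using l by (intro divide_left_mono) auto
    also have "\<dots> = lam powr (- 1 / 2 + e) / (2 * l\<^sup>2) * lam powr (1 / 2 - e / 2)"
      by (simp flip: powr_add)
    also have "\<dots> \<le> \<kappa> * lam powr (1 / 2 - e / 2)"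
      using W l by (intro mult_right_mono) (auto simp: pos_divide_le_eq mult_ac)
    finally show "(lam powr (e / 4) / (2 * l))\<^sup>2 \<le> \<kappa> * lam powr (1 / 2 - e / 2)" .
  qed
  moreover have p: "0 < lam powr (e / 4) / (2 * l)" using lam l by simp
  ultimately have "8 / sqrt (\<kappa> * lam powr (1 / 2 - e / 2)) \<le> 8 / (lam powr (e / 4) / (2 * l))"
    by (intro divide_left_mono mult_pos_pos) (use lam l in auto)
  also have "\<dots> = 16 * (lam powr (- e / 4) * l)"
  proof -
    have "lam powr (- e / 4) = 1 / lam powr (e / 4)" using powr_minus_divide[of lam "e / 4"] by simp
    then show ?thesis by simp
  qed
  finally show ?thesis using 1 by (simp add: mult_ac)
qed

theorem theorem2:
  shows "\<forall>\<epsilon>>0. \<exists>\<delta>>0. \<exists>lam0>0. \<forall>lam>lam0. \<forall>\<phi> (\<C> :: torus2 set set).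
    laplace_eigenfunction (lam\<^sup>2) \<phi> \<longrightarrow>
    (\<forall>C\<in>\<C>. regular_arc C \<and> C \<subseteq> nodal_set \<phi> \<and> arc_width C > lam powr (- 1/2 + \<epsilon>)) \<longrightarrow>
    pairwise disjnt \<C> \<longrightarrow>
    arc_length summable_on \<C> \<and> (\<Sum>\<^sub>\<infinity>C\<in>\<C>. arc_length C) < lam powr (1 - \<delta>)"
proof (intro allI impI)
  fix \<epsilon> :: real assume \<epsilon>: "0 < \<epsilon>"
  define e where "e = min \<epsilon> (1 / 4)"
  have e: "0 < e" "e \<le> \<epsilon>" "e \<le> 1 / 4" using \<epsilon> by (auto simp: e_def)
  \<comment> \<open>L e > 1 puts L / (2 L + 1) above 1/2 - e/2, so that the separation radius
    lam^(1/2 - e/2) is admissible for clusters.\<close>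
  define L where "L = nat \<lceil>1 / e\<rceil> + 1"
  have L: "0 < L" "1 / e < real L"
    by (simp_all add: L_def) linarith
  define P :: nat where "P = 4 ^ (2 * L)"
  \<comment> \<open>With \<rho> = lam^(- c) this gives \<rho>^P = lam^(- e/32), which has to exceed
    2 * 64^P \<sigma> for \<sigma> = lam^(- e/16); in turn \<sigma>^2 = lam^(- e/8) has to exceed 40
    N^2 lam^(- e/4).\<close>
  define c where "c = e / (32 * real P)"
  have P: "1 \<le> real P" by (simp add: P_def)
  have c: "0 < c" "c \<le> e / 32" "c * real P = e / 32"
    using e P by (auto simp: c_def divide_simps)
  define B where "B = real (2 * L + 1)"
  have B: "0 < B" by (simp add: B_def)
  have expL: "1 / 2 - e / 2 < real L / B"
  proof -
    have "1 < real L * e" using L(2) e by (simp add: pos_divide_less_eq)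
    then show ?thesis using e B by (simp add: B_def field_simps)
  qed
  \<comment> \<open>The exponent c / 8 yields N <= lam^(c / 4) once lam absorbs C; the two factors N
    in the final bound then cost only half of the saving lam^(- c).\<close>
  obtain C where C: "C > 0" "\<And>lam. lam > 0 \<Longrightarrow> real (card (frequencies (lam\<^sup>2))) \<le> C * lam powr (c / 8)"
    using card_frequencies_bound[of "c / 8"] c(1) by auto
  have "eventually (\<lambda>lam. 10 \<le> lam \<and>
      C * lam powr (c / 8) < lam powr (c / 4) \<and>
      (2 * B) * lam powr (1 / 2 - e / 2) < lam powr (real L / B) \<and>
      (real (2 * L) * (2 * pi * (B * 2))) * lam powr (- 1 / 2 - e / 2) < lam powr (- e / 16) \<and>
      (2 * 64 ^ P) * lam powr (- e / 16) < lam powr (- e / 32) \<and>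
      (2 * B * 64 ^ P) * lam powr (- 1 / 2 - e / 2) < lam powr (- e / 32) \<and>
      40 * lam powr (c / 2 - e / 4) < lam powr (- e / 8) \<and>
      3960 * lam powr (1 - c / 2) < lam powr (1 - c / 4)) at_top" (is "eventually ?large at_top")
    using e c expL
    by (intro eventually_conj eventually_ge_at_top eventually_powr_less) auto
  then obtain lam1 where lam1: "\<And>lam. lam1 \<le> lam \<Longrightarrow> ?large lam"
    unfolding eventually_at_top_linorder by blast
  have main: "arc_length summable_on \<C> \<and> (\<Sum>\<^sub>\<infinity>C\<in>\<C>. arc_length C) < lam powr (1 - c / 4)"
    if lam: "lam > max lam1 1" and eig: "laplace_eigenfunction (lam\<^sup>2) \<phi>"
      and arcs: "\<forall>C\<in>\<C>. regular_arc C \<and> C \<subseteq> nodal_set \<phi> \<and> arc_width C > lam powr (- 1/2 + \<epsilon>)"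
      and dis: "pairwise disjnt \<C>" for lam \<phi> and \<C> :: "torus2 set set"
  proof -
    have lam10: "10 \<le> lam" and
      Cc: "C * lam powr (c / 8) < lam powr (c / 4)" and
      RL: "(2 * B) * lam powr (1 / 2 - e / 2) < lam powr (real L / B)" and
      s1: "(real (2 * L) * (2 * pi * (B * 2))) * lam powr (- 1 / 2 - e / 2) < lam powr (- e / 16)" and
      r1: "(2 * 64 ^ P) * lam powr (- e / 16) < lam powr (- e / 32)" and
      r2: "(2 * B * 64 ^ P) * lam powr (- 1 / 2 - e / 2) < lam powr (- e / 32)" and
      o1: "40 * lam powr (c / 2 - e / 4) < lam powr (- e / 8)" and
      fin: "3960 * lam powr (1 - c / 2) < lam powr (1 - c / 4)"
      using lam1[of lam] lam by simp_all
    have lam0: "0 < lam" using lam10 by simp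
    define N where "N = card (frequencies (lam\<^sup>2))"
    have "frequencies (lam\<^sup>2) \<noteq> {}"
      using eig unfolding laplace_eigenfunction_def by force
    then have N1: "1 \<le> N" using finite_frequencies by (simp add: N_def Suc_le_eq card_gt_0_iff)
    have Nc: "real N \<le> lam powr (c / 4)" using C(2)[OF lam0] Cc by (simp add: N_def)
    \<comment> \<open>The factor 10 gives 2 pi N lam / M <= 2 pi / 10 < 0.65, which is what counting
      zeros on lines requires.\<close>
    define M where "M = nat \<lceil>10 * real N * lam\<rceil>"
    have Nl: "lam \<le> real N * lam" using N1 lam0 by simp
    have Mlo: "10 * real N * lam \<le> real M" unfolding M_def by linarith
    have "real M \<le> 10 * real N * lam + 1" unfolding M_def using Nl lam0 by linarith
    then have Mhi: "real M \<le> 11 * real N * lam" using Nl lam10 by linarith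
    have M100: "100 \<le> real M" using Mlo Nl lam10 by linarith
    have Mlam: "lam \<le> real M" using Mlo Nl lam0 by linarith
    define R where "R = lam powr (1 / 2 - e / 2)"
    define \<sigma> where "\<sigma> = lam powr (- e / 16)"
    define \<rho> where "\<rho> = lam powr (- c)"
    define W where "W = lam powr (- 1 / 2 + e)"
    have RM: "R / real M \<le> lam powr (- 1 / 2 - e / 2)"
    proof -
      have "R / real M \<le> R / lam" using Mlam lam0 by (intro divide_left_mono) (auto simp: R_def)
      also have "\<dots> = lam powr (1 / 2 - e / 2) * lam powr (- 1)"
        using lam0 by (simp add: R_def powr_neg_one)
      also have "\<dots> = lam powr (- 1 / 2 - e / 2)" by (simp only: powr_add[symmetric]) simp
      finally show ?thesis .
    qed
    have \<rho>P: "(\<rho> / 64) ^ P = lam powr (- e / 32) / 64 ^ P"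
    proof -
      have "\<rho> ^ P = \<rho> powr real P" using lam0 by (intro powr_realpow[symmetric]) (simp add: \<rho>_def)
      then have "\<rho> ^ P = lam powr (- c * real P)" by (simp only: \<rho>_def powr_powr)
      then show ?thesis using c(3) by (simp add: power_divide)
    qed
    \<comment> \<open>Uniform over finite subfamilies, so it yields summability together with the
      bound for the infinite sum. The constant is absorbed at the end by weakening the exponent to 1
      - c / 4.\<close>
    have bound: "(\<Sum>C\<in>F. arc_length C) \<le> 3960 * lam powr (1 - c / 2)" if F: "finite F" "F \<subseteq> \<C>" for F
    proof -
      have "(\<Sum>C\<in>F. arc_length C) \<le> 360 * real N * \<rho> * real M"
      proof (rule nodal_arcs_length_bound[OF lam0 eig F(1), where L = L and R = R and W = W and \<sigma> = \<sigma>])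
        show "pairwise disjnt F" using dis F(2) pairwise_subset by blast
        show "regular_arc C \<and> C \<subseteq> nodal_set \<phi> \<and> W < arc_width C" if "C \<in> F" for C
        proof -
          have "W \<le> lam powr (- 1/2 + \<epsilon>)" unfolding W_def using e lam10 by (intro powr_mono) auto
          then show ?thesis using arcs F(2) that by fastforce
        qed
        show "2 * (real (2 * L + 1) * R) < lam powr (real L / real (2 * L + 1))"
          using RL unfolding R_def B_def by (simp only: mult.assoc)
        show "N = card (frequencies (lam\<^sup>2))" by (rule N_def)
        show "2 < M" using M100 by simp
        show "(1 + 2 * pi * lam * (1 / real M)) ^ N < 2"
        proof (rule power_one_plus_less_2)
          have "real N * (2 * pi * lam * (1 / real M)) = (2 * pi) * (real N * lam / real M)" by simp
          also have "\<dots> \<le> (2 * pi) * (1 / 10)"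
            using Mlo M100 by (intro mult_left_mono) (auto simp: pos_divide_le_eq)
          also have "\<dots> \<le> 65 / 100" using pi_approx by simp
          finally show "real N * (2 * pi * lam * (1 / real M)) \<le> 65 / 100" .
        qed (use lam0 in auto)
        show "real (2 * L) * (2 * pi * (real (2 * L + 1) * R * (2 * (1 / real M)))) \<le> \<sigma>"
        proof -
          have "real (2 * L) * (2 * pi * (real (2 * L + 1) * R * (2 * (1 / real M)))) = (real (2 * L) * (2 * pi * (B * 2))) * (R / real M)"
            by (simp add: B_def)
          also have "\<dots> \<le> (real (2 * L) * (2 * pi * (B * 2))) * lam powr (- 1 / 2 - e / 2)"
            using RM B by (intro mult_left_mono) auto
          finally show ?thesis using s1 by (simp add: \<sigma>_def)
        qed
        show "\<rho> \<le> 1" using lam10 c powr_mono[of "- c" 0 lam] by (simp add: \<rho>_def)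
        show "2 * \<sigma> \<le> (\<rho> / 64) ^ 4 ^ (2 * L)"
          using r1 unfolding P_def[symmetric] \<rho>P by (simp add: \<sigma>_def pos_le_divide_eq mult_ac)
        show "2 * (real (2 * L + 1) * R) / real M \<le> (\<rho> / 64) ^ 4 ^ (2 * L)"
        proof -
          have "2 * (real (2 * L + 1) * R) / real M * 64 ^ P = (2 * B * 64 ^ P) * (R / real M)" by (simp add: B_def)
          also have "\<dots> \<le> (2 * B * 64 ^ P) * lam powr (- 1 / 2 - e / 2)"
            using RM B by (intro mult_left_mono) auto
          finally show ?thesis using r2 unfolding P_def[symmetric] \<rho>P by (simp add: pos_le_divide_eq)
        qed
        fix l \<kappa> :: real
        assume l: "0 < l" "0 < \<kappa>" "2 * \<kappa> * l < 1" "W < 2 * \<kappa> * l\<^sup>2"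
        have "4 / R + 8 / sqrt (\<kappa> * R) \<le> 20 * lam powr (- e / 4) * l"
          unfolding R_def by (rule oscillation_parameters) (use lam10 e l in \<open>auto simp: W_def\<close>)
        moreover have "(real N)\<^sup>2 \<le> lam powr (c / 2)"
        proof -
          have "(real N)\<^sup>2 \<le> (lam powr (c / 4))\<^sup>2" using Nc by (intro power_mono) auto
          then show ?thesis by (simp add: power2_eq_square flip: powr_add)
        qed
        ultimately have "(real N)\<^sup>2 * (4 / R + 8 / sqrt (\<kappa> * R)) \<le> lam powr (c / 2) * (20 * lam powr (- e / 4) * l)"
          using l by (intro mult_mono) (auto simp: R_def)
        also have "\<dots> = 40 * lam powr (c / 2 - e / 4) * (l / 2)"
        proof -
          have "lam powr (c / 2 - e / 4) = lam powr (c / 2) * lam powr (- e / 4)"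
            by (simp only: powr_add[symmetric]) simp
          then show ?thesis by simp
        qed
        also have "\<dots> \<le> lam powr (- e / 8) * (l / 2)" using o1 l by (intro mult_right_mono) auto
        also have "lam powr (- e / 8) = \<sigma>\<^sup>2" by (simp add: \<sigma>_def power2_eq_square flip: powr_add)
        finally show "(real N)\<^sup>2 * (4 / R + 8 / sqrt (\<kappa> * R)) \<le> \<sigma>\<^sup>2 * (l / 2)" .
      qed (use L lam0 in \<open>auto simp: R_def \<sigma>_def \<rho>_def\<close>)
      also have "\<dots> \<le> 360 * lam powr (c / 4) * \<rho> * (11 * lam powr (c / 4) * lam)"
      proof (intro mult_mono)
        show "real M \<le> 11 * lam powr (c / 4) * lam"
        proof -
          have "11 * real N * lam \<le> 11 * lam powr (c / 4) * lam"
            using Nc lam0 by (intro mult_right_mono mult_left_mono) auto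
          then show ?thesis using Mhi by (rule order_trans[rotated])
        qed
      qed (use Nc lam0 in \<open>auto simp: \<rho>_def\<close>)
      also have "\<dots> = 3960 * (lam powr (c / 4) * lam powr (- c) * lam powr (c / 4) * lam powr 1)"
        using lam0 by (simp add: \<rho>_def)
      also have "\<dots> = 3960 * lam powr (1 - c / 2)" by (simp only: powr_add[symmetric]) simp
      finally show ?thesis .
    qed
    have nn: "0 \<le> arc_length C" if "C \<in> \<C>" for C
    proof -
      have "regular_arc C" using arcs that by blast
      then obtain l \<gamma> where lift: "arc_lift C l \<gamma>" unfolding regular_arc_def by blast
      then have "0 < l" by (simp add: arc_lift_def regular_param_def)
      then show ?thesis using arc_length_eq[OF lift] by simp
    qed
    have "arc_length summable_on \<C>"
      by (rule nonneg_bdd_above_summable_on[OF nn])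
        (auto intro!: bdd_aboveI2[of _ _ "3960 * lam powr (1 - c / 2)"] bound)
    moreover have "(\<Sum>\<^sub>\<infinity>C\<in>\<C>. arc_length C) \<le> 3960 * lam powr (1 - c / 2)"
      using calculation by (rule infsum_le_finite_sums) (rule bound)
    ultimately show ?thesis using fin by simp
  qed
  show "\<exists>\<delta>>0. \<exists>lam0>0. \<forall>lam>lam0. \<forall>\<phi> (\<C> :: torus2 set set).
    laplace_eigenfunction (lam\<^sup>2) \<phi> \<longrightarrow>
    (\<forall>C\<in>\<C>. regular_arc C \<and> C \<subseteq> nodal_set \<phi> \<and> arc_width C > lam powr (- 1/2 + \<epsilon>)) \<longrightarrow>
    pairwise disjnt \<C> \<longrightarrow>
    arc_length summable_on \<C> \<and> (\<Sum>\<^sub>\<infinity>C\<in>\<C>. arc_length C) < lam powr (1 - \<delta>)"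
    using c by (intro exI[of _ "c / 4"] conjI exI[of _ "max lam1 1"]) (use main in auto)
qed

end
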